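(* There is a natural $*$-algebra quotient $\mathbb{C}[S^4]$ of $\mathbb{C}[\mathbb{CM}^\#]$ defined by the additional relations $x^*=x$ (i.e. $x_i^*=x_i$ for $i=1,2,3$), $t^*=t$ and $\alpha=\delta=0$ (vanishing of all components of the vectors $\alpha,\delta$). Under this quotient the tautological projector $P$ of $\mathbb{C}[\mathbb{CM}^\#]$ becomes \[ e=\begin{pmatrix} a & t+\imath x\cdot\sigma \\ t-\imath x\cdot\sigma & 1-a\end{pmatrix}\in M_4(\mathbb{C}[S^4]) \] (written in $2\times 2$ blocks). The Grassmann connection on the projective module $\mathcal{E}=\mathbb{C}[S^4]^4e$ is the 1-instanton, with local form (where $1-2a$ is invertible) \[ (F\wedge F)(\tilde v\cdot e)=-4!\,\frac{\mathrm{d}t\,\mathrm{d}^3x}{1-2a}\,\tilde v\cdot e \qquad\text{for all } \tilde v\in\mathbb{C}[S^4]^4 . \]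
   Context: $\mathbb{C}[\mathbb{CM}^\#]$ is the commutative unital $*$-algebra generated by the entries $P^\mu{}_\nu$ ($\mu,\nu=1,\dots,4$) of a matrix $P$ with relations $P^2=P$, $\mathrm{Tr}\,P=2$ and $*$-structure $(P^\mu{}_\nu)^*=P^\nu{}_\mu$ (i.e. $P=P^\dagger$); it is the coordinate algebra of the Grassmannian of $2$-planes in $\mathbb{C}^4$ viewed as a real manifold. In $2\times 2$ blocks \[ P=\begin{pmatrix} A & B \\ B^\dagger & D \end{pmatrix},\quad A=a+\alpha\cdot\sigma,\quad B=t+\imath x\cdot\sigma,\quad B^\dagger=t^*-\imath x^*\cdot\sigma,\quad D=1-a+\delta\cdot\sigma, \] where $\sigma=(\sigma_1,\sigma_2,\sigma_3)$ are the Pauli matrices (scalars are multiplied by the $2\times2$ identity), $a=a^*$, $\alpha=(\alpha_1,\alpha_2,\alpha_3)$ and $\delta=(\delta_1,\delta_2,\delta_3)$ have self-adjoint entries, and $t$, $x=(x_1,x_2,x_3)$ are not necessarily self-adjoint. For a projection $e\in M_n(\mathcal A)$ over an algebra $\mathcal A$ with classical differential forms, $\mathcal{E}=\mathcal A^ne$ is the module of row vectors $v=\tilde v\cdot e$, $\tilde v\in \mathcal A^n$. The Grassmann connection is $\nabla(\tilde v\cdot e)=(\mathrm{d}(\tilde v\cdot e))e$, with curvature $F=\nabla^2$, $F(\tilde v\cdot e)=(\tilde v\cdot \mathrm{d}e\cdot\mathrm{d}e)\cdot e$; $F\wedge F$ denotes $F$ applied twice, so $(F\wedge F)(\tilde v\cdot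 e)=\tilde v\cdot(\mathrm{d}e)^4\cdot e$. Here $\mathrm{d}^3x=\mathrm{d}x_1\wedge \mathrm{d}x_2\wedge \mathrm{d}x_3$, and wedge symbols are omitted. "The 1-instanton" means the basic instanton on $S^4$: the rank two bundle with connection whose curvature is anti-self-dual (for the appropriate orientation) with respect to the usual Hodge $*$-operator on $S^4$ and which has topological charge (second Chern number) of absolute value $1$. *)

theory Defs
  imports "HOL-Analysis.Analysis" "HOL-Library.Poly_Mapping" "HOL-Combinatorics.Permutations"
begin

section \<open>Commutative complex algebras and \<open>*\<close>-algebras\<close>

text \<open>\<open>scal\<close> is the structure map \<open>c \<mapsto> c \<cdot> 1\<close>.\<close>

class complex_algebra = comm_ring_1 +
  fixes scal :: "complex \<Rightarrow> 'a"
  assumes scal_one: "scal 1 = 1"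
    and scal_add: "scal (b + c) = scal b + scal c"
    and scal_mult: "scal (b * c) = scal b * scal c"

class star_algebra = complex_algebra +
  fixes star :: "'a \<Rightarrow> 'a"
  assumes star_star: "star (star f) = f"
    and star_add: "star (f + g) = star f + star g"
    and star_mult: "star (f * g) = star f * star g"
    and star_scal: "star (scal c) = scal (cnj c)"

instantiation complex :: star_algebra
begin
definition "scal_complex (c::complex) = c"
definition "star_complex (c::complex) = cnj c"
instance by standard (simp_all add: scal_complex_def star_complex_def)
end

definition alg_hom :: "('a::complex_algebra \<Rightarrow> 'b::complex_algebra) \<Rightarrow> bool" where
  "alg_hom h \<longleftrightarrow> (\<forall>f g. h (f + g) = h f + h g) \<and> (\<forall>f g. h (f * g) = h f * h g)
     \<and> (\<forall>c. h (scal c) = scal c)"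

definition star_alg_hom :: "('a::star_algebra \<Rightarrow> 'b::star_algebra) \<Rightarrow> bool" where
  "star_alg_hom h \<longleftrightarrow> alg_hom h \<and> (\<forall>f. h (star f) = star (h f))"

definition dagger :: "'a::star_algebra^'n^'n \<Rightarrow> 'a^'n^'n" where
  "dagger M = (\<chi> i j. star (M $ j $ i))"

inductive_set ideal_gen :: "'a::ring_1 set \<Rightarrow> 'a set" for R :: "'a set" where
  ideal_zero: "0 \<in> ideal_gen R"
| ideal_base: "r \<in> R \<Longrightarrow> r \<in> ideal_gen R"
| ideal_add: "u \<in> ideal_gen R \<Longrightarrow> v \<in> ideal_gen R \<Longrightarrow> u + v \<in> ideal_gen R"
| ideal_left: "u \<in> ideal_gen R \<Longrightarrow> w * u \<in> ideal_gen R"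
| ideal_right: "u \<in> ideal_gen R \<Longrightarrow> u * w \<in> ideal_gen R"

lemma ideal_uminus: "u \<in> ideal_gen R \<Longrightarrow> - u \<in> ideal_gen R"
  using ideal_left[of u R "- 1"] by simp

lemma ideal_diff: "u \<in> ideal_gen R \<Longrightarrow> v \<in> ideal_gen R \<Longrightarrow> u - v \<in> ideal_gen R"
  using ideal_add[of u R "- v"] ideal_uminus[of v R] by simp

lemma ideal_equivp: "equivp (\<lambda>u v. u - v \<in> ideal_gen R)"
proof (rule equivpI)
  show "reflp (\<lambda>u v. u - v \<in> ideal_gen R)" by (rule reflpI) (simp add: ideal_zero)
  show "symp (\<lambda>u v. u - v \<in> ideal_gen R)"
    by (rule sympI) (metis ideal_uminus minus_diff_eq)
  show "transp (\<lambda>u v. u - v \<in> ideal_gen R)"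
    by (rule transpI) (metis ideal_add diff_add_cancel add_diff_eq)
qed

lemma ideal_mult_cong:
  assumes "u - u' \<in> ideal_gen R" "v - v' \<in> ideal_gen R"
  shows "u * v - u' * v' \<in> ideal_gen R"
proof -
  have "u * v - u' * v' = (u - u') * v + u' * (v - v')" by (simp add: algebra_simps)
  then show ?thesis using assms by (simp add: ideal_add ideal_left ideal_right)
qed

lemma ideal_add_cong:
  assumes "u - u' \<in> ideal_gen R" "v - v' \<in> ideal_gen R"
  shows "(u + v) - (u' + v') \<in> ideal_gen R"
  using ideal_add[OF assms] by (simp add: algebra_simps)

lemma ideal_diff_cong:
  assumes "u - u' \<in> ideal_gen R" "v - v' \<in> ideal_gen R"
  shows "(u - v) - (u' - v') \<in> ideal_gen R"
  using ideal_diff[OF assms] by (simp add: algebra_simps)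

lemma ideal_uminus_cong:
  assumes "u - u' \<in> ideal_gen R"
  shows "(- u) - (- u') \<in> ideal_gen R"
  using ideal_uminus[OF assms] by (simp add: algebra_simps)

lemma ideal_gen_hom:
  assumes "u \<in> ideal_gen R"
    and "h 0 = 0" "\<And>u v. h (u + v) = h u + h v" "\<And>u v. h (u * v) = h u * h v"
    and "\<And>r. r \<in> R \<Longrightarrow> h r \<in> ideal_gen R'"
  shows "h u \<in> ideal_gen R'"
  using assms(1)
  by induction (simp_all add: assms(2-5) ideal_zero ideal_add ideal_left ideal_right)

lemma ideal_gen_hom_zero:
  assumes "u \<in> ideal_gen R"
    and "h 0 = 0" "\<And>u v. h (u + v) = h u + h v" "\<And>u v. h (u * v) = h u * (h v :: 'b::ring_1)"
    and "\<And>r. r \<in> R \<Longrightarrow> h r = 0"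
  shows "h u = 0"
  using assms(1) by induction (simp_all add: assms(2-5))


section \<open>Linear extension from monomials\<close>

definition extend :: "('c::zero \<Rightarrow> 'r::ring_1) \<Rightarrow> ('m \<Rightarrow> 'r) \<Rightarrow> ('m \<Rightarrow>\<^sub>0 'c) \<Rightarrow> 'r" where
  "extend h M p = (\<Sum>m\<in>Poly_Mapping.keys p. h (Poly_Mapping.lookup p m) * M m)"

lemma extend_zero [simp]: "extend h M 0 = 0"
  by (simp add: extend_def)

lemma extend_single:
  "h 0 = 0 \<Longrightarrow> extend h M (Poly_Mapping.single m c) = h c * M m"
  by (cases "c = 0") (simp_all add: extend_def)

lemma extend_add:
  assumes "h 0 = 0" "\<And>b c. h (b + c) = h b + h c"
  shows "extend h M (p + q) = extend h M p + extend h M q"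
  unfolding extend_def
  by (rule setsum_keys_plus_distrib) (simp_all add: assms distrib_right)

lemma extend_uminus:
  fixes p :: "'m \<Rightarrow>\<^sub>0 'c::ab_group_add"
  assumes "h 0 = 0" "\<And>b c. h (b + c) = h b + h c"
  shows "extend h M (- p) = - extend h M p"
  using extend_add[OF assms, of M p "- p"] by (simp add: eq_neg_iff_add_eq_0 add.commute)

lemma extend_diff:
  fixes p :: "'m \<Rightarrow>\<^sub>0 'c::ab_group_add"
  assumes "h 0 = 0" "\<And>b c. h (b + c) = h b + h c"
  shows "extend h M (p - q) = extend h M p - extend h M q"
  using extend_add[OF assms, of M p "- q"] extend_uminus[OF assms, of M q] by simp

lemma poly_mapping_induct [case_names zero single add]:
  fixes p :: "'m \<Rightarrow>\<^sub>0 'c::ab_group_add"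
  assumes "P 0" "\<And>m c. P (Poly_Mapping.single m c)" "\<And>p q. P p \<Longrightarrow> P q \<Longrightarrow> P (p + q)"
  shows "P p"
proof (induction "card (Poly_Mapping.keys p)" arbitrary: p)
  case 0
  then have "p = 0" by simp
  then show ?case using assms by simp
next
  case (Suc n)
  then obtain m where m: "m \<in> Poly_Mapping.keys p" by (metis card.empty ex_in_conv nat.distinct(1))
  let ?q = "p - Poly_Mapping.single m (Poly_Mapping.lookup p m)"
  have "Poly_Mapping.keys ?q = Poly_Mapping.keys p - {m}"
    by (auto simp: in_keys_iff lookup_minus lookup_single when_def split: if_splits)
  then have "P ?q" using Suc m by simp
  then have "P (?q + Poly_Mapping.single m (Poly_Mapping.lookup p m))" using assms by blast
  then show ?case by simp
qed

lemma extend_mult: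
  fixes p q :: "'m::monoid_add \<Rightarrow>\<^sub>0 'c::ring_1"
  assumes h: "h 0 = 0" "\<And>b c. h (b + c) = h b + h c" "\<And>b c. h (b * c) = h b * h c"
    and M: "\<And>k m. M (k + m) = M k * M m" and comm: "\<And>c m. h c * M m = M m * h c"
  shows "extend h M (p * q) = extend h M p * extend h M q"
proof (induction p rule: poly_mapping_induct)
  case (single k b)
  show ?case
  proof (induction q rule: poly_mapping_induct)
    case (single m c)
    have "h b * h c * (M k * M m) = h b * M k * (h c * M m)"
      by (metis comm mult.assoc)
    then show ?case by (simp add: mult_single extend_single h M)
  qed (simp_all add: distrib_left extend_add h)
qed (simp_all add: distrib_right extend_add h)


section \<open>The coordinate algebra of \<open>\<CM>\<^sup>#\<close>\<close>

type_synonym gen_poly = "((4 \<times> 4) \<Rightarrow>\<^sub>0 nat) \<Rightarrow>\<^sub>0 complex"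

definition pconst :: "complex \<Rightarrow> gen_poly" where
  "pconst c = Poly_Mapping.single 0 c"

definition pgen :: "4 \<times> 4 \<Rightarrow> gen_poly" where
  "pgen v = Poly_Mapping.single (Poly_Mapping.single v 1) 1"

definition gen_matrix :: "gen_poly^4^4" where
  "gen_matrix = (\<chi> i j. pgen (i, j))"

definition monom_at :: "(4 \<times> 4 \<Rightarrow> 'r::comm_ring_1) \<Rightarrow> ((4 \<times> 4) \<Rightarrow>\<^sub>0 nat) \<Rightarrow> 'r" where
  "monom_at g m = (\<Prod>v\<in>UNIV. g v ^ Poly_Mapping.lookup m v)"

text \<open>The conjugate-linear involution of the polynomial ring exchanging the \<open>(i,j)\<close> and
  \<open>(j,i)\<close> generators.\<close>

definition pstar :: "gen_poly \<Rightarrow> gen_poly" where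
  "pstar = extend (\<lambda>c. pconst (cnj c)) (monom_at (\<lambda>v. pgen (prod.swap v)))"

definition cm_rels :: "gen_poly set" where
  "cm_rels = {(gen_matrix ** gen_matrix - gen_matrix) $ i $ j | i j. True}
     \<union> {trace gen_matrix - 2}"

lemma pconst_hom:
  "pconst 0 = 0" "pconst 1 = 1" "pconst (b + c) = pconst b + pconst c"
  "pconst (b * c) = pconst b * pconst c"
  by (simp_all add: pconst_def single_add mult_single)

lemma monom_at_add: "monom_at g (k + m) = monom_at g k * monom_at g m"
  by (simp add: monom_at_def lookup_add power_add prod.distrib)

lemma monom_at_zero [simp]: "monom_at g 0 = 1"
  by (simp add: monom_at_def)

lemma monom_at_single: "monom_at g (Poly_Mapping.single v n) = g v ^ n"
proof -
  have "monom_at g (Poly_Mapping.single v n) = (\<Prod>w\<in>UNIV. if v = w then g w ^ n else 1)"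
    unfolding monom_at_def by (rule prod.cong) (auto simp: lookup_single when_def)
  then show ?thesis by simp
qed

lemma pstar_hom:
  "pstar 0 = 0" "pstar (p + q) = pstar p + pstar q" "pstar (p * q) = pstar p * pstar q"
  "pstar (pconst c) = pconst (cnj c)" "pstar (pgen v) = pgen (prod.swap v)"
  by (simp_all add: pstar_def extend_add extend_mult pconst_hom monom_at_add mult.commute)
     (simp_all add: pconst_def pgen_def extend_single monom_at_single)

lemma pstar_one: "pstar 1 = 1"
  using pstar_hom(4)[of 1] by (simp add: pconst_hom)

lemma pstar_uminus: "pstar (- p) = - pstar p"
  using pstar_hom(2)[of p "- p"] by (simp add: pstar_hom eq_neg_iff_add_eq_0 add.commute)

lemma pstar_diff: "pstar (p - q) = pstar p - pstar q"
  using pstar_hom(2)[of p "- q"] by (simp add: pstar_uminus)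

lemma pstar_sum: "finite A \<Longrightarrow> pstar (sum f A) = (\<Sum>i\<in>A. pstar (f i))"
  by (induction A rule: finite_induct) (simp_all add: pstar_hom)

lemma pstar_power: "pstar (p ^ n) = pstar p ^ n"
  by (induction n) (simp_all add: pstar_hom pstar_one)

lemma pstar_prod: "finite A \<Longrightarrow> pstar (prod f A) = (\<Prod>i\<in>A. pstar (f i))"
  by (induction A rule: finite_induct) (simp_all add: pstar_hom pstar_one)

lemma monom_at_pgen: "monom_at pgen m = Poly_Mapping.single m 1"
proof -
  have *: "(pgen v) ^ n = Poly_Mapping.single (Poly_Mapping.single v n) 1" for v n
    by (induction n) (simp_all add: pgen_def mult_single flip: single_add)
  have **: "(\<Prod>v\<in>A. Poly_Mapping.single (g v) (1::complex)) = Poly_Mapping.single (\<Sum>v\<in>A. g v) 1"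
    if "finite A" for A :: "(4 \<times> 4) set" and g :: "4 \<times> 4 \<Rightarrow> (4 \<times> 4) \<Rightarrow>\<^sub>0 nat"
    using that by (induction A rule: finite_induct) (simp_all add: mult_single)
  have "(\<Sum>v\<in>UNIV. Poly_Mapping.single v (Poly_Mapping.lookup m v)) = m"
  proof (rule poly_mapping_eqI)
    fix k
    have "(\<Sum>v\<in>UNIV. Poly_Mapping.lookup (Poly_Mapping.single v (Poly_Mapping.lookup m v)) k)
        = (\<Sum>v\<in>UNIV. if k = v then Poly_Mapping.lookup m v else 0)"
      by (rule sum.cong) (auto simp: lookup_single when_def)
    then show "Poly_Mapping.lookup (\<Sum>v\<in>UNIV. Poly_Mapping.single v (Poly_Mapping.lookup m v)) k = Poly_Mapping.lookup m k"
      by (simp add: lookup_sum)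
  qed
  then show ?thesis by (simp add: monom_at_def * **)
qed

lemma pstar_pstar: "pstar (pstar p) = p"
proof (induction p rule: poly_mapping_induct)
  case (single m c)
  have s: "Poly_Mapping.single m c = pconst c * monom_at pgen m"
    by (simp add: monom_at_pgen pconst_def mult_single)
  have "pstar (pstar (monom_at pgen m)) = monom_at pgen m"
    by (simp add: monom_at_def pstar_prod pstar_power pstar_hom)
  then show ?case by (simp only: s pstar_hom complex_cnj_cnj)
qed (simp_all add: pstar_hom)

lemma pstar_cm_rels:
  assumes "r \<in> cm_rels"
  shows "pstar r \<in> ideal_gen cm_rels"
proof -
  have two: "pstar 2 = 2"
    using pstar_hom(2)[of 1 1] by (simp add: pstar_one)
  consider i j where "r = (gen_matrix ** gen_matrix - gen_matrix) $ i $ j"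
    | "r = trace gen_matrix - 2"
    using assms by (auto simp: cm_rels_def)
  then show ?thesis
  proof cases
    case 1
    have "pstar r = (gen_matrix ** gen_matrix - gen_matrix) $ j $ i"
      by (simp add: 1 matrix_matrix_mult_def gen_matrix_def pstar_diff pstar_sum pstar_hom
          mult.commute)
    then show ?thesis by (auto intro!: ideal_base simp: cm_rels_def)
  next
    case 2
    have "pstar r = r"
      by (simp add: 2 trace_def gen_matrix_def pstar_diff pstar_sum pstar_hom two)
    then show ?thesis using assms by (simp add: ideal_base)
  qed
qed

lemma pstar_cong:
  "p - q \<in> ideal_gen cm_rels \<Longrightarrow> pstar p - pstar q \<in> ideal_gen cm_rels"
  using ideal_gen_hom[of "p - q" cm_rels pstar cm_rels]
  by (simp add: pstar_hom pstar_cm_rels pstar_diff)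

quotient_type cm_sharp = gen_poly / "\<lambda>u v. u - v \<in> ideal_gen cm_rels"
  by (rule ideal_equivp)

text \<open>Evaluation of polynomials at the point of the Grassmannian given by \<open>span {e\<^sub>1, e\<^sub>2}\<close>,
  needed for \<open>0 \<noteq> 1\<close> in the quotients.\<close>

definition base_eval :: "gen_poly \<Rightarrow> complex" where
  "base_eval = extend (\<lambda>c. c) (monom_at (\<lambda>(i, j). if i = j \<and> (i = 1 \<or> i = 2) then 1 else 0))"

lemma base_eval_hom:
  "base_eval 0 = 0" "base_eval (p + q) = base_eval p + base_eval q"
  "base_eval (p * q) = base_eval p * base_eval q"
  "base_eval (pconst c) = c"
  "base_eval (pgen (i, j)) = (if i = j \<and> (i = 1 \<or> i = 2) then 1 else 0)"
  by (simp_all add: base_eval_def extend_add extend_mult monom_at_add mult.commute)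
     (auto simp: pconst_def pgen_def extend_single monom_at_single)

lemma base_eval_one: "base_eval 1 = 1"
  using base_eval_hom(4)[of 1] by (simp add: pconst_hom)

lemma base_eval_diff: "base_eval (p - q) = base_eval p - base_eval q"
  using base_eval_hom(2)[of "p - q" q] by simp

lemma base_eval_rels: "r \<in> cm_rels \<Longrightarrow> base_eval r = 0"
proof -
  have two: "base_eval 2 = 2"
    using base_eval_hom(2)[of 1 1] by (simp add: base_eval_one)
  assume "r \<in> cm_rels"
  then show ?thesis
    by (auto simp: cm_rels_def base_eval_diff two matrix_matrix_mult_def trace_def gen_matrix_def
        sum_4 base_eval_hom)
qed

lemma base_eval_ideal: "u \<in> ideal_gen cm_rels \<Longrightarrow> base_eval u = 0"
  using ideal_gen_hom_zero[of u cm_rels base_eval] base_eval_hom base_eval_rels by blast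

instantiation cm_sharp :: star_algebra
begin
lift_definition zero_cm_sharp :: cm_sharp is 0 .
lift_definition one_cm_sharp :: cm_sharp is 1 .
lift_definition plus_cm_sharp :: "cm_sharp \<Rightarrow> cm_sharp \<Rightarrow> cm_sharp" is "(+)"
  by (rule ideal_add_cong)
lift_definition minus_cm_sharp :: "cm_sharp \<Rightarrow> cm_sharp \<Rightarrow> cm_sharp" is "(-)"
  by (rule ideal_diff_cong)
lift_definition uminus_cm_sharp :: "cm_sharp \<Rightarrow> cm_sharp" is uminus
  by (rule ideal_uminus_cong)
lift_definition times_cm_sharp :: "cm_sharp \<Rightarrow> cm_sharp \<Rightarrow> cm_sharp" is "(*)"
  by (rule ideal_mult_cong)
lift_definition scal_cm_sharp :: "complex \<Rightarrow> cm_sharp" is pconst .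
lift_definition star_cm_sharp :: "cm_sharp \<Rightarrow> cm_sharp" is pstar
  by (rule pstar_cong)
instance
proof
  show "(0::cm_sharp) \<noteq> 1"
    by transfer (metis base_eval_ideal base_eval_diff base_eval_one base_eval_hom(1)
        diff_0 neg_equal_0_iff_equal zero_neq_one)
qed (transfer; simp add: algebra_simps pconst_hom pstar_hom pstar_pstar ideal_zero)+
end

lift_definition cm_gen :: "4 \<Rightarrow> 4 \<Rightarrow> cm_sharp" is "\<lambda>i j. pgen (i, j)" .

definition cm_P :: "cm_sharp^4^4" where
  "cm_P = (\<chi> i j. cm_gen i j)"


section \<open>Block matrices and Pauli components\<close>

definition block :: "'a::zero^2^2 \<Rightarrow> 'a^2^2 \<Rightarrow> 'a^2^2 \<Rightarrow> 'a^2^2 \<Rightarrow> 'a^4^4" where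
  "block A B C D = vector
     [vector [A$1$1, A$1$2, B$1$1, B$1$2],
      vector [A$2$1, A$2$2, B$2$1, B$2$2],
      vector [C$1$1, C$1$2, D$1$1, D$1$2],
      vector [C$2$1, C$2$2, D$2$1, D$2$2]]"

definition blk11 :: "'a::zero^4^4 \<Rightarrow> 'a^2^2" where
  "blk11 P = vector [vector [P$1$1, P$1$2], vector [P$2$1, P$2$2]]"

definition blk12 :: "'a::zero^4^4 \<Rightarrow> 'a^2^2" where
  "blk12 P = vector [vector [P$1$3, P$1$4], vector [P$2$3, P$2$4]]"

definition blk22 :: "'a::zero^4^4 \<Rightarrow> 'a^2^2" where
  "blk22 P = vector [vector [P$3$3, P$3$4], vector [P$4$3, P$4$4]]"

definition pauli :: "3 \<Rightarrow> 'a::complex_algebra^2^2" where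
  "pauli k =
     (if k = 1 then vector [vector [0, 1], vector [1, 0]]
      else if k = 2 then vector [vector [0, - scal \<i>], vector [scal \<i>, 0]]
      else vector [vector [1, 0], vector [0, - 1]])"

text \<open>\<open>s + c (v \<cdot> \<sigma>)\<close> for \<open>s\<close> and the entries of \<open>v\<close> in the algebra and \<open>c \<in> \<complex>\<close>.\<close>

definition pauli_comb :: "'a::complex_algebra \<Rightarrow> complex \<Rightarrow> 'a^3 \<Rightarrow> 'a^2^2" where
  "pauli_comb s c v = mat s + (\<chi> i j. scal c * (\<Sum>k\<in>UNIV. v $ k * pauli k $ i $ j))"

text \<open>The components of a \<open>2 \<times> 2\<close> matrix \<open>M = s + v \<cdot> \<sigma>\<close> are recovered by
  \<open>s = Tr M / 2\<close> and \<open>v\<^sub>k = Tr (M \<sigma>\<^sub>k) / 2\<close>.\<close>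

definition scalar_part :: "'a::complex_algebra^2^2 \<Rightarrow> 'a" where
  "scalar_part M = scal (1/2) * trace M"

definition vector_part :: "'a::complex_algebra^2^2 \<Rightarrow> 'a^3" where
  "vector_part M = (\<chi> k. scal (1/2) * trace (M ** pauli k))"

definition "cm_a = scalar_part (blk11 cm_P)"
definition "cm_alpha = vector_part (blk11 cm_P)"
definition "cm_t = scalar_part (blk12 cm_P)"
definition "cm_x = (\<chi> k. scal (- \<i>) * vector_part (blk12 cm_P) $ k)"
definition "cm_delta = vector_part (blk22 cm_P)"


section \<open>The quotient algebra of the four-sphere\<close>

definition s4_rels :: "cm_sharp set" where
  "s4_rels = {star (cm_x $ k) - cm_x $ k | k. True} \<union> {star cm_t - cm_t}
     \<union> {cm_alpha $ k | k. True} \<union> {cm_delta $ k | k. True}"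

lemma star_uminus: "star (- f) = - star (f::'a::star_algebra)"
proof -
  have "star (0::'a) = 0"
    using star_add[of 0 "0::'a"] by simp
  then show ?thesis
    using star_add[of f "- f"] by (simp add: eq_neg_iff_add_eq_0 add.commute)
qed

lemma star_zero: "star 0 = (0::'a::star_algebra)"
  using star_add[of 0 "0::'a"] by simp

lemma star_diff: "star (f - g) = star f - star (g::'a::star_algebra)"
  using star_add[of f "- g"] by (simp add: star_uminus)

lemma star_sum: "finite A \<Longrightarrow> star (sum f A) = (\<Sum>i\<in>A. star (f i :: 'a::star_algebra))"
  by (induction A rule: finite_induct) (simp_all add: star_zero star_add)

lemma scal_zero: "scal 0 = (0::'a::complex_algebra)"
  using scal_add[of 0 0, where 'a='a] by simp

lemma scal_uminus: "scal (- c) = - (scal c :: 'a::complex_algebra)"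
  using scal_add[of c "- c", where 'a='a]
  by (simp add: scal_zero eq_neg_iff_add_eq_0 add.commute)

lemma star_one: "star 1 = (1::'a::star_algebra)"
  using star_scal[of 1, where 'a='a] by (simp add: scal_one)

lemma star_cm_gen: "star (cm_gen i j) = cm_gen j i"
  by transfer (simp add: pstar_hom ideal_zero)

lemma pauli_component_simps:
  "vector_part M $ 1 = scal (1/2) * (M$1$2 + M$2$1)"
  "vector_part M $ 2 = scal (1/2) * (scal \<i> * (M$1$2 - M$2$1))"
  "vector_part M $ 3 = scal (1/2) * (M$1$1 - M$2$2)"
  "scalar_part M = scal (1/2) * (M$1$1 + M$2$2)"
  by (simp_all add: vector_part_def scalar_part_def trace_def matrix_matrix_mult_def sum_2
      pauli_def algebra_simps)

lemma blk_simps: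
  "blk11 P $ 1 $ 1 = P $ 1 $ 1" "blk11 P $ 1 $ 2 = P $ 1 $ 2"
  "blk11 P $ 2 $ 1 = P $ 2 $ 1" "blk11 P $ 2 $ 2 = P $ 2 $ 2"
  "blk12 P $ 1 $ 1 = P $ 1 $ 3" "blk12 P $ 1 $ 2 = P $ 1 $ 4"
  "blk12 P $ 2 $ 1 = P $ 2 $ 3" "blk12 P $ 2 $ 2 = P $ 2 $ 4"
  "blk22 P $ 1 $ 1 = P $ 3 $ 3" "blk22 P $ 1 $ 2 = P $ 3 $ 4"
  "blk22 P $ 2 $ 1 = P $ 4 $ 3" "blk22 P $ 2 $ 2 = P $ 4 $ 4"
  by (simp_all add: blk11_def blk12_def blk22_def)

lemma block_simps:
  "block A B C D $ 1 = vector [A$1$1, A$1$2, B$1$1, B$1$2]"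
  "block A B C D $ 2 = vector [A$2$1, A$2$2, B$2$1, B$2$2]"
  "block A B C D $ 3 = vector [C$1$1, C$1$2, D$1$1, D$1$2]"
  "block A B C D $ 4 = vector [C$2$1, C$2$2, D$2$1, D$2$2]"
  by (simp_all add: block_def vector_def)

lemma vec4_simps:
  "(vector [w, x, y, z] :: 'a::zero^4) $ 1 = w" "(vector [w, x, y, z] :: 'a::zero^4) $ 2 = x"
  "(vector [w, x, y, z] :: 'a::zero^4) $ 3 = y" "(vector [w, x, y, z] :: 'a::zero^4) $ 4 = z"
  by (simp_all add: vector_def)

lemma cm_component_simps:
  "cm_a = scal (1/2) * (cm_gen 1 1 + cm_gen 2 2)"
  "cm_t = scal (1/2) * (cm_gen 1 3 + cm_gen 2 4)"
  "cm_x $ 1 = scal (- \<i>) * (scal (1/2) * (cm_gen 1 4 + cm_gen 2 3))"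
  "cm_x $ 2 = scal (- \<i>) * (scal (1/2) * (scal \<i> * (cm_gen 1 4 - cm_gen 2 3)))"
  "cm_x $ 3 = scal (- \<i>) * (scal (1/2) * (cm_gen 1 3 - cm_gen 2 4))"
  "cm_alpha $ 1 = scal (1/2) * (cm_gen 1 2 + cm_gen 2 1)"
  "cm_alpha $ 2 = scal (1/2) * (scal \<i> * (cm_gen 1 2 - cm_gen 2 1))"
  "cm_alpha $ 3 = scal (1/2) * (cm_gen 1 1 - cm_gen 2 2)"
  "cm_delta $ 1 = scal (1/2) * (cm_gen 3 4 + cm_gen 4 3)"
  "cm_delta $ 2 = scal (1/2) * (scal \<i> * (cm_gen 3 4 - cm_gen 4 3))"
  "cm_delta $ 3 = scal (1/2) * (cm_gen 3 3 - cm_gen 4 4)"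
  by (simp_all add: cm_a_def cm_t_def cm_x_def cm_alpha_def cm_delta_def pauli_component_simps
      blk_simps cm_P_def)

lemma cm_selfadjoint:
  "star cm_a = cm_a" "star (cm_alpha $ k) = cm_alpha $ k" "star (cm_delta $ k) = cm_delta $ k"
  using exhaust_3[of k]
  by (auto simp: cm_component_simps star_mult star_add star_diff star_scal star_cm_gen
      scal_uminus algebra_simps)

lemma cm_trace: "cm_gen 1 1 + cm_gen 2 2 + cm_gen 3 3 + cm_gen 4 4 = 2"
proof -
  have "cm_gen 1 1 + cm_gen 2 2 + cm_gen 3 3 + cm_gen 4 4 = 1 + 1"
    by transfer (auto intro!: ideal_base simp: cm_rels_def trace_def sum_4 gen_matrix_def)
  then show ?thesis by simp
qed

text \<open>The tautological projector in terms of the components just defined.\<close>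

lemma cm_P_block:
  "cm_P = block (pauli_comb cm_a 1 cm_alpha) (pauli_comb cm_t \<i> cm_x)
     (pauli_comb (star cm_t) (- \<i>) (\<chi> k. star (cm_x $ k)))
     (pauli_comb (1 - cm_a) 1 cm_delta)"
proof -
  have half: "2 * scal (1/2) = (1::cm_sharp)"
    by (simp add: scal_one mult_2 flip: scal_add)
  then have h: "f * (2 * scal (1/2)) = f" "2 * (f * scal (1/2)) = f" "2 * (scal (1/2) * f) = f"
    for f :: cm_sharp
    by (metis mult.left_commute mult.commute mult_1)+
  have ii: "scal \<i> * scal \<i> = (-1::cm_sharp)" "scal \<i> * (scal \<i> * f) = - (f::cm_sharp)" for f
    by (simp_all add: scal_uminus scal_one flip: scal_mult mult.assoc)
  have tr: "1 - cm_a = scal (1/2) * (cm_gen 3 3 + cm_gen 4 4)"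
  proof -
    have "scal (1/2) * (cm_gen 1 1 + cm_gen 2 2 + cm_gen 3 3 + cm_gen 4 4) = (1::cm_sharp)"
      using half by (simp add: cm_trace mult.commute)
    then show ?thesis by (simp add: cm_component_simps algebra_simps)
  qed
  note [simp] = scal_uminus star_uminus star_mult star_add star_diff star_scal star_cm_gen
  have A: "cm_a + cm_alpha $ 3 = cm_gen 1 1" "cm_a - cm_alpha $ 3 = cm_gen 2 2"
    "cm_alpha $ 1 - cm_alpha $ 2 * scal \<i> = cm_gen 1 2"
    "cm_alpha $ 1 + cm_alpha $ 2 * scal \<i> = cm_gen 2 1"
    by (simp_all add: cm_component_simps algebra_simps h ii)
  have D: "1 - cm_a + cm_delta $ 3 = cm_gen 3 3" "1 - cm_a - cm_delta $ 3 = cm_gen 4 4"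
    "cm_delta $ 1 - cm_delta $ 2 * scal \<i> = cm_gen 3 4"
    "cm_delta $ 1 + cm_delta $ 2 * scal \<i> = cm_gen 4 3"
    unfolding tr by (simp_all add: cm_component_simps algebra_simps h ii)
  have B: "cm_t + scal \<i> * cm_x $ 3 = cm_gen 1 3" "cm_t - scal \<i> * cm_x $ 3 = cm_gen 2 4"
    "scal \<i> * (cm_x $ 1 - cm_x $ 2 * scal \<i>) = cm_gen 1 4"
    "scal \<i> * (cm_x $ 1 + cm_x $ 2 * scal \<i>) = cm_gen 2 3"
    by (simp_all add: cm_component_simps algebra_simps h ii)
  have C: "star cm_t - scal \<i> * star (cm_x $ 3) = cm_gen 3 1"
    "star cm_t + scal \<i> * star (cm_x $ 3) = cm_gen 4 2"
    "scal \<i> * (star (cm_x $ 1) - star (cm_x $ 2) * scal \<i>) = - cm_gen 3 2"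
    "scal \<i> * (star (cm_x $ 1) + star (cm_x $ 2) * scal \<i>) = - cm_gen 4 1"
    by (simp_all add: cm_component_simps algebra_simps h ii)
  have "cm_P $ i $ j = block (pauli_comb cm_a 1 cm_alpha) (pauli_comb cm_t \<i> cm_x)
     (pauli_comb (star cm_t) (- \<i>) (\<chi> k. star (cm_x $ k)))
     (pauli_comb (1 - cm_a) 1 cm_delta) $ i $ j" for i j
    using exhaust_4[of i] exhaust_4[of j]
    by (auto simp: block_simps vec4_simps pauli_comb_def pauli_def sum_3 cm_P_def mat_def scal_one
        A B C D)
  then show ?thesis by (simp add: vec_eq_iff)
qed

lemma cm_P_projection: "cm_P ** cm_P = cm_P" "dagger cm_P = cm_P" "trace cm_P = 2"
proof -
  have "(\<Sum>k\<in>UNIV. cm_gen i k * cm_gen k j) = cm_gen i j" for i j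
    unfolding sum_4
    by transfer (auto intro!: ideal_base exI simp: cm_rels_def gen_matrix_def
        matrix_matrix_mult_def sum_4)
  then show "cm_P ** cm_P = cm_P"
    by (simp add: matrix_matrix_mult_def cm_P_def vec_eq_iff)
  show "dagger cm_P = cm_P"
    by (simp add: dagger_def cm_P_def vec_eq_iff star_cm_gen)
  show "trace cm_P = 2"
    by (simp add: trace_def cm_P_def sum_4 cm_trace)
qed

lift_definition base_char :: "cm_sharp \<Rightarrow> complex" is base_eval
  by (metis base_eval_diff base_eval_ideal eq_iff_diff_eq_0)

lemma base_char_hom:
  "base_char 0 = 0" "base_char 1 = 1" "base_char (f + g) = base_char f + base_char g"
  "base_char (f * g) = base_char f * base_char g" "base_char (f - g) = base_char f - base_char g"
  "base_char (scal c) = c"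
  "base_char (cm_gen i j) = (if i = j \<and> (i = 1 \<or> i = 2) then 1 else 0)"
  by (transfer; simp add: base_eval_hom base_eval_one base_eval_diff)+

lemma base_char_rels: "r \<in> s4_rels \<Longrightarrow> base_char r = 0"
proof -
  have "base_char (star (cm_x $ k)) = 0" "base_char (cm_x $ k) = 0" "base_char (cm_alpha $ k) = 0"
    "base_char (cm_delta $ k) = 0" "base_char (star cm_t) = 0" "base_char cm_t = 0" for k
    using exhaust_3[of k]
    by (auto simp: cm_component_simps star_mult star_add star_diff star_scal star_cm_gen
        base_char_hom)
  then show "r \<in> s4_rels \<Longrightarrow> base_char r = 0"
    by (auto simp: s4_rels_def base_char_hom)
qed

lemma base_char_ideal: "u \<in> ideal_gen s4_rels \<Longrightarrow> base_char u = 0"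
  using ideal_gen_hom_zero[of u s4_rels base_char] base_char_hom base_char_rels by blast

lemma star_s4_rels: "r \<in> s4_rels \<Longrightarrow> star r \<in> ideal_gen s4_rels"
proof -
  have neg: "star (star f - f) = - (star f - f)" for f :: cm_sharp
    by (simp add: star_diff star_star)
  assume "r \<in> s4_rels"
  moreover from this have "star r = r \<or> star r = - r"
    unfolding s4_rels_def by (auto simp: cm_selfadjoint neg simp del: minus_diff_eq)
  ultimately show ?thesis
    by (metis ideal_base ideal_uminus)
qed

lemma star_s4_cong: "f - g \<in> ideal_gen s4_rels \<Longrightarrow> star f - star g \<in> ideal_gen s4_rels"
  using ideal_gen_hom[of "f - g" s4_rels star s4_rels]
  by (simp add: star_zero star_add star_mult star_s4_rels star_diff)

quotient_type s4 = cm_sharp / "\<lambda>u v. u - v \<in> ideal_gen s4_rels"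
  by (rule ideal_equivp)

instantiation s4 :: star_algebra
begin
lift_definition zero_s4 :: s4 is 0 .
lift_definition one_s4 :: s4 is 1 .
lift_definition plus_s4 :: "s4 \<Rightarrow> s4 \<Rightarrow> s4" is "(+)" by (rule ideal_add_cong)
lift_definition minus_s4 :: "s4 \<Rightarrow> s4 \<Rightarrow> s4" is "(-)" by (rule ideal_diff_cong)
lift_definition uminus_s4 :: "s4 \<Rightarrow> s4" is uminus by (rule ideal_uminus_cong)
lift_definition times_s4 :: "s4 \<Rightarrow> s4 \<Rightarrow> s4" is "(*)" by (rule ideal_mult_cong)
lift_definition scal_s4 :: "complex \<Rightarrow> s4" is scal .
lift_definition star_s4 :: "s4 \<Rightarrow> s4" is star by (rule star_s4_cong)
instance
proof
  show "(0::s4) \<noteq> 1"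
    by transfer (metis base_char_ideal base_char_hom(1,2,5) diff_0 neg_equal_0_iff_equal zero_neq_one)
qed (transfer; simp add: algebra_simps scal_one scal_add scal_mult star_star star_add star_mult
    star_scal ideal_zero)+
end

definition s4_proj :: "cm_sharp \<Rightarrow> s4" where
  "s4_proj = abs_s4"

definition "s4_a = s4_proj cm_a"
definition "s4_t = s4_proj cm_t"
definition "s4_x = (\<chi> k. s4_proj (cm_x $ k))"

definition s4_e :: "s4^4^4" where
  "s4_e = map_matrix s4_proj cm_P"


section \<open>Classical differential forms\<close>

text \<open>For a commutative complex algebra \<open>A\<close>, the differential forms are the de Rham complex
  \<open>\<Lambda>\<^sub>A \<Omega>\<^sup>1\<^sub>A\<close> of Kaehler differentials over \<open>\<complex>\<close>, presented as a ring by generators \<open>f\<close> and \<open>df\<close>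
  (\<open>f \<in> A\<close>) and relations, the free ring being the monoid ring of words with integer
  coefficients. Multiplication is the wedge product.\<close>

datatype 'a letter = Fn 'a | Df 'a

datatype 'a word = Word (letters: "'a letter list")

instantiation word :: (type) monoid_add
begin
definition "zero_word = Word []"
definition "plus_word v w = Word (letters v @ letters w)"
instance by standard (simp_all add: zero_word_def plus_word_def)
end

definition gen :: "'a letter \<Rightarrow> 'a word \<Rightarrow>\<^sub>0 int" where
  "gen l = Poly_Mapping.single (Word [l]) 1"

definition dr_rels :: "('a::complex_algebra word \<Rightarrow>\<^sub>0 int) set" where
  "dr_rels =
     {gen (Fn (f + g)) - gen (Fn f) - gen (Fn g) | f g. True}
   \<union> {gen (Fn (f * g)) - gen (Fn f) * gen (Fn g) | f g. True}
   \<union> {gen (Fn 1) - 1}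
   \<union> {gen (Df (f + g)) - gen (Df f) - gen (Df g) | f g. True}
   \<union> {gen (Df (f * g)) - gen (Df f) * gen (Fn g) - gen (Fn f) * gen (Df g) | f g. True}
   \<union> {gen (Df (scal c)) | c. True}
   \<union> {gen (Fn f) * gen (Df g) - gen (Df g) * gen (Fn f) | f g. True}
   \<union> {gen (Df f) * gen (Df g) + gen (Df g) * gen (Df f) | f g. True}"

text \<open>On the free ring: the grading involution \<open>\<omega> \<mapsto> (-1)\<^bsup>deg \<omega>\<^esup> \<omega>\<close>, and the odd derivation
  with \<open>d f = df\<close>, \<open>d (df) = 0\<close>.\<close>

fun ginv_word :: "'a letter list \<Rightarrow> 'a word \<Rightarrow>\<^sub>0 int" where
  "ginv_word [] = 1"
| "ginv_word (Fn f # w) = gen (Fn f) * ginv_word w"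
| "ginv_word (Df f # w) = - gen (Df f) * ginv_word w"

fun d_word :: "'a letter list \<Rightarrow> 'a word \<Rightarrow>\<^sub>0 int" where
  "d_word [] = 0"
| "d_word (Fn f # w) = gen (Df f) * Poly_Mapping.single (Word w) 1 + gen (Fn f) * d_word w"
| "d_word (Df f # w) = - gen (Df f) * d_word w"

definition ginv_free :: "('a word \<Rightarrow>\<^sub>0 int) \<Rightarrow> 'a word \<Rightarrow>\<^sub>0 int" where
  "ginv_free = extend of_int (\<lambda>w. ginv_word (letters w))"

definition d_free :: "('a word \<Rightarrow>\<^sub>0 int) \<Rightarrow> 'a word \<Rightarrow>\<^sub>0 int" where
  "d_free = extend of_int (\<lambda>w. d_word (letters w))"

lemma word_Cons: "Poly_Mapping.single (Word (l # w)) (1::int) = gen l * Poly_Mapping.single (Word w) 1"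
  by (simp add: gen_def mult_single plus_word_def)

lemma word_append:
  "Poly_Mapping.single (Word (v @ w)) (1::int)
     = Poly_Mapping.single (Word v) 1 * Poly_Mapping.single (Word w) 1"
  by (simp add: mult_single plus_word_def)

lemma ginv_word_append: "ginv_word (v @ w) = ginv_word v * ginv_word w"
  by (induction v rule: ginv_word.induct) (simp_all add: mult.assoc)

lemma d_word_append:
  "d_word (v @ w) = d_word v * Poly_Mapping.single (Word w) 1 + ginv_word v * d_word w"
  by (induction v rule: d_word.induct) (simp_all add: word_append algebra_simps)

lemma extend_int_mult:
  fixes p q :: "'m::monoid_add \<Rightarrow>\<^sub>0 int"
  assumes "\<And>k m. M (k + m) = M k * M m"
  shows "extend of_int M (p * q) = extend of_int M p * extend of_int M q"
  by (rule extend_mult) (simp, simp, simp, rule assms, rule mult_of_int_commute)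

lemma extend_int_one: "extend of_int M 1 = M 0"
  unfolding single_one[symmetric] by (subst extend_single) simp_all

lemma one_word: "Poly_Mapping.single (Word []) 1 = 1"
  by (simp flip: zero_word_def)

lemma ginv_free_hom:
  "ginv_free 0 = 0" "ginv_free (u + v) = ginv_free u + ginv_free v"
  "ginv_free (u - v) = ginv_free u - ginv_free v" "ginv_free (- u) = - ginv_free u"
  "ginv_free (u * v) = ginv_free u * ginv_free v"
  "ginv_free 1 = 1" "ginv_free (gen (Fn f)) = gen (Fn f)" "ginv_free (gen (Df f)) = - gen (Df f)"
  by (simp_all add: ginv_free_def extend_add extend_diff extend_uminus extend_int_mult
      extend_int_one plus_word_def zero_word_def ginv_word_append)
     (simp_all add: gen_def extend_single one_word)

lemma d_free_add:
  "d_free 0 = 0" "d_free (u + v) = d_free u + d_free v"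
  "d_free (u - v) = d_free u - d_free v" "d_free (- u) = - d_free u"
  "d_free 1 = 0" "d_free (gen (Fn f)) = gen (Df f)" "d_free (gen (Df f)) = 0"
  by (simp_all add: d_free_def extend_add extend_diff extend_uminus extend_int_one zero_word_def)
     (simp_all add: gen_def extend_single one_word)

lemma single_word_of_int:
  "Poly_Mapping.single m (c::int) = of_int c * Poly_Mapping.single (m::'a::monoid_add) 1"
  by (subst single_of_int[symmetric]) (simp add: mult_single del: single_of_int)

lemma d_free_mult:
  fixes u v :: "'a word \<Rightarrow>\<^sub>0 int"
  shows "d_free (u * v) = d_free u * v + ginv_free u * d_free v"
proof (induction u rule: poly_mapping_induct)
  case (single k b)
  show ?case
  proof (induction v rule: poly_mapping_induct)
    case (single m c)
    obtain v w where [simp]: "k = Word v" "m = Word w" by (metis word.exhaust)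
    have r: "of_int (b * c) * (x * y) = (of_int b * x) * (of_int c * y)"
      for x y :: "'a word \<Rightarrow>\<^sub>0 int"
      using mult_of_int_commute[of c x] by (simp add: mult.assoc) (simp flip: mult.assoc)
    have "d_free (Poly_Mapping.single k b * Poly_Mapping.single m c)
      = of_int (b * c) * (d_word v * Poly_Mapping.single (Word w) 1 + ginv_word v * d_word w)"
      by (simp add: d_free_def mult_single extend_single plus_word_def d_word_append)
    also have "\<dots> = of_int b * d_word v * (of_int c * Poly_Mapping.single (Word w) 1)
        + of_int b * ginv_word v * (of_int c * d_word w)"
      by (simp only: distrib_left r)
    also have "\<dots> = d_free (Poly_Mapping.single k b) * Poly_Mapping.single m c
        + ginv_free (Poly_Mapping.single k b) * d_free (Poly_Mapping.single m c)"
      unfolding single_word_of_int[of m c, symmetric]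
      by (subst (2) single_word_of_int) (simp add: d_free_def ginv_free_def extend_single)
    finally show ?case .
  qed (simp_all add: d_free_add distrib_left algebra_simps)
qed (simp_all add: d_free_add ginv_free_hom distrib_right)

lemma ginv_dr_rels: "r \<in> dr_rels \<Longrightarrow> ginv_free r = r \<or> ginv_free r = - r"
  unfolding dr_rels_def
  by (auto simp: ginv_free_hom)

lemma dr_rels_intros:
  "gen (Fn (f + g)) - gen (Fn f) - gen (Fn g) \<in> dr_rels"
  "gen (Fn (f * g)) - gen (Fn f) * gen (Fn g) \<in> dr_rels"
  "gen (Fn 1) - 1 \<in> dr_rels"
  "gen (Df (f + g)) - gen (Df f) - gen (Df g) \<in> dr_rels"
  "gen (Df (f * g)) - gen (Df f) * gen (Fn g) - gen (Fn f) * gen (Df g) \<in> dr_rels"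
  "gen (Df (scal c)) \<in> dr_rels"
  "gen (Fn f) * gen (Df g) - gen (Df g) * gen (Fn f) \<in> dr_rels"
  "gen (Df f) * gen (Df g) + gen (Df g) * gen (Df f) \<in> dr_rels"
  unfolding dr_rels_def by blast+

lemma d_dr_rels:
  assumes "r \<in> (dr_rels :: ('a::complex_algebra word \<Rightarrow>\<^sub>0 int) set)"
  shows "d_free r \<in> ideal_gen dr_rels"
proof -
  have one: "gen (Df 1) \<in> (dr_rels :: ('a word \<Rightarrow>\<^sub>0 int) set)"
    using dr_rels_intros(6)[of 1] by (simp only: scal_one)
  note s = d_free_add d_free_mult ginv_free_hom
  consider (a) "d_free r = 0"
    | (b) f g where "d_free r = gen (Df (f + g)) - gen (Df f) - gen (Df g)"
    | (c) f g where
        "d_free r = gen (Df (f * g)) - gen (Df f) * gen (Fn g) - gen (Fn f) * gen (Df g)"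
    | (d) "d_free r = gen (Df 1)"
    | (e) f g where "d_free r = gen (Df f) * gen (Df g) + gen (Df g) * gen (Df f)"
    using assms[unfolded dr_rels_def Un_iff mem_Collect_eq singleton_iff]
    by (elim disjE exE conjE) (simp_all add: s diff_diff_eq)
  then show ?thesis
    by cases (simp_all add: ideal_zero ideal_base dr_rels_intros one)
qed

lemma ginv_cong:
  fixes u v :: "'a::complex_algebra word \<Rightarrow>\<^sub>0 int"
  assumes "u - v \<in> ideal_gen dr_rels"
  shows "ginv_free u - ginv_free v \<in> ideal_gen dr_rels"
proof -
  have "ginv_free r \<in> ideal_gen dr_rels" if "r \<in> dr_rels" for r :: "'a word \<Rightarrow>\<^sub>0 int"
    using ginv_dr_rels[OF that] ideal_base[OF that] ideal_uminus[OF ideal_base[OF that]] by auto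
  then have "ginv_free (u - v) \<in> ideal_gen dr_rels"
    using ideal_gen_hom[OF assms, of ginv_free dr_rels] by (simp add: ginv_free_hom)
  then show ?thesis by (simp only: ginv_free_hom)
qed

lemma d_free_cong:
  fixes u v :: "'a::complex_algebra word \<Rightarrow>\<^sub>0 int"
  assumes "u - v \<in> ideal_gen dr_rels"
  shows "d_free u - d_free v \<in> ideal_gen dr_rels"
proof -
  have "d_free w \<in> ideal_gen dr_rels" if "w \<in> ideal_gen dr_rels" for w :: "'a word \<Rightarrow>\<^sub>0 int"
    using that
  proof induction
    case (ideal_right y x)
    then have "ginv_free y \<in> ideal_gen dr_rels"
      using ginv_cong[of y 0] by (simp add: ginv_free_hom)
    with ideal_right show ?case
      unfolding d_free_mult by (blast intro: ideal_add ideal_gen.ideal_right)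
  next
    case (ideal_left y x)
    then show ?case
      unfolding d_free_mult by (blast intro: ideal_add ideal_gen.ideal_right ideal_gen.ideal_left)
  qed (simp_all add: d_free_add d_dr_rels ideal_zero ideal_add)
  from this[OF assms] show ?thesis by (simp only: d_free_add)
qed

text \<open>The degree-zero part of the form ring, showing that it is nontrivial.\<close>

fun fn_word :: "'a::comm_ring_1 letter list \<Rightarrow> 'a" where
  "fn_word [] = 1"
| "fn_word (Fn f # w) = f * fn_word w"
| "fn_word (Df f # w) = 0"

lemma fn_word_append: "fn_word (v @ w) = fn_word v * fn_word w"
  by (induction v rule: fn_word.induct) (simp_all add: mult.assoc)

lemma dr_ideal_proper: "(1 :: 'a::complex_algebra word \<Rightarrow>\<^sub>0 int) \<notin> ideal_gen dr_rels"
proof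
  define h :: "('a word \<Rightarrow>\<^sub>0 int) \<Rightarrow> 'a" where "h = extend of_int (\<lambda>w. fn_word (letters w))"
  have h: "h 0 = 0" "\<And>u v. h (u + v) = h u + h v" "\<And>u v. h (u - v) = h u - h v"
    "\<And>u v. h (u * v) = h u * h v" "h 1 = 1" "\<And>f. h (gen (Fn f)) = f" "\<And>f. h (gen (Df f)) = 0"
    by (simp_all add: h_def extend_add extend_diff extend_int_mult extend_int_one zero_word_def
        plus_word_def fn_word_append)
       (simp_all add: gen_def extend_single)
  assume "(1 :: 'a word \<Rightarrow>\<^sub>0 int) \<in> ideal_gen dr_rels"
  then have "h 1 = 0"
    by (rule ideal_gen_hom_zero) (auto simp: h dr_rels_def)
  then show False by (simp add: h)
qed

quotient_type (overloaded) 'a forms = "'a::complex_algebra word \<Rightarrow>\<^sub>0 int" / "\<lambda>u v. u - v \<in> ideal_gen dr_rels"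
  by (rule ideal_equivp)

instantiation forms :: (complex_algebra) ring_1
begin
lift_definition zero_forms :: "'a forms" is 0 .
lift_definition one_forms :: "'a forms" is 1 .
lift_definition plus_forms :: "'a forms \<Rightarrow> 'a forms \<Rightarrow> 'a forms" is "(+)" by (rule ideal_add_cong)
lift_definition minus_forms :: "'a forms \<Rightarrow> 'a forms \<Rightarrow> 'a forms" is "(-)" by (rule ideal_diff_cong)
lift_definition uminus_forms :: "'a forms \<Rightarrow> 'a forms" is uminus by (rule ideal_uminus_cong)
lift_definition times_forms :: "'a forms \<Rightarrow> 'a forms \<Rightarrow> 'a forms" is "(*)" by (rule ideal_mult_cong)
instance
proof
  show "(0::'a forms) \<noteq> 1"
    by transfer (use dr_ideal_proper ideal_uminus[of "- 1"] in force)
qed (transfer; simp add: algebra_simps ideal_zero)+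
end

lift_definition fn :: "'a::complex_algebra \<Rightarrow> 'a forms" is "\<lambda>f. gen (Fn f)" .
lift_definition ginv :: "'a::complex_algebra forms \<Rightarrow> 'a forms" is ginv_free by (rule ginv_cong)
lift_definition dd :: "'a::complex_algebra forms \<Rightarrow> 'a forms" is d_free by (rule d_free_cong)

lemma fn_hom:
  "fn (f + g) = fn f + fn g" "fn (f * g) = fn f * fn g" "fn 1 = 1"
  by (transfer; rule ideal_base; simp add: dr_rels_intros flip: diff_diff_eq)+

lemma forms_graded_commutative:
  "fn f * dd (fn g) = dd (fn g) * fn f" "dd (fn f) * dd (fn g) = - (dd (fn g) * dd (fn f))"
  by (transfer; rule ideal_base; simp add: dr_rels_intros d_free_add)+

lemma ginv_hom:
  "ginv (u + v) = ginv u + ginv v" "ginv (u - v) = ginv u - ginv v"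
  "ginv (u * v) = ginv u * ginv v" "ginv (fn f) = fn f" "ginv (dd (fn f)) = - dd (fn f)"
  by (transfer; simp add: ginv_free_hom d_free_add ideal_zero)+

lemma dd_simps:
  "dd (u + v) = dd u + dd v" "dd (u - v) = dd u - dd v"
  "dd (u * v) = dd u * v + ginv u * dd v"
  by (transfer; simp add: d_free_add d_free_mult ideal_zero)+

lemma dd_scal: "dd (fn (scal c)) = 0"
  by transfer (rule ideal_base, simp add: dr_rels_intros d_free_add)

lemma fn_sum: "finite A \<Longrightarrow> fn (sum f A) = (\<Sum>i\<in>A. fn (f i))"
proof (induction A rule: finite_induct)
  case empty
  show ?case using fn_hom(1)[of 0 0] by simp
qed (simp_all add: fn_hom)

lemma dd_dd_fn: "dd (dd (fn f)) = 0"
  by transfer (simp add: d_free_add ideal_zero)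

lemma dd_zero: "dd 0 = 0"
  using dd_simps(1)[of 0 0] by simp

lemma ginv_zero: "ginv 0 = 0"
  using ginv_hom(1)[of 0 0] by simp

lemma dd_uminus: "dd (- u) = - dd u"
  using dd_simps(2)[of 0 u] by (simp add: dd_zero)

lemma dd_sum: "finite A \<Longrightarrow> dd (sum f A) = (\<Sum>i\<in>A. dd (f i))"
  by (induction A rule: finite_induct) (simp_all add: dd_zero dd_simps)

lemma ginv_sum: "finite A \<Longrightarrow> ginv (sum f A) = (\<Sum>i\<in>A. ginv (f i))"
  by (induction A rule: finite_induct) (simp_all add: ginv_zero ginv_hom)


section \<open>The Grassmann connection\<close>

text \<open>The product \<open>v v* M\<close> of HOL-Analysis multiplies entries in the opposite order and cannot be used over
  a noncommutative ring.\<close>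

definition row_mult :: "'a::semiring_1^'n \<Rightarrow> 'a^'m^'n \<Rightarrow> 'a^'m" where
  "row_mult v M = (\<chi> j. \<Sum>i\<in>UNIV. v $ i * M $ i $ j)"

definition fn_row :: "'a::complex_algebra^'n \<Rightarrow> 'a forms^'n" where
  "fn_row v = (\<chi> i. fn (v $ i))"

definition d_matrix :: "'a::complex_algebra^'m^'n \<Rightarrow> 'a forms^'m^'n" where
  "d_matrix M = (\<chi> i j. dd (fn (M $ i $ j)))"

text \<open>Forms with values in \<open>A\<^sup>n e\<close> are row vectors \<open>w\<close> of forms with \<open>w e = w\<close>. In degree 0 the
  connection is \<open>\<nabla> w = (dw) e\<close>. It is extended to higher degrees by
  \<open>\<nabla> (\<omega> s) = \<omega> \<and> \<nabla> s + (-1)\<^bsup>deg \<omega>\<^esup> d\<omega> s\<close>, that is \<open>\<nabla> w = (-1)\<^bsup>deg w\<^esup> (dw) e\<close>: this is the sign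
  rule for which \<open>\<nabla>\<^sup>2 (v e) = (v de de) e\<close> on row vectors (the other common rule changes \<open>\<nabla>\<^sup>2\<close> by a
  global sign).\<close>

definition grassmann_conn ::
  "'a::complex_algebra^'n^'n \<Rightarrow> 'a forms^'n \<Rightarrow> 'a forms^'n" where
  "grassmann_conn e w = row_mult (\<chi> i. dd (ginv (w $ i))) (map_matrix fn e)"

definition curvature :: "('w \<Rightarrow> 'w) \<Rightarrow> 'w \<Rightarrow> 'w" where
  "curvature nabla w = nabla (nabla w)"

lemma row_mult_assoc: "row_mult (row_mult v M) N = row_mult v (M ** N)"
proof -
  have "(\<Sum>i\<in>UNIV. (\<Sum>k\<in>UNIV. v $ k * M $ k $ i) * N $ i $ j)
      = (\<Sum>k\<in>UNIV. v $ k * (\<Sum>i\<in>UNIV. M $ k $ i * N $ i $ j))" for j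
    by (simp add: sum_distrib_left sum_distrib_right mult.assoc) (rule sum.swap)
  then show ?thesis by (simp add: row_mult_def matrix_matrix_mult_def)
qed

lemma row_mult_linear:
  fixes v w :: "'a::ring_1^'n"
  shows "row_mult (v + w) M = row_mult v M + row_mult w M"
    "row_mult (v - w) M = row_mult v M - row_mult w M"
  by (simp_all add: row_mult_def vec_eq_iff distrib_right left_diff_distrib sum.distrib
      sum_subtractf)

lemma map_matrix_fn_mult:
  fixes M :: "'a::complex_algebra^'b^'c"
  shows "map_matrix fn (M ** N) = map_matrix fn M ** map_matrix fn N"
  by (simp add: map_matrix_def matrix_matrix_mult_def fn_hom fn_sum)

text \<open>\<open>F (v e) = (v de de) e\<close> for every projection.\<close>

lemma curvature_grassmann:
  fixes e :: "'a::complex_algebra^'n^'n"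
  assumes e: "e ** e = e"
  shows "curvature (grassmann_conn e) (row_mult (fn_row v) (map_matrix fn e))
    = row_mult (row_mult (fn_row v) (d_matrix e ** d_matrix e)) (map_matrix fn e)"
proof -
  define E where "E = map_matrix fn e"
  define D :: "'a forms^'n \<Rightarrow> 'a forms^'n" where "D w = (\<chi> i. dd (ginv (w $ i)))" for w
  let ?v = "fn_row v" and ?dv = "\<chi> i. dd (fn (v $ i))" and ?dE = "d_matrix e"
  have EE: "E ** E = E"
    by (simp add: E_def e flip: map_matrix_fn_mult)
  have conn: "grassmann_conn e w = row_mult (D w) E" for w
    by (simp add: grassmann_conn_def D_def E_def)
  have D_add: "D (w + w') = D w + D w'" for w w'
    by (simp add: D_def vec_eq_iff ginv_hom dd_simps)
  have 1: "D (row_mult ?v E) = row_mult ?dv E + row_mult ?v ?dE"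
    by (simp add: D_def row_mult_def vec_eq_iff E_def map_matrix_def d_matrix_def fn_row_def
        ginv_sum dd_sum ginv_hom dd_simps sum.distrib)
  have 2: "D (row_mult ?dv E) = row_mult ?dv ?dE"
    by (simp add: D_def row_mult_def vec_eq_iff E_def map_matrix_def d_matrix_def
        ginv_sum dd_sum ginv_hom dd_simps dd_uminus dd_dd_fn)
  have 3: "D (row_mult (row_mult ?v ?dE) E)
      = row_mult (row_mult ?v ?dE) ?dE - row_mult (row_mult ?dv ?dE) E"
    by (simp add: D_def row_mult_def vec_eq_iff E_def map_matrix_def d_matrix_def fn_row_def
        ginv_sum dd_sum ginv_hom dd_simps dd_uminus dd_dd_fn sum.distrib sum_subtractf
        sum_negf sum_distrib_right distrib_right)
  have "curvature (grassmann_conn e) (row_mult ?v E)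
      = row_mult (D (row_mult (row_mult ?dv E) E + row_mult (row_mult ?v ?dE) E)) E"
    by (simp only: curvature_def conn 1 row_mult_linear)
  also have "row_mult (row_mult ?dv E) E = row_mult ?dv E"
    by (simp only: row_mult_assoc EE)
  finally show ?thesis
    by (simp add: D_add 2 3 row_mult_linear row_mult_assoc[where M = E and N = E] EE
        row_mult_assoc[of ?v ?dE ?dE, symmetric] flip: E_def)
qed

text \<open>The curvature as an endomorphism-valued 2-form: row \<open>j\<close> is \<open>F\<close> applied to the \<open>j\<close>-th row of
  \<open>e\<close>, so that \<open>F (v e) = v \<Phi>\<close>.\<close>

definition curv_matrix ::
  "('a::complex_algebra forms^'n \<Rightarrow> 'a forms^'n) \<Rightarrow> 'a^'n^'n \<Rightarrow> 'a forms^'n^'n" where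
  "curv_matrix nabla e = (\<chi> j. curvature nabla (fn_row (e $ j)))"


section \<open>Evaluation of forms\<close>

text \<open>Value at a point (a character \<open>ch\<close>) of the degree \<open>k\<close> component of a form on \<open>k\<close> tangent
  vectors (point derivations at \<open>ch\<close>), where
  \<open>(f dg\<^sub>1 \<dots> dg\<^sub>k)(X\<^sub>1, \<dots>, X\<^sub>k) = f det (X\<^sub>s g\<^sub>r)\<close>. The value does not depend on the representative
  chosen by \<^const>\<open>rep_forms\<close>, because every relation is respected for such \<open>ch\<close> and \<open>X\<^sub>s\<close>.\<close>

fun diffs :: "'a letter list \<Rightarrow> 'a list" where
  "diffs [] = []"
| "diffs (Fn f # w) = diffs w"
| "diffs (Df f # w) = f # diffs w"

fun coeff_word :: "('a \<Rightarrow> complex) \<Rightarrow> 'a letter list \<Rightarrow> complex" where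
  "coeff_word ch [] = 1"
| "coeff_word ch (Fn f # w) = ch f * coeff_word ch w"
| "coeff_word ch (Df f # w) = coeff_word ch w"

definition eval_word :: "('a \<Rightarrow> complex) \<Rightarrow> ('a \<Rightarrow> complex) list \<Rightarrow> 'a letter list \<Rightarrow> complex" where
  "eval_word ch Xs w = (let gs = diffs w; k = length Xs in
     if length gs = k
     then coeff_word ch w *
       (\<Sum>\<pi> | \<pi> permutes {..<k}. of_int (sign \<pi>) * (\<Prod>r<k. (Xs ! \<pi> r) (gs ! r)))
     else 0)"

definition form_at ::
  "('a::complex_algebra \<Rightarrow> complex) \<Rightarrow> ('a \<Rightarrow> complex) list \<Rightarrow> 'a forms \<Rightarrow> complex" where
  "form_at ch Xs \<omega> = extend of_int (\<lambda>w. eval_word ch Xs (letters w)) (rep_forms \<omega>)"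


section \<open>The sphere and the 1-instanton\<close>

text \<open>The points of \<open>S\<^sup>4 \<subseteq> \<real>\<^sup>5\<close>, with coordinates \<open>(a, t, x\<^sub>1, x\<^sub>2, x\<^sub>3)\<close> subject to
  \<open>a (1 - a) = t\<^sup>2 + x\<^sub>1\<^sup>2 + x\<^sub>2\<^sup>2 + x\<^sub>3\<^sup>2\<close>.\<close>

definition s4_centre :: "real^5" where
  "s4_centre = vector [1/2, 0, 0, 0, 0]"

definition s4_points :: "(real^5) set" where
  "s4_points = sphere s4_centre (1/2)"

lemma vec5_simps:
  "(vector [v, w, x, y, z] :: 'a::zero^5) $ 1 = v" "(vector [v, w, x, y, z] :: 'a::zero^5) $ 2 = w"
  "(vector [v, w, x, y, z] :: 'a::zero^5) $ 3 = x" "(vector [v, w, x, y, z] :: 'a::zero^5) $ 4 = y"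
  "(vector [v, w, x, y, z] :: 'a::zero^5) $ 5 = z"
  by (simp_all add: vector_def)

text \<open>Coordinates of a \<open>*\<close>-character; the real parts lose nothing as \<open>a\<close>, \<open>t\<close>, \<open>x\<^sub>k\<close> are
  self-adjoint.\<close>

definition char_coords :: "(s4 \<Rightarrow> complex) \<Rightarrow> real^5" where
  "char_coords ch = vector
     [Re (ch s4_a), Re (ch s4_t), Re (ch (s4_x $ 1)), Re (ch (s4_x $ 2)), Re (ch (s4_x $ 3))]"

definition s4_eval :: "real^5 \<Rightarrow> s4 \<Rightarrow> complex" where
  "s4_eval = inv_into {ch. star_alg_hom ch} char_coords"

text \<open>Derivative of the function \<open>f\<close> on the sphere along the tangent vector \<open>v\<close> at \<open>p\<close>, by means
  of the curve through \<open>p\<close> obtained by projecting \<open>p + s v\<close> radially to the sphere.\<close>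

definition tangent_deriv :: "real^5 \<Rightarrow> real^5 \<Rightarrow> s4 \<Rightarrow> complex" where
  "tangent_deriv p v f = vector_derivative
     (\<lambda>s. s4_eval (s4_centre + (1/2) *\<^sub>R sgn (p - s4_centre + s *\<^sub>R v)) f) (at 0)"

definition s4_form :: "real^5 \<Rightarrow> (real^5) list \<Rightarrow> s4 forms \<Rightarrow> complex" where
  "s4_form p vs \<omega> = form_at (s4_eval p) (map (tangent_deriv p) vs) \<omega>"

text \<open>Orthonormal frames of the tangent space at \<open>p\<close> for the round metric, positively oriented
  (outward normal first) for \<open>ori = 1\<close>, negatively for \<open>ori = -1\<close>.\<close>

definition oriented_frame ::
  "real \<Rightarrow> real^5 \<Rightarrow> real^5 \<Rightarrow> real^5 \<Rightarrow> real^5 \<Rightarrow> real^5 \<Rightarrow> bool" where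
  "oriented_frame ori p v1 v2 v3 v4 \<longleftrightarrow>
     (\<forall>v\<in>{v1, v2, v3, v4}. norm v = 1 \<and> v \<bullet> (p - s4_centre) = 0)
     \<and> v1 \<bullet> v2 = 0 \<and> v1 \<bullet> v3 = 0 \<and> v1 \<bullet> v4 = 0 \<and> v2 \<bullet> v3 = 0 \<and> v2 \<bullet> v4 = 0 \<and> v3 \<bullet> v4 = 0
     \<and> ori * det (vector [p - s4_centre, v1, v2, v3, v4] :: real^5^5) > 0"

text \<open>\<open>\<eta> = *\<omega>\<close> on \<open>T\<^sub>pS\<^sup>4\<close> for 2-forms: \<open>*(\<theta>\<^sup>3 \<and> \<theta>\<^sup>4) = \<theta>\<^sup>1 \<and> \<theta>\<^sup>2\<close> for the dual coframe of every
  oriented orthonormal frame.\<close>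

definition hodge_dual ::
  "real \<Rightarrow> real^5 \<Rightarrow> (real^5 \<Rightarrow> real^5 \<Rightarrow> complex) \<Rightarrow> (real^5 \<Rightarrow> real^5 \<Rightarrow> complex) \<Rightarrow> bool" where
  "hodge_dual ori p \<omega> \<eta> \<longleftrightarrow>
     (\<forall>v1 v2 v3 v4. oriented_frame ori p v1 v2 v3 v4 \<longrightarrow> \<eta> v1 v2 = \<omega> v3 v4)"

definition anti_self_dual :: "real \<Rightarrow> s4 forms \<Rightarrow> bool" where
  "anti_self_dual ori \<omega> \<longleftrightarrow>
     (\<forall>p\<in>s4_points. hodge_dual ori p (\<lambda>v w. s4_form p [v, w] \<omega>) (\<lambda>v w. - s4_form p [v, w] \<omega>))"

text \<open>Inverse stereographic projection, a parametrisation of the sphere minus the point \<open>0\<close>. The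
  integral of a 4-form over the sphere is that of its pullback (up to the choice of orientation).\<close>

definition stereo :: "real^4 \<Rightarrow> real^5" where
  "stereo y = (1 / (1 + y \<bullet> y)) *\<^sub>R vector [1, y $ 1, y $ 2, y $ 3, y $ 4]"

definition s4_integral :: "s4 forms \<Rightarrow> complex" where
  "s4_integral \<omega> = (LINT y|lborel. s4_form (stereo y)
     (map (\<lambda>k. frechet_derivative stereo (at y) (axis k 1)) [1, 2, 3, 4]) \<omega>)"

text \<open>Chern--Weil: \<open>c\<^sub>2 = (8\<pi>\<^sup>2)\<^sup>-\<^sup>1 \<integral> (Tr (F \<and> F) - Tr F \<and> Tr F)\<close>.\<close>

definition second_chern_number :: "s4 forms^'n^'n \<Rightarrow> complex" where
  "second_chern_number \<Phi> =
     complex_of_real (1 / (8 * pi\<^sup>2)) * s4_integral (trace (\<Phi> ** \<Phi>) - trace \<Phi> * trace \<Phi>)"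

text \<open>The connection \<open>nabla\<close> on the bundle of the projection \<open>e\<close>, with fibre the row space of \<open>e(p)\<close>,
  is the basic instanton.\<close>

definition is_one_instanton :: "s4^'n^'n \<Rightarrow> (s4 forms^'n \<Rightarrow> s4 forms^'n) \<Rightarrow> bool" where
  "is_one_instanton e nabla \<longleftrightarrow>
     (\<forall>p\<in>s4_points. rank (map_matrix (s4_eval p) e) = 2)
     \<and> (\<exists>ori\<in>{1, - 1}. \<forall>i j. anti_self_dual ori (curv_matrix nabla e $ i $ j))
     \<and> cmod (second_chern_number (curv_matrix nabla e)) = 1"

end

(* On the sphere e = (1 + N)/2 with N = (2a - 1) g0 + 2 (t gt + x.g), where the five 4 x 4 matrices
   g0, gt, g1, g2, g3 anticommute, square to 1 and have product 1. The curvature of the Grassmann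
   connection is e de de, and (de)^4 is 4! times the sum of the five products g_A vol_A, vol_A being
   the (signed) product of the four differentials other than dy_A. The derivative of the sphere
   relation turns (2a - 1) vol_A into 2 y_A vol_0, which gives the local form.
   At a point with unit normal n and a positively oriented orthonormal frame v1, ..., v4 of the
   tangent space the Clifford product n v1 v2 v3 v4 is the identity, so n v3 v4 = - v1 v2 and the
     curvature is anti-self-dual; the
   trace of the same product shows that Tr F^2 is 48 times the volume form of the sphere of
   radius 1/2, whose total volume pi^2/6 gives second Chern number 1. *)
theory Submission
  imports Defs "HOL-Real_Asymp.Real_Asymp"
begin

section \<open>Homomorphisms out of the coordinate algebras\<close>

text \<open>Points, tangent vectors and forms enter through choices: \<open>s4_eval\<close> is an
  inverse picked by \<open>inv_into\<close>, \<open>tangent_deriv\<close> a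
  \<open>vector_derivative\<close>, \<open>form_at\<close> a value at a chosen representative. None
  of them can be computed with before it is shown to be meaningful. That is the use of the bijection
  between characters and sphere points, of differentiability along curves, and of the vanishing of
  evaluation on the ideal of form relations. One matrix pattern is needed over three rings: the
  algebra (for e), the noncommutative ring of forms (for de) and the complex numbers (for values at
  a point). Hence \<open>cliff\<close> lives over any ring with a chosen element \<open>i\<close>.
  In F wedge F the second curvature acts on a row of 2-forms, so the formula F(w e) = (w de de) e is
  required for rows of arbitrary forms, not just of functions. The local form is claimed after every
  homomorphism that makes 1 - 2a invertible. It is therefore derived in an arbitrary commutative
  algebra from the sphere equation and an inverse \<open>u\<close>. The charge comes out as 1
  because 48 * pi^2/6 = 8 pi^2 is the Chern-Weil denominator.\<close>

lemma alg_homD: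
  assumes "alg_hom h"
  shows "h (f + g) = h f + h g" "h (f * g) = h f * h g" "h (scal c) = scal c"
    "h 0 = 0" "h 1 = 1" "h (- f) = - h f" "h (f - g) = h f - h g"
proof -
  show a: "h (f + g) = h f + h g" and "h (f * g) = h f * h g" and s: "h (scal c) = scal c"
    for f g c using assms by (simp_all add: alg_hom_def)
  show z: "h 0 = 0" using a[of 0 0] by simp
  show "h 1 = 1" using s[of 1] by (simp add: scal_one)
  show m: "h (- f) = - h f" for f using a[of f "- f"] z by (simp add: eq_neg_iff_add_eq_0 add.commute)
  show "h (f - g) = h f - h g" using a[of f "- g"] m by simp
qed

lemma alg_hom_numeral: "alg_hom h \<Longrightarrow> h (numeral k) = numeral k"
  by (induction k) (simp_all only: numeral.simps alg_homD)

lemma alg_hom_sum: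
  assumes "alg_hom h" "finite A"
  shows "h (sum f A) = (\<Sum>i\<in>A. h (f i))"
  using assms(2) by (induction A rule: finite_induct) (simp_all add: alg_homD[OF assms(1)])

lemma map_matrix_alg_hom_mult:
  assumes "alg_hom h"
  shows "map_matrix h (M ** N) = map_matrix h M ** map_matrix h N"
  by (simp add: map_matrix_def matrix_matrix_mult_def alg_hom_sum[OF assms] alg_homD[OF assms])

section \<open>Generation by matrix entries and universal properties\<close>

lemma gen_poly_induct [case_names const gen add mult]:
  assumes "\<And>c. P (pconst c)" "\<And>v. P (pgen v)" "\<And>p q. P p \<Longrightarrow> P q \<Longrightarrow> P (p + q)"
    "\<And>p q. P p \<Longrightarrow> P q \<Longrightarrow> P (p * q)"
  shows "P p"
proof (induction p rule: poly_mapping_induct)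
  case zero
  then show ?case using assms(1)[of 0] by (simp add: pconst_hom)
next
  case (single m c)
  have one: "P 1" using assms(1)[of 1] by (simp add: pconst_hom)
  have pow: "P (pgen v ^ n)" for v n by (induction n) (simp_all add: one assms)
  have "P (\<Prod>v\<in>A. pgen v ^ k v)" if "finite A" for A k
    using that by (induction A rule: finite_induct) (simp_all add: one pow assms)
  then have "P (pconst c * monom_at pgen m)" by (simp add: monom_at_def assms)
  then show ?case by (simp add: monom_at_pgen pconst_def mult_single)
qed (rule assms)

lemma cm_sharp_induct [case_names scal gen add mult]:
  assumes "\<And>c. P (scal c)" "\<And>i j. P (cm_gen i j)" "\<And>f g. P f \<Longrightarrow> P g \<Longrightarrow> P (f + g)"
    "\<And>f g. P f \<Longrightarrow> P g \<Longrightarrow> P (f * g)"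
  shows "P f"
proof -
  have "P (abs_cm_sharp p)" for p
  proof (induction p rule: gen_poly_induct)
    case (const c) then show ?case using assms(1)[of c] by (simp add: scal_cm_sharp.abs_eq)
  next
    case (gen v)
    then show ?case using assms(2)[of "fst v" "snd v"] by (simp add: cm_gen.abs_eq)
  next
    case (add p q) then show ?case using assms(3) by (metis plus_cm_sharp.abs_eq)
  next
    case (mult p q) then show ?case using assms(4) by (metis times_cm_sharp.abs_eq)
  qed
  then show ?thesis by (induction f rule: cm_sharp.abs_induct)
qed

text \<open>Evaluating polynomials at the entries of \<open>M\<close> kills the relations and hence
  their ideal, so the value at \<open>rep_cm_sharp f\<close> does not depend on the
  representative.\<close>

lemma cm_sharp_lift:
  fixes M :: "'r::complex_algebra^4^4"
  assumes M: "M ** M = M" "trace M = 2"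
  obtains h where "alg_hom h" "\<And>i j. h (cm_gen i j) = M $ i $ j"
proof -
  define k :: "gen_poly \<Rightarrow> 'r" where "k = extend scal (monom_at (\<lambda>(i, j). M $ i $ j))"
  have k: "k 0 = 0" "k (p + q) = k p + k q" "k (p - q) = k p - k q" "k (p * q) = k p * k q"
    "k (pconst c) = scal c" "k (pgen (i, j)) = M $ i $ j" for p q c i j
    by (simp_all add: k_def extend_add extend_diff extend_mult monom_at_add scal_zero scal_add
        scal_mult mult.commute)
       (simp_all add: pconst_def pgen_def extend_single monom_at_single scal_zero scal_one)
  have k1: "k 1 = 1" using k(5)[of 1] by (simp add: pconst_hom scal_one)
  have k2: "k 2 = 2" using k(2)[of 1 1] by (simp add: k1)
  have ksum: "finite A \<Longrightarrow> k (sum f A) = (\<Sum>i\<in>A. k (f i))" for A and f :: "4 \<Rightarrow> gen_poly"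
    by (induction A rule: finite_induct) (simp_all add: k)
  have "k r = 0" if "r \<in> cm_rels" for r
    using that M
    by (auto simp: cm_rels_def k k2 ksum gen_matrix_def trace_def matrix_matrix_mult_def vec_eq_iff)
  then have ideal: "k u = 0" if "u \<in> ideal_gen cm_rels" for u
    using ideal_gen_hom_zero[OF that, of k] k by blast
  define h where "h f = k (rep_cm_sharp f)" for f
  have h: "h (abs_cm_sharp p) = k p" for p
  proof -
    have "rep_cm_sharp (abs_cm_sharp p) - p \<in> ideal_gen cm_rels"
      by (simp add: Quotient3_abs_rep[OF Quotient3_cm_sharp] flip: cm_sharp.abs_eq_iff)
    from ideal[OF this] show ?thesis by (simp add: h_def k)
  qed
  show thesis
  proof
    have ex: "\<exists>p. f = abs_cm_sharp p" for f by (induction f rule: cm_sharp.abs_induct) blast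
    have "h (f + g) = h f + h g \<and> h (f * g) = h f * h g" for f g
      using ex[of f] ex[of g] by (auto simp: h k plus_cm_sharp.abs_eq times_cm_sharp.abs_eq)
    then show "alg_hom h" by (simp add: alg_hom_def scal_cm_sharp.abs_eq h k)
    show "h (cm_gen i j) = M $ i $ j" for i j by (simp add: cm_gen.abs_eq h k)
  qed
qed

lemma star_alg_hom_s4_proj: "star_alg_hom s4_proj"
  by (auto simp: star_alg_hom_def alg_hom_def s4_proj_def plus_s4.abs_eq times_s4.abs_eq
      scal_s4.abs_eq star_s4.abs_eq)

lemma alg_hom_s4_proj: "alg_hom s4_proj"
  using star_alg_hom_s4_proj by (simp add: star_alg_hom_def)

lemma surj_s4_proj: "surj s4_proj"
  unfolding s4_proj_def by (metis Quotient_abs_rep Quotient_s4 surjI)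

lemma s4_proj_eq_0_iff: "s4_proj f = 0 \<longleftrightarrow> f \<in> ideal_gen s4_rels"
  unfolding s4_proj_def zero_s4_def by (simp add: s4.abs_eq_iff)

text \<open>\<open>inv s4_proj\<close> is a mere choice of preimage. Two preimages differ by an
  element of the ideal, on which \<open>h\<close> vanishes, so the choice does not affect
  \<open>k\<close> and homomorphy passes from \<open>h\<close> to \<open>k\<close>.\<close>

lemma s4_lift:
  fixes h :: "cm_sharp \<Rightarrow> 'r::complex_algebra"
  assumes h: "alg_hom h" and rels: "\<And>r. r \<in> s4_rels \<Longrightarrow> h r = 0"
  obtains k where "alg_hom k" "\<And>f. k (s4_proj f) = h f"
proof -
  have ideal: "h u = 0" if "u \<in> ideal_gen s4_rels" for u
    using ideal_gen_hom_zero[OF that, of h] alg_homD[OF h] rels by blast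
  define k where "k f = h (inv s4_proj f)" for f
  have k: "k (s4_proj f) = h f" for f
  proof -
    have "s4_proj (inv s4_proj (s4_proj f) - f) = 0"
      by (simp add: alg_homD[OF alg_hom_s4_proj] surj_f_inv_f[OF surj_s4_proj])
    then have "h (inv s4_proj (s4_proj f) - f) = 0" using ideal by (simp add: s4_proj_eq_0_iff)
    then show ?thesis by (simp add: k_def alg_homD(7)[OF h])
  qed
  show thesis
  proof
    have ex: "\<exists>p. f = s4_proj p" for f using surj_s4_proj by (metis surjD)
    have "k (f + g) = k f + k g \<and> k (f * g) = k f * k g" for f g
      using ex[of f] ex[of g]
      by (auto simp: k alg_homD[OF h] simp flip: alg_homD(1,2)[OF alg_hom_s4_proj])
    moreover have "k (scal c) = scal c" for c
      using k[of "scal c"] by (simp add: alg_homD[OF alg_hom_s4_proj] alg_homD[OF h])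
    ultimately show "alg_hom k" by (simp add: alg_hom_def)
  qed (rule k)
qed

section \<open>The quotient in coordinates\<close>

lemma s4_proj_components:
  "s4_proj cm_a = s4_a" "s4_proj cm_t = s4_t" "s4_proj (cm_x $ k) = s4_x $ k"
  "s4_proj (star cm_t) = s4_t" "s4_proj (star (cm_x $ k)) = s4_x $ k"
  "s4_proj (cm_alpha $ k) = 0" "s4_proj (cm_delta $ k) = 0"
proof -
  show "s4_proj cm_a = s4_a" "s4_proj cm_t = s4_t" "s4_proj (cm_x $ k) = s4_x $ k"
    by (simp_all add: s4_a_def s4_t_def s4_x_def)
  have "s4_proj (star cm_t - cm_t) = 0" "s4_proj (star (cm_x $ k) - cm_x $ k) = 0"
    "s4_proj (cm_alpha $ k) = 0" "s4_proj (cm_delta $ k) = 0"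
    unfolding s4_proj_eq_0_iff by (rule ideal_base, auto simp: s4_rels_def)+
  then show "s4_proj (star cm_t) = s4_t" "s4_proj (star (cm_x $ k)) = s4_x $ k"
    "s4_proj (cm_alpha $ k) = 0" "s4_proj (cm_delta $ k) = 0"
    by (simp_all add: alg_homD[OF alg_hom_s4_proj] s4_t_def s4_x_def)
qed

lemma s4_selfadjoint: "star s4_a = s4_a" "star s4_t = s4_t" "star (s4_x $ k) = s4_x $ k"
  using star_alg_hom_s4_proj unfolding star_alg_hom_def
  by (metis cm_selfadjoint(1) s4_proj_components)+

lemma map_matrix_s4_proj_cm_P:
  "map_matrix s4_proj cm_P =
     block (mat s4_a) (pauli_comb s4_t \<i> s4_x) (pauli_comb s4_t (- \<i>) s4_x) (mat (1 - s4_a))"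
proof -
  have "map_matrix s4_proj cm_P $ i $ j =
     block (mat s4_a) (pauli_comb s4_t \<i> s4_x) (pauli_comb s4_t (- \<i>) s4_x) (mat (1 - s4_a)) $ i $ j"
    for i j
    using exhaust_4[of i] exhaust_4[of j]
    by (subst cm_P_block)
      (auto simp: map_matrix_def block_simps vec4_simps pauli_comb_def pauli_def sum_3 mat_def
        alg_homD[OF alg_hom_s4_proj] s4_proj_components scal_one)
  then show ?thesis by (simp add: vec_eq_iff)
qed

text \<open>\<open>i\<close> plays the role of the imaginary unit. For \<open>d = - a\<close> this is the Clifford matrix of the vector
  \<open>(a, t, x, y, z)\<close>, for \<open>d = 1 - a\<close> the instanton projector.\<close>

definition cliff :: "'a::ring_1 \<Rightarrow> 'a \<Rightarrow> 'a \<Rightarrow> 'a \<Rightarrow> 'a \<Rightarrow> 'a \<Rightarrow> 'a \<Rightarrow> 'a^4^4" where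
  "cliff i a d t x y z = vector
    [vector [a, 0, t + i * z, i * x + y],
     vector [0, a, i * x - y, t - i * z],
     vector [t - i * z, - i * x - y, d, 0],
     vector [- i * x + y, t + i * z, 0, d]]"

lemma scal_ii: "scal \<i> * scal \<i> = (-1 :: 'a::complex_algebra)"
  "scal \<i> * (scal \<i> * f) = - (f :: 'a::complex_algebra)"
  by (simp_all add: scal_uminus scal_one flip: scal_mult mult.assoc)

lemma s4_e_cliff: "s4_e = cliff (scal \<i>) s4_a (1 - s4_a) s4_t (s4_x $ 1) (s4_x $ 2) (s4_x $ 3)"
proof -
  have "s4_e $ i $ j = cliff (scal \<i>) s4_a (1 - s4_a) s4_t (s4_x $ 1) (s4_x $ 2) (s4_x $ 3) $ i $ j" for
    i j
    using exhaust_4[of i] exhaust_4[of j]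
    by (subst s4_e_def, subst map_matrix_s4_proj_cm_P)
       (auto simp: block_simps cliff_def vec4_simps pauli_comb_def pauli_def sum_3 mat_def
        scal_one scal_uminus scal_ii algebra_simps)
  then show ?thesis by (simp add: vec_eq_iff)
qed

lemma s4_e_projection: "s4_e ** s4_e = s4_e" "dagger s4_e = s4_e"
proof -
  show "s4_e ** s4_e = s4_e"
    by (simp add: s4_e_def cm_P_projection flip: map_matrix_alg_hom_mult[OF alg_hom_s4_proj])
  have "dagger s4_e = map_matrix s4_proj (dagger cm_P)"
    using star_alg_hom_s4_proj by (simp add: s4_e_def map_matrix_def dagger_def star_alg_hom_def)
  then show "dagger s4_e = s4_e" by (simp add: cm_P_projection s4_e_def)
qed

text \<open>The equation of the sphere is not among \<open>s4_rels\<close>. It is a consequence of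
  e^2 = e, read off in the top left entry.\<close>

lemma s4_relation:
  "s4_t * s4_t + s4_x $ 1 * s4_x $ 1 + s4_x $ 2 * s4_x $ 2 + s4_x $ 3 * s4_x $ 3 = s4_a * (1 - s4_a)"
proof -
  have "(s4_e ** s4_e) $ 1 $ 1 = s4_e $ 1 $ 1" by (simp add: s4_e_projection)
  then show ?thesis
    by (simp add: s4_e_cliff cliff_def matrix_matrix_mult_def sum_4 vec4_simps algebra_simps scal_ii)
qed

text \<open>The entries of \<open>s4_e\<close> are polynomials in a, t and the x_k, and they are the
  images of generators under a surjection; so these five elements generate.\<close>

lemma s4_induct [case_names scal a t x add mult]:
  assumes "\<And>c. P (scal c)" "P s4_a" "P s4_t" "\<And>k. P (s4_x $ k)"
    "\<And>f g. P f \<Longrightarrow> P g \<Longrightarrow> P (f + g)" "\<And>f g. P f \<Longrightarrow> P g \<Longrightarrow> P (f * g)"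
  shows "P f"
proof -
  have m: "P (- f)" if "P f" for f
    using assms(6)[OF assms(1)[of "- 1"] that] by (simp add: scal_uminus scal_one)
  have d: "P (f - g)" if "P f" "P g" for f g
    using assms(5)[OF that(1) m[OF that(2)]] by simp
  have z: "P 0" "P 1" using assms(1)[of 0] assms(1)[of 1] by (simp_all add: scal_zero scal_one)
  have "P (s4_e $ i $ j)" for i j
    using exhaust_4[of i] exhaust_4[of j]
    by (auto simp: s4_e_cliff cliff_def vec4_simps intro!: z m d assms)
  then have e: "P (s4_proj (cm_gen i j))" for i j by (simp add: s4_e_def map_matrix_def cm_P_def)
  have "P (s4_proj f)" for f
    by (induction f rule: cm_sharp_induct)
      (simp_all add: alg_homD[OF alg_hom_s4_proj] assms(1,5,6) e)
  then show ?thesis using surj_s4_proj by (metis surjD)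
qed

text \<open>The converse of \<open>s4_relation\<close>: the sphere equation alone makes
  \<open>?M\<close> idempotent, and the shape of \<open>?M\<close> makes the additional relations
  hold. This is the source of characters, that is, of points.\<close>

lemma s4_hom_exists:
  fixes a t x y z :: "'r::complex_algebra"
  assumes "t * t + x * x + y * y + z * z = a * (1 - a)"
  obtains h :: "s4 \<Rightarrow> 'r" where "alg_hom h" "h s4_a = a" "h s4_t = t" "h (s4_x $ 1) = x"
    "h (s4_x $ 2) = y" "h (s4_x $ 3) = z"
proof -
  let ?M = "cliff (scal \<i>) a (1 - a) t x y z"
  \<comment> \<open>Oriented as a rewrite rule that eliminates z^2, so that all entries of M^2 reach
    a normal form.\<close>
  have r: "z * z = a - a * a - t * t - x * x - y * y"
    using assms by (simp add: algebra_simps)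
  then have r': "z * (z * w) = (a - a * a - t * t - x * x - y * y) * w" for w
    by (simp flip: mult.assoc)
  have "(?M ** ?M) $ i $ j = ?M $ i $ j" for i j
    using exhaust_4[of i] exhaust_4[of j]
    by (auto simp: cliff_def matrix_matrix_mult_def sum_4 vec4_simps algebra_simps scal_ii r r')
  then have M: "?M ** ?M = ?M" by (simp add: vec_eq_iff)
  have tr: "trace ?M = 2" by (simp add: trace_def sum_4 cliff_def vec4_simps)
  obtain h :: "cm_sharp \<Rightarrow> 'r" where h: "alg_hom h" "\<And>i j. h (cm_gen i j) = ?M $ i $ j"
    using cm_sharp_lift[OF M tr] by blast
  have half: "scal (1/2) * 2 = (1 :: 'r)"
    using scal_add[of "1/2" "1/2", where 'a='r] by (simp add: scal_one mult_2_right)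
  have half': "scal (1/2) * (f * 2) = (f :: 'r)" "scal (1/2) * (2 * f) = f"
    "f * (2 * scal (1/2)) = f" "scal (1/2) * f + scal (1/2) * f = f" for f
  proof -
    show "scal (1/2) * (f * 2) = f" using half by (simp only: mult.left_commute[of _ f] mult_1_right)
    then show *: "scal (1/2) * (2 * f) = f" by (simp only: mult.commute)
    show "f * (2 * scal (1/2)) = f" using half by (simp only: mult.commute[of 2] mult_1_right)
    show "scal (1/2) * f + scal (1/2) * f = f" using * by (simp only: distrib_left mult_2)
  qed
  note s = h alg_homD[OF h(1)] cliff_def vec4_simps algebra_simps scal_ii scal_uminus half'
    star_mult star_add star_diff star_uminus star_scal star_cm_gen
  have c: "h cm_a = a" "h cm_t = t" "h (cm_x $ 1) = x" "h (cm_x $ 2) = y" "h (cm_x $ 3) = z"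
    by (simp_all add: cm_component_simps s)
  have "h (star cm_t) = t" "h (star (cm_x $ 1)) = x" "h (star (cm_x $ 2)) = y" "h (star (cm_x $ 3)) = z"
     "h (cm_alpha $ 1) = 0" "h (cm_alpha $ 2) = 0" "h (cm_alpha $ 3) = 0"
     "h (cm_delta $ 1) = 0" "h (cm_delta $ 2) = 0" "h (cm_delta $ 3) = 0"
    by (simp_all add: cm_component_simps s)
  then have "h r = 0" if "r \<in> s4_rels" for r
    using that exhaust_3 unfolding s4_rels_def
    by (auto simp: alg_homD[OF h(1)] c) (metis c(3-5))+
  then obtain k :: "s4 \<Rightarrow> 'r" where k: "alg_hom k" "\<And>f. k (s4_proj f) = h f"
    using s4_lift[OF h(1)] by blast
  show thesis
    by (rule that[OF k(1)]) (simp_all add: k(2) c flip: s4_proj_components(1-3))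
qed

section \<open>Points and tangent vectors of the sphere\<close>

lemma exhaust_5: "i = 1 \<or> i = 2 \<or> i = 3 \<or> i = 4 \<or> i = (5 :: 5)"
proof (induct i)
  case (of_int z)
  then have "z = 0 \<or> z = 1 \<or> z = 2 \<or> z = 3 \<or> z = 4" by fastforce
  then show ?case by auto
qed

lemma UNIV_5: "UNIV = {1, 2, 3, 4, 5 :: 5}"
  using exhaust_5 by auto

lemma forall_5: "(\<forall>i::5. P i) \<longleftrightarrow> P 1 \<and> P 2 \<and> P 3 \<and> P 4 \<and> P 5"
  by (metis exhaust_5)

lemma sum_5: "sum f (UNIV :: 5 set) = f 1 + f 2 + f 3 + f 4 + f 5"
  unfolding UNIV_5 by (simp add: ac_simps)

lemma s4_points_iff:
  "p \<in> s4_points \<longleftrightarrow> (p$2)\<^sup>2 + (p$3)\<^sup>2 + (p$4)\<^sup>2 + (p$5)\<^sup>2 = p$1 * (1 - p$1)"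
proof -
  have "p \<in> s4_points \<longleftrightarrow> (norm (p - s4_centre))\<^sup>2 = (1/2)\<^sup>2"
    by (simp add: s4_points_def dist_norm norm_minus_commute power2_eq_iff_nonneg)
  also have "(norm (p - s4_centre))\<^sup>2 = (p$1 - 1/2)\<^sup>2 + (p$2)\<^sup>2 + (p$3)\<^sup>2 + (p$4)\<^sup>2 + (p$5)\<^sup>2"
    unfolding power2_norm_eq_inner
    by (simp add: inner_vec_def sum_5 s4_centre_def vec5_simps power2_eq_square)
  finally show ?thesis by (auto simp: power2_eq_square algebra_simps)
qed

lemma star_char_coords:
  assumes "star_alg_hom ch"
  shows "ch s4_a = of_real (char_coords ch $ 1)" "ch s4_t = of_real (char_coords ch $ 2)"
    "ch (s4_x $ 1) = of_real (char_coords ch $ 3)" "ch (s4_x $ 2) = of_real (char_coords ch $ 4)"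
    "ch (s4_x $ 3) = of_real (char_coords ch $ 5)"
proof -
  have "ch f = of_real (Re (ch f))" if "star f = f" for f
    using assms that
    by (metis star_alg_hom_def star_complex_def cnj.simps(2) complex_is_Real_iff neg_equal_zero
      of_real_Re)
  then show "ch s4_a = of_real (char_coords ch $ 1)" "ch s4_t = of_real (char_coords ch $ 2)"
    "ch (s4_x $ 1) = of_real (char_coords ch $ 3)" "ch (s4_x $ 2) = of_real (char_coords ch $ 4)"
    "ch (s4_x $ 3) = of_real (char_coords ch $ 5)"
    by (simp_all add: char_coords_def vec5_simps s4_selfadjoint)
qed

lemma alg_hom_s4_eqI:
  assumes g: "alg_hom g" and h: "alg_hom h" and "g s4_a = h s4_a" "g s4_t = h s4_t"
    "\<And>k. g (s4_x $ k) = h (s4_x $ k)"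
  shows "g = (h :: s4 \<Rightarrow> 'r::complex_algebra)"
proof
  show "g f = h f" for f
    by (induction f rule: s4_induct) (simp_all add: assms alg_homD[OF g] alg_homD[OF h])
qed

text \<open>Injective because the generators are self-adjoint, so the real parts determine a
  *-character; onto because the sphere equation is all that \<open>s4_hom_exists\<close> asks for.
  The character obtained respects the star since its values on the self-adjoint generators are
  real.\<close>

lemma bij_betw_char_coords: "bij_betw char_coords {ch. star_alg_hom ch} s4_points"
  unfolding bij_betw_def
proof (intro conjI inj_onI equalityI subsetI)
  fix g h assume gh: "g \<in> {ch. star_alg_hom ch}" "h \<in> {ch. star_alg_hom ch}"
    and eq: "char_coords g = char_coords h"
  then have "g (s4_x $ k) = h (s4_x $ k)" for k
    using exhaust_3[of k] by (auto simp: star_char_coords)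
  then show "g = h"
    using gh eq by (intro alg_hom_s4_eqI) (auto simp: star_char_coords star_alg_hom_def)
next
  fix p assume "p \<in> char_coords ` {ch. star_alg_hom ch}"
  then obtain ch where ch: "star_alg_hom ch" and p: "p = char_coords ch" by auto
  then have hom: "alg_hom ch" by (simp add: star_alg_hom_def)
  have "complex_of_real ((p$2)\<^sup>2 + (p$3)\<^sup>2 + (p$4)\<^sup>2 + (p$5)\<^sup>2) = of_real (p$1 * (1 - p$1))"
    using arg_cong[OF s4_relation, of ch]
    by (simp add: alg_homD[OF hom] star_char_coords[OF ch] p power2_eq_square)
  then show "p \<in> s4_points" unfolding s4_points_iff of_real_eq_iff .
next
  fix p assume "p \<in> s4_points"
  then have "complex_of_real ((p$2)\<^sup>2 + (p$3)\<^sup>2 + (p$4)\<^sup>2 + (p$5)\<^sup>2) = of_real (p$1 * (1 - p$1))"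
    by (simp only: s4_points_iff)
  then obtain ch :: "s4 \<Rightarrow> complex" where hom: "alg_hom ch"
    and c: "ch s4_a = of_real (p$1)" "ch s4_t = of_real (p$2)" "ch (s4_x $ 1) = of_real (p$3)"
     "ch (s4_x $ 2) = of_real (p$4)" "ch (s4_x $ 3) = of_real (p$5)"
    using s4_hom_exists[of "complex_of_real (p$2)" "of_real (p$3)" "of_real (p$4)" "of_real (p$5)"
      "of_real (p$1)"]
    by (auto simp: power2_eq_square)
  have "ch (star f) = star (ch f)" for f
  proof (induction f rule: s4_induct)
    case (x k)
    then show ?case using exhaust_3[of k] by (auto simp: s4_selfadjoint c star_complex_def)
  qed (simp_all add: star_scal star_add star_mult alg_homD[OF hom] s4_selfadjoint c,
    simp_all add: star_complex_def)
  then have "star_alg_hom ch" using hom by (simp add: star_alg_hom_def)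
  moreover have "char_coords ch = p"
    by (simp add: char_coords_def c vec_eq_iff forall_5 vec5_simps)
  ultimately show "p \<in> char_coords ` {ch. star_alg_hom ch}" by blast
qed

lemma s4_eval:
  assumes "p \<in> s4_points"
  shows "alg_hom (s4_eval p)" "s4_eval p s4_a = of_real (p$1)" "s4_eval p s4_t = of_real (p$2)"
    "s4_eval p (s4_x $ 1) = of_real (p$3)" "s4_eval p (s4_x $ 2) = of_real (p$4)"
    "s4_eval p (s4_x $ 3) = of_real (p$5)"
proof -
  have im: "p \<in> char_coords ` {ch. star_alg_hom ch}"
    using assms bij_betw_char_coords by (simp add: bij_betw_def)
  from inv_into_into[OF im] have *: "star_alg_hom (s4_eval p)" by (simp add: s4_eval_def)
  moreover from f_inv_into_f[OF im] have "char_coords (s4_eval p) = p" by (simp add: s4_eval_def)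
  ultimately show "alg_hom (s4_eval p)" "s4_eval p s4_a = of_real (p$1)" "s4_eval p s4_t = of_real (p$2)"
    "s4_eval p (s4_x $ 1) = of_real (p$3)" "s4_eval p (s4_x $ 2) = of_real (p$4)"
    "s4_eval p (s4_x $ 3) = of_real (p$5)"
    using star_char_coords[OF *] by (simp_all add: star_alg_hom_def)
qed

section \<open>Tangent vectors as point derivations\<close>

definition point_deriv :: "('a::complex_algebra \<Rightarrow> complex) \<Rightarrow> ('a \<Rightarrow> complex) \<Rightarrow> bool" where
  "point_deriv ch X \<longleftrightarrow> (\<forall>f g. X (f + g) = X f + X g)
     \<and> (\<forall>f g. X (f * g) = X f * ch g + ch f * X g) \<and> (\<forall>c. X (scal c) = 0)"

text \<open>\<open>vector_derivative\<close> carries information only where a derivative exists.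
  Existence holds for the coordinates and passes to the whole algebra through sums and
  products.\<close>

lemma s4_eval_curve_derivative:
  assumes on: "\<And>s. \<gamma> s \<in> s4_points" and \<gamma>: "(\<gamma> has_vector_derivative v) (at 0)"
  shows "\<exists>D. ((\<lambda>s. s4_eval (\<gamma> s) f) has_vector_derivative D) (at 0)"
proof (induction f rule: s4_induct)
  have co: "((\<lambda>s. complex_of_real (\<gamma> s $ i)) has_vector_derivative complex_of_real (v $ i)) (at 0)" for i
    by (rule bounded_linear.has_vector_derivative[OF bounded_linear_of_real
          bounded_linear.has_vector_derivative[OF bounded_linear_vec_nth \<gamma>]])
  note ev = s4_eval[OF on] and h = alg_homD[OF s4_eval(1)[OF on]]
  case (scal c) show ?case by (auto simp: h intro!: exI derivative_eq_intros)
  case a show ?case using co[of 1] by (auto simp: ev)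
  case t show ?case using co[of 2] by (auto simp: ev)
  case (x k) show ?case using exhaust_3[of k] co[of 3] co[of 4] co[of 5] by (auto simp: ev)
  case (add f g) then show ?case by (auto simp: h intro: has_vector_derivative_add)
  case (mult f g) then show ?case by (auto simp: h intro: has_vector_derivative_mult)
qed

text \<open>As v is orthogonal to the radius, the squared norm of p - c + s v is 1/4 + s^2 |v|^2
  with no linear term in s. The normalising factor therefore has derivative 0 at s = 0, and the
  velocity is v itself.\<close>

lemma tangent_curve:
  fixes p v :: "real^5"
  assumes p: "p \<in> s4_points" and v: "v \<bullet> (p - s4_centre) = 0"
  defines "\<gamma> \<equiv> \<lambda>s::real. s4_centre + (1/2) *\<^sub>R sgn (p - s4_centre + s *\<^sub>R v)"
  shows "\<gamma> s \<in> s4_points" "(\<gamma> has_vector_derivative v) (at 0)" "\<gamma> 0 = p"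
proof -
  have n: "norm (p - s4_centre) = 1/2"
    using p by (simp add: s4_points_def dist_norm norm_minus_commute)
  have "(norm (p - s4_centre + s *\<^sub>R v))\<^sup>2 = (norm (p - s4_centre))\<^sup>2 + s\<^sup>2 * (norm v)\<^sup>2" for s
    using v unfolding power2_norm_eq_inner
    by (simp add: inner_add_left inner_add_right inner_commute power2_eq_square)
  then have sq: "(norm (p - s4_centre + s *\<^sub>R v))\<^sup>2 = 1/4 + s\<^sup>2 * (norm v)\<^sup>2" for s
    by (simp add: n power2_eq_square)
  then have norm: "norm (p - s4_centre + s *\<^sub>R v) = sqrt (1/4 + s\<^sup>2 * (norm v)\<^sup>2)" for s
    by (metis norm_ge_zero real_sqrt_unique)
  have pos: "1/4 + s\<^sup>2 * (norm v)\<^sup>2 > 0" for s :: real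
    by (simp add: add_pos_nonneg)
  have "p - s4_centre + s *\<^sub>R v \<noteq> 0"
    using sq[of s] pos[of s] by auto
  then show "\<gamma> s \<in> s4_points"
    by (simp add: s4_points_def \<gamma>_def dist_norm norm_sgn)
  have s14: "sqrt (1/4) = 1/2" by (simp add: real_sqrt_divide)
  have \<gamma>: "\<gamma> = (\<lambda>s. s4_centre + (1/2 / sqrt (1/4 + s\<^sup>2 * (norm v)\<^sup>2)) *\<^sub>R (p - s4_centre + s *\<^sub>R v))"
    by (rule ext) (simp only: \<gamma>_def sgn_div_norm norm scaleR_scaleR divide_inverse)
  have "((\<lambda>s. 1/2 / sqrt (1/4 + s\<^sup>2 * (norm v)\<^sup>2)) has_real_derivative 0) (at 0)"
    by (auto intro!: derivative_eq_intros)
  then show "(\<gamma> has_vector_derivative v) (at 0)"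
    unfolding \<gamma> by (auto intro!: derivative_eq_intros simp: s14)
  show "\<gamma> 0 = p" by (simp add: \<gamma> s14)
qed

lemma tangent_deriv:
  assumes p: "p \<in> s4_points" and v: "v \<bullet> (p - s4_centre) = 0"
  shows "point_deriv (s4_eval p) (tangent_deriv p v)"
    "tangent_deriv p v s4_a = of_real (v$1)" "tangent_deriv p v s4_t = of_real (v$2)"
    "tangent_deriv p v (s4_x $ 1) = of_real (v$3)" "tangent_deriv p v (s4_x $ 2) = of_real (v$4)"
    "tangent_deriv p v (s4_x $ 3) = of_real (v$5)"
proof -
  define \<gamma> where "\<gamma> = (\<lambda>s::real. s4_centre + (1/2) *\<^sub>R sgn (p - s4_centre + s *\<^sub>R v))"
  have \<gamma>: "\<And>s. \<gamma> s \<in> s4_points" "(\<gamma> has_vector_derivative v) (at 0)" "\<gamma> 0 = p"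
    using tangent_curve[OF p v] by (simp_all add: \<gamma>_def)
  have X: "((\<lambda>s. s4_eval (\<gamma> s) f) has_vector_derivative tangent_deriv p v f) (at 0)" for f
    using s4_eval_curve_derivative[OF \<gamma>(1,2), of f]
    by (auto simp: tangent_deriv_def \<gamma>_def dest: vector_derivative_at)
  \<comment> \<open>By uniqueness, each differentiation rule for curves turns into a rule for
    \<open>tangent_deriv\<close>.\<close>
  have uniq: "tangent_deriv p v f = D" if "((\<lambda>s. s4_eval (\<gamma> s) f) has_vector_derivative D) (at 0)" for f
    D
    using X that vector_derivative_at by metis
  note ev = s4_eval[OF \<gamma>(1)] and h = alg_homD[OF s4_eval(1)[OF \<gamma>(1)]]
  have co: "((\<lambda>s. complex_of_real (\<gamma> s $ i)) has_vector_derivative complex_of_real (v $ i)) (at 0)" for i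
    by (rule bounded_linear.has_vector_derivative[OF bounded_linear_of_real
          bounded_linear.has_vector_derivative[OF bounded_linear_vec_nth \<gamma>(2)]])
  show "tangent_deriv p v s4_a = of_real (v$1)" "tangent_deriv p v s4_t = of_real (v$2)"
    "tangent_deriv p v (s4_x $ 1) = of_real (v$3)" "tangent_deriv p v (s4_x $ 2) = of_real (v$4)"
    "tangent_deriv p v (s4_x $ 3) = of_real (v$5)"
    by (rule uniq, simp only: ev, rule co)+
  have "tangent_deriv p v (f + g) = tangent_deriv p v f + tangent_deriv p v g" for f g
    by (rule uniq) (simp add: h has_vector_derivative_add X)
  moreover have "tangent_deriv p v (f * g) = tangent_deriv p v f * s4_eval p g + s4_eval p f *
    tangent_deriv p v g"
    for f g
    using has_vector_derivative_mult[OF X[of f] X[of g]]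
    by (intro uniq) (simp add: h \<gamma>(3) add.commute)
  moreover have "tangent_deriv p v (scal c) = 0" for c
    by (rule uniq) (simp add: h)
  ultimately show "point_deriv (s4_eval p) (tangent_deriv p v)"
    by (simp add: point_deriv_def)
qed

section \<open>Evaluation of forms at a point\<close>

text \<open>The determinant in \<open>eval_word\<close>, split off because it sees only the
  differentials of a word; the functions contribute the factor \<open>coeff_word\<close>.\<close>

definition alt_eval :: "('a \<Rightarrow> complex) list \<Rightarrow> 'a list \<Rightarrow> complex" where
  "alt_eval Xs gs = (if length gs = length Xs
     then \<Sum>\<pi> | \<pi> permutes {..<length Xs}. of_int (sign \<pi>) * (\<Prod>r<length Xs. (Xs ! \<pi> r) (gs ! r))
     else 0)"

lemma eval_word_eq: "eval_word ch Xs w = coeff_word ch w * alt_eval Xs (diffs w)"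
  by (simp add: eval_word_def alt_eval_def Let_def)

lemma diffs_append: "diffs (v @ w) = diffs v @ diffs w"
  by (induction v rule: diffs.induct) simp_all

lemma coeff_word_append: "coeff_word ch (v @ w) = coeff_word ch v * coeff_word ch w"
  by (induction v rule: diffs.induct) simp_all

text \<open>Linearity of the determinant in one slot. The free coefficients let one statement cover
  the sum rule, the Leibniz rule (c = ch g, d = ch f) and constants (c = d = 0).\<close>

lemma alt_eval_linear:
  assumes "\<And>X. X \<in> set Xs \<Longrightarrow> X h = c * X f + d * X g"
  shows "alt_eval Xs (gs @ h # hs) = c * alt_eval Xs (gs @ f # hs) + d * alt_eval Xs (gs @ g # hs)"
proof (cases "length (gs @ h # hs) = length Xs")
  case True
  let ?k = "length Xs" and ?n = "length gs"
  have n: "?n < ?k" using True by simp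
  have pr: "(\<Prod>r<?k. (Xs ! \<pi> r) ((gs @ u # hs) ! r))
      = (Xs ! \<pi> ?n) u * (\<Prod>r\<in>{..<?k} - {?n}. (Xs ! \<pi> r) ((gs @ h # hs) ! r))" for u \<pi>
  proof -
    have "(gs @ u # hs) ! r = (gs @ h # hs) ! r" if "r \<noteq> ?n" for r
      using that by (cases r ?n rule: linorder_cases) (auto simp: nth_append nth_Cons')
    then have "(\<Prod>r\<in>{..<?k} - {?n}. (Xs ! \<pi> r) ((gs @ u # hs) ! r))
        = (\<Prod>r\<in>{..<?k} - {?n}. (Xs ! \<pi> r) ((gs @ h # hs) ! r))"
      by (intro prod.cong) auto
    then show ?thesis by (subst prod.remove[of _ ?n]) (auto simp: n)
  qed
  have "of_int (sign \<pi>) * (\<Prod>r<?k. (Xs ! \<pi> r) ((gs @ h # hs) ! r))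
      = c * (of_int (sign \<pi>) * (\<Prod>r<?k. (Xs ! \<pi> r) ((gs @ f # hs) ! r)))
      + d * (of_int (sign \<pi>) * (\<Prod>r<?k. (Xs ! \<pi> r) ((gs @ g # hs) ! r)))"
    if "\<pi> permutes {..<?k}" for \<pi>
  proof -
    have "Xs ! \<pi> ?n \<in> set Xs" using permutes_in_image[OF that] n by auto
    then show ?thesis
      unfolding pr[of _ h] pr[of _ f] pr[of _ g] by (simp add: assms algebra_simps)
  qed
  then show ?thesis
    using True by (simp add: alt_eval_def sum_distrib_left flip: sum.distrib)
qed (simp add: alt_eval_def)

text \<open>Composing every permutation with the transposition of the two adjacent slots permutes
  the summands and reverses each sign.\<close>

lemma alt_eval_swap: "alt_eval Xs (gs @ f # g # hs) = - alt_eval Xs (gs @ g # f # hs)"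
proof (cases "length (gs @ f # g # hs) = length Xs")
  case True
  let ?k = "length Xs" and ?n = "length gs" and ?A = "{..<length Xs}"
  let ?\<tau> = "Transposition.transpose ?n (Suc ?n)" and ?T = "\<lambda>gs \<pi>. of_int (sign \<pi>) * (\<Prod>r<?k. (Xs ! \<pi> r)
    (gs ! r))"
  have \<tau>: "?\<tau> permutes ?A" using True by (intro permutes_swap_id) auto
  have "?T (gs @ f # g # hs) (\<pi> \<circ> ?\<tau>) = - ?T (gs @ g # f # hs) \<pi>" if "\<pi> permutes ?A" for \<pi>
  proof -
    have "sign (\<pi> \<circ> ?\<tau>) = - sign \<pi>"
      using that by (subst sign_compose)
        (auto simp: sign_swap_id permutation_swap_id intro: permutes_imp_permutation)
    moreover have "(\<Prod>r<?k. (Xs ! \<pi> (?\<tau> r)) ((gs @ f # g # hs) ! r))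
        = (\<Prod>r<?k. (Xs ! \<pi> r) ((gs @ g # f # hs) ! r))"
      by (subst prod.permute[OF \<tau>]) (auto simp: Transposition.transpose_def nth_append nth_Cons
          split: nat.splits intro!: prod.cong)
    ultimately show ?thesis by simp
  qed
  then have "(\<Sum>\<pi> | \<pi> permutes ?A. ?T (gs @ f # g # hs) (\<pi> \<circ> ?\<tau>))
      = (\<Sum>\<pi> | \<pi> permutes ?A. - ?T (gs @ g # f # hs) \<pi>)"
    by (intro sum.cong) auto
  then show ?thesis
    using True sum_permutations_compose_right[OF \<tau>, of "?T (gs @ f # g # hs)"]
    by (simp add: alt_eval_def sum_negf)
qed (simp add: alt_eval_def)

section \<open>Independence of the representative\<close>

definition form_eval :: "('a \<Rightarrow> complex) \<Rightarrow> ('a \<Rightarrow> complex) list \<Rightarrow> ('a word \<Rightarrow>\<^sub>0 int) \<Rightarrow> complex" where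
  "form_eval ch Xs = extend of_int (\<lambda>w. eval_word ch Xs (letters w))"

lemma form_eval_simps:
  "form_eval ch Xs 0 = 0" "form_eval ch Xs (u + v) = form_eval ch Xs u + form_eval ch Xs v"
  "form_eval ch Xs (u - v) = form_eval ch Xs u - form_eval ch Xs v"
  "form_eval ch Xs (- u) = - form_eval ch Xs u"
  "form_eval ch Xs (Poly_Mapping.single w c) = of_int c * eval_word ch Xs (letters w)"
  by (simp_all add: form_eval_def extend_add extend_diff extend_uminus extend_single)

text \<open>\<open>form_eval\<close> is additive but not multiplicative, so vanishing on a relation
  says nothing about its multiples. Hence the relation is placed between two arbitrary words from
  the outset.\<close>

lemma form_eval_dr_rels:
  assumes ch: "alg_hom ch" and Xs: "\<And>X. X \<in> set Xs \<Longrightarrow> point_deriv ch X" and r: "r \<in> dr_rels"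
  shows "form_eval ch Xs (Poly_Mapping.single v 1 * r * Poly_Mapping.single w 1) = 0"
proof -
  note ev = gen_def mult_single plus_word_def form_eval_simps eval_word_eq diffs_append
    coeff_word_append alg_homD[OF ch] distrib_left distrib_right left_diff_distrib right_diff_distrib
  have add: "alt_eval Xs (gs @ (f + g) # hs) = alt_eval Xs (gs @ f # hs) + alt_eval Xs (gs @ g # hs)"
    for f g gs hs
    using alt_eval_linear[of Xs "f + g" 1 f 1 g gs hs] Xs by (simp add: point_deriv_def)
  have mult: "alt_eval Xs (gs @ (f * g) # hs)
      = ch g * alt_eval Xs (gs @ f # hs) + ch f * alt_eval Xs (gs @ g # hs)" for f g gs hs
    using alt_eval_linear[of Xs "f * g" "ch g" f "ch f" g gs hs] Xs
    by (simp add: point_deriv_def mult.commute)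
  have scal: "alt_eval Xs (gs @ scal c # hs) = 0" for c gs hs
    using alt_eval_linear[of Xs "scal c" 0 undefined 0 undefined gs hs] Xs
    by (simp add: point_deriv_def)
  \<comment> \<open>Multiplicativity of \<open>ch\<close> and the slot rules settle every relation
    except the anticommutation of differentials, which is left for
    \<open>alt_eval_swap\<close>.\<close>
  from r show ?thesis
    unfolding dr_rels_def Un_iff mem_Collect_eq singleton_iff
    by (elim disjE exE conjE)
       (simp_all add: ev add mult scal flip: one_word, subst alt_eval_swap, simp)
qed

lemma form_eval_ideal:
  assumes ch: "alg_hom ch" and Xs: "\<And>X. X \<in> set Xs \<Longrightarrow> point_deriv ch X"
    and u: "u \<in> ideal_gen dr_rels"
  shows "form_eval ch Xs u = 0"
proof -
  have scale: "form_eval ch Xs (of_int c * u) = of_int c * form_eval ch Xs u" for c u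
  proof (induction u rule: poly_mapping_induct)
    case (single m d)
    have "of_int c * Poly_Mapping.single m d = Poly_Mapping.single m (c * d)"
      by (subst single_of_int[symmetric]) (simp add: mult_single del: single_of_int)
    then show ?case by (simp add: form_eval_simps)
  qed (simp_all add: form_eval_simps distrib_left)
  \<comment> \<open>Strengthened to two-sided multiples, so that the closure rules of the ideal only
    change \<open>a\<close> and \<open>b\<close>.\<close>
  have "form_eval ch Xs (a * u * b) = 0" for a b
    using u
  proof (induction arbitrary: a b)
    case (ideal_base r)
    show ?case
    proof (induction a rule: poly_mapping_induct)
      case (single v c)
      show ?case
      proof (induction b rule: poly_mapping_induct)
        case (single w d)
        have "Poly_Mapping.single v c * r * Poly_Mapping.single w d
          = of_int c * (of_int d * (Poly_Mapping.single v 1 * r * Poly_Mapping.single w 1))"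
          unfolding single_word_of_int[of v c] single_word_of_int[of w d]
          using mult_of_int_commute[of d "Poly_Mapping.single v 1 * r"] by (simp only: mult.assoc) (simp
            flip: mult.assoc)
        then show ?case by (simp add: scale form_eval_dr_rels[OF ch Xs ideal_base])
      qed (simp_all add: form_eval_simps distrib_left)
    qed (simp_all add: form_eval_simps distrib_right)
  next
    case (ideal_left u w)
    then show ?case by (metis mult.assoc)
  next
    case (ideal_right u w)
    then show ?case by (metis mult.assoc)
  qed (simp_all add: form_eval_simps distrib_left distrib_right)
  from this[of 1 1] show ?thesis by simp
qed

lemma form_at_abs:
  assumes ch: "alg_hom ch" and Xs: "\<And>X. X \<in> set Xs \<Longrightarrow> point_deriv ch X"
  shows "form_at ch Xs (abs_forms u) = form_eval ch Xs u"
proof -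
  have "rep_forms (abs_forms u) - u \<in> ideal_gen dr_rels"
    by (simp add: Quotient3_abs_rep[OF Quotient3_forms] flip: forms.abs_eq_iff)
  from form_eval_ideal[OF ch Xs this] show ?thesis
    by (simp add: form_eval_simps form_at_def flip: form_eval_def)
qed

lemma form_at_add:
  assumes ch: "alg_hom ch" and Xs: "\<And>X. X \<in> set Xs \<Longrightarrow> point_deriv ch X"
  shows "form_at ch Xs (\<omega> + \<eta>) = form_at ch Xs \<omega> + form_at ch Xs \<eta>"
    "form_at ch Xs (\<omega> - \<eta>) = form_at ch Xs \<omega> - form_at ch Xs \<eta>"
    "form_at ch Xs (- \<omega>) = - form_at ch Xs \<omega>" "form_at ch Xs 0 = 0"
proof -
  have "\<exists>u. \<omega> = abs_forms u" for \<omega> :: "'a forms" by (induction \<omega> rule: forms.abs_induct) blast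
  then obtain u v where "\<omega> = abs_forms u" "\<eta> = abs_forms v" by metis
  then show "form_at ch Xs (\<omega> + \<eta>) = form_at ch Xs \<omega> + form_at ch Xs \<eta>"
    "form_at ch Xs (\<omega> - \<eta>) = form_at ch Xs \<omega> - form_at ch Xs \<eta>"
    "form_at ch Xs (- \<omega>) = - form_at ch Xs \<omega>" "form_at ch Xs 0 = 0"
    by (simp_all add: form_at_abs[OF ch Xs] form_eval_simps plus_forms.abs_eq minus_forms.abs_eq
        uminus_forms.abs_eq zero_forms_def)
qed

lemma form_at_sum:
  assumes "alg_hom ch" "\<And>X. X \<in> set Xs \<Longrightarrow> point_deriv ch X" "finite A"
  shows "form_at ch Xs (sum f A) = (\<Sum>i\<in>A. form_at ch Xs (f i))"
  using assms(3) by (induction A rule: finite_induct) (simp_all add: form_at_add[OF assms(1,2)])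

text \<open>A function on each side of the two differentials, because this is the shape of the
  summands in an entry of e de de e.\<close>

lemma form_at_2:
  assumes ch: "alg_hom ch" and X: "point_deriv ch X" "point_deriv ch Y"
  shows "form_at ch [X, Y] (fn f * (dd (fn g1) * dd (fn g2) * fn h))
    = ch f * ch h * (X g1 * Y g2 - Y g1 * X g2)"
proof -
  have perm: "sum F {\<pi>. \<pi> permutes {..<Suc (Suc 0)}} = F id + F (Transposition.transpose 0 (Suc 0))" for
    F :: "(nat \<Rightarrow> nat) \<Rightarrow> complex"
  proof -
    have i: "{..<Suc (Suc 0)} = insert 0 {Suc 0}" by auto
    show ?thesis
      unfolding i by (subst sum_over_permutations_insert) (simp_all add: permutes_sing)
  qed
  have "fn f * (dd (fn g1) * dd (fn g2) * fn h) = abs_forms (Poly_Mapping.single (Word [Fn f, Df g1, Df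
    g2, Fn h]) 1)"
    by (simp add: fn.abs_eq dd.abs_eq d_free_add times_forms.abs_eq)
       (simp add: gen_def mult_single plus_word_def)
  moreover have at: "form_at ch [X, Y] (abs_forms u) = form_eval ch [X, Y] u" for u
    by (rule form_at_abs[OF ch]) (use X in auto)
  ultimately show ?thesis
    by (simp add: at form_eval_simps eval_word_eq)
      (simp add: alt_eval_def perm sign_swap_id sign_id)
qed

text \<open>The 4 x 4 determinant grouped by 2 x 2 minors, those of X, Y against those of Z, W: the
  Laplace expansion in the pattern that \<open>wedge4\<close> records later.\<close>

lemma form_at_4:
  assumes ch: "alg_hom ch" and X: "point_deriv ch X" "point_deriv ch Y" "point_deriv ch Z" "point_deriv
    ch W"
  shows "form_at ch [X, Y, Z, W] (fn f * (dd (fn g1) * dd (fn g2) * dd (fn g3) * dd (fn g4)))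
    = ch f * ((X g1 * Y g2 - X g2 * Y g1) * (Z g3 * W g4 - Z g4 * W g3)
      - (X g1 * Y g3 - X g3 * Y g1) * (Z g2 * W g4 - Z g4 * W g2)
      + (X g1 * Y g4 - X g4 * Y g1) * (Z g2 * W g3 - Z g3 * W g2)
      + (X g2 * Y g3 - X g3 * Y g2) * (Z g1 * W g4 - Z g4 * W g1)
      - (X g2 * Y g4 - X g4 * Y g2) * (Z g1 * W g3 - Z g3 * W g1)
      + (X g3 * Y g4 - X g4 * Y g3) * (Z g1 * W g2 - Z g2 * W g1))"
proof -
  let ?a = "Suc 0" and ?b = "Suc (Suc 0)" and ?c = "Suc (Suc (Suc 0))"
  have i: "{..<Suc ?c} = insert 0 (insert ?a (insert ?b {?c}))" by auto
  have fin: "finite {?a, ?b, ?c}" "0 \<notin> {?a, ?b, ?c}" "finite {?b, ?c}" "?a \<notin> {?b, ?c}"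
     "finite {?c}" "?b \<notin> {?c}" by auto
  have len: "length [X, Y, Z, W] = Suc ?c" "length [g1, g2, g3, g4] = Suc ?c" by simp_all
  have "fn f * (dd (fn g1) * dd (fn g2) * dd (fn g3) * dd (fn g4))
     = abs_forms (Poly_Mapping.single (Word [Fn f, Df g1, Df g2, Df g3, Df g4]) 1)"
    by (simp add: fn.abs_eq dd.abs_eq d_free_add times_forms.abs_eq)
       (simp add: gen_def mult_single plus_word_def)
  moreover have at: "form_at ch [X, Y, Z, W] (abs_forms u) = form_eval ch [X, Y, Z, W] u" for u
    by (rule form_at_abs[OF ch]) (use X in auto)
  moreover have "alt_eval [X, Y, Z, W] [g1, g2, g3, g4] =
      (X g1 * Y g2 - X g2 * Y g1) * (Z g3 * W g4 - Z g4 * W g3)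
      - (X g1 * Y g3 - X g3 * Y g1) * (Z g2 * W g4 - Z g4 * W g2)
      + (X g1 * Y g4 - X g4 * Y g1) * (Z g2 * W g3 - Z g3 * W g2)
      + (X g2 * Y g3 - X g3 * Y g2) * (Z g1 * W g4 - Z g4 * W g1)
      - (X g2 * Y g4 - X g4 * Y g2) * (Z g1 * W g3 - Z g3 * W g1)
      + (X g3 * Y g4 - X g4 * Y g3) * (Z g1 * W g2 - Z g2 * W g1)"
    unfolding alt_eval_def len
    by (simp only: if_True simp_thms i sum_over_permutations_insert[OF fin(1,2)]
        sum_over_permutations_insert[OF fin(3,4)] sum_over_permutations_insert[OF fin(5,6)]
          permutes_sing)
      (simp add: sign_swap_id permutation_swap_id sign_compose sign_id permutation_compose
        Transposition.transpose_def algebra_simps)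
  ultimately show ?thesis
    by (simp add: at form_eval_simps eval_word_eq)
qed

section \<open>Calculus of the projector\<close>

lemma matrix_add_rdistrib: "((A :: 'a::semiring_1^'n^'m) + B) ** C = A ** C + B ** C"
  by (simp add: vec_eq_iff matrix_matrix_mult_def distrib_right sum.distrib)

text \<open>\<open>i\<close> commutes with the anticommuting entries \<open>p, q, r, s, w\<close>, so \<open>D\<^sup>4\<close> is the sum of
  the products of four distinct entries times Clifford matrices; as the product of all five Clifford
  matrices is 1, such a product of four is, up to sign, the remaining one.\<close>

lemma cliff_power4:
  fixes i p q r s w :: "'a::ring_1"
  assumes sq: "p * p = 0" "q * q = 0" "r * r = 0" "s * s = 0" "w * w = 0"
    and ac: "q * p = - (p * q)" "r * p = - (p * r)" "s * p = - (p * s)" "w * p = - (p * w)"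
      "r * q = - (q * r)" "s * q = - (q * s)" "w * q = - (q * w)"
      "s * r = - (r * s)" "w * r = - (r * w)" "w * s = - (s * w)"
    and i: "i * i = -1" "p * i = i * p" "q * i = i * q" "r * i = i * r" "s * i = i * s" "w * i = i * w"
  defines "D \<equiv> cliff i p (- p) q r s w"
  shows "(D ** D) ** (D ** D) = (\<chi> j k. 24 * cliff i (q * r * s * w) (- (q * r * s * w))
      (- (p * r * s * w)) (p * q * s * w) (- (p * q * r * w)) (p * q * r * s) $ j $ k)"
    "\<And>a d t x y z. (\<And>g. g * i = i * g) \<Longrightarrow> trace (cliff i a d t x y z ** (D ** D)) = 0"
proof -
  have a3: "g * (h * u) = - (h * (g * u))" if "g * h = - (h * g)" for g h u :: 'a
    using arg_cong[OF that, of "\<lambda>v. v * u"] by (simp add: mult.assoc)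
  have c3: "g * (i * u) = i * (g * u)" if "g * i = i * g" for g u :: 'a
    using arg_cong[OF that, of "\<lambda>v. v * u"] by (simp add: mult.assoc)
  have s3: "g * (g * u) = 0" if "g * g = 0" for g u :: 'a
    using arg_cong[OF that, of "\<lambda>v. v * u"] by (simp add: mult.assoc)
  have i3: "i * (i * u) = - u" for u
    using arg_cong[OF i(1), of "\<lambda>v. v * u"] by (simp add: mult.assoc)
  note rules = sq ac i sq[THEN s3] ac[THEN a3] i(2-)[THEN c3] i3
  \<comment> \<open>The sum over A < B of dy_A dy_B g_A g_B. The square of \<open>D\<close> is twice
    this, since exchanging A and B changes the sign both of the entries and of the Clifford
    matrices, and the squares of the entries vanish.\<close>
  define E :: "'a^4^4" where "E =
    vector [vector [- i * q * w + i * r * s, - i * q * r - q * s - r * w + i * s * w,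
        p * q + i * p * w, i * p * r + p * s],
     vector [- i * q * r + q * s + r * w + i * s * w, i * q * w - i * r * s,
        i * p * r - p * s, p * q - i * p * w],
     vector [- p * q + i * p * w, i * p * r + p * s,
        i * q * w + i * r * s, i * q * r + q * s - r * w + i * s * w],
     vector [i * p * r - p * s, - p * q - i * p * w,
        i * q * r - q * s + r * w + i * s * w, - i * q * w - i * r * s]]"
  have DD: "D ** D = E + E"
    by (simp add: vec_eq_iff forall_4 D_def E_def cliff_def matrix_matrix_mult_def sum_4 vec4_simps)
       (simp add: algebra_simps rules)
  have six: "6 * u = u + u + u + u + u + u" "24 * u = 6 * u + 6 * u + 6 * u + 6 * u" for u :: 'a
  proof -
    have "(6::'a) = 1 + 1 + 1 + 1 + 1 + 1" "(24::'a) = 6 + 6 + 6 + 6" by simp_all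
    then show "6 * u = u + u + u + u + u + u" "24 * u = 6 * u + 6 * u + 6 * u + 6 * u"
      by (simp_all only: distrib_right mult_1_left)
  qed
  \<comment> \<open>Four distinct entries can be distributed over the two factors in 6 ways, all
    giving the same term; repeated entries give 0. With D^4 = 4 E^2 this yields 24 = 4!.\<close>
  have EE: "(E ** E) $ j $ k = 6 * cliff i (q * r * s * w) (- (q * r * s * w))
      (- (p * r * s * w)) (p * q * s * w) (- (p * q * r * w)) (p * q * r * s) $ j $ k" for j k
    using exhaust_4[of j] exhaust_4[of k] unfolding six(1)
    by (elim disjE; simp add: E_def cliff_def matrix_matrix_mult_def sum_4 vec4_simps;
        simp add: algebra_simps rules)
  show "(D ** D) ** (D ** D) = (\<chi> j k. 24 * cliff i (q * r * s * w) (- (q * r * s * w))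
      (- (p * r * s * w)) (p * q * s * w) (- (p * q * r * w)) (p * q * r * s) $ j $ k)"
    unfolding vec_eq_iff
    by (intro allI) (simp only: DD matrix_add_ldistrib matrix_add_rdistrib vector_add_component EE
        six(2) vec_lambda_beta add.assoc)
  \<comment> \<open>For B different from C the traces of g_B g_C and of g_A g_B g_C vanish, whatever
    A is. This is what makes the trace of the curvature vanish.\<close>
  fix a d t x y z assume ci: "\<And>g. g * i = i * g"
  have "trace (cliff i a d t x y z ** E) = 0"
    using ci[of a, THEN c3] ci[of d, THEN c3] ci[of t, THEN c3] ci[of x, THEN c3] ci[of y, THEN c3]
      ci[of z, THEN c3]
    by (simp add: trace_def E_def cliff_def matrix_matrix_mult_def sum_4 vec4_simps)
       (simp add: algebra_simps i3)
  then show "trace (cliff i a d t x y z ** (D ** D)) = 0"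
    by (simp add: DD matrix_add_ldistrib trace_def sum.distrib)
qed

text \<open>Forms are integer combinations of words. Letters are attached on the left, where
  \<open>ginv\<close> and \<open>dd\<close> can be computed one letter at a time; integer
  coefficients are repeated sums, which needs only addition and negation.\<close>

lemma forms_induct [case_names one fn dd add uminus]:
  fixes \<omega> :: "'a::complex_algebra forms"
  assumes "P 1" "\<And>f \<omega>. P \<omega> \<Longrightarrow> P (fn f * \<omega>)" "\<And>f \<omega>. P \<omega> \<Longrightarrow> P (dd (fn f) * \<omega>)"
    "\<And>\<omega> \<eta>. P \<omega> \<Longrightarrow> P \<eta> \<Longrightarrow> P (\<omega> + \<eta>)" "\<And>\<omega>. P \<omega> \<Longrightarrow> P (- \<omega>)"
  shows "P \<omega>"
proof -
  have word: "P (abs_forms (Poly_Mapping.single (Word w) 1))" for w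
  proof (induction w)
    case Nil then show ?case using assms(1) by (simp add: one_word one_forms_def)
  next
    case (Cons l w)
    have "abs_forms (Poly_Mapping.single (Word (l # w)) 1)
        = (case l of Fn f \<Rightarrow> fn f | Df f \<Rightarrow> dd (fn f)) * abs_forms (Poly_Mapping.single (Word w) 1)"
      unfolding word_Cons
      by (simp add: fn.abs_eq dd.abs_eq d_free_add times_forms.abs_eq split: letter.split)
    then show ?case using Cons assms(2,3) by (simp split: letter.split)
  qed
  have zero: "P 0" using assms(4)[OF assms(1) assms(5)[OF assms(1)]] by simp
  have "P (abs_forms p)" for p
  proof (induction p rule: poly_mapping_induct)
    case zero show ?case using \<open>P 0\<close> by (simp add: zero_forms_def)
  next
    case (add p q) then show ?case using assms(4) by (metis plus_forms.abs_eq)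
  next
    case (single m c)
    obtain w where m: "m = Word w" by (cases m)
    show ?case
    proof (induction c rule: int_induct[where k = 0])
      case base show ?case using zero by (simp add: zero_forms_def)
    next
      case (step1 c)
      from assms(4)[OF step1(2) word[of w]] show ?case by (simp add: m single_add plus_forms.abs_eq)
    next
      case (step2 c)
      from assms(4)[OF step2(2) assms(5)[OF word[of w]]] show ?case
        by (simp add: m single_diff minus_forms.abs_eq)
    qed
  qed
  then show ?thesis by (induction \<omega> rule: forms.abs_induct)
qed

section \<open>Calculus rules for forms\<close>

lemma fn_0: "fn 0 = 0"
  using fn_hom(1)[of 0 0] by simp

lemma fn_uminus: "fn (- f) = - fn f"
  using fn_hom(1)[of f "- f"] by (simp add: fn_0 eq_neg_iff_add_eq_0 add.commute)

lemma fn_diff: "fn (f - g) = fn f - fn g"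
  using fn_hom(1)[of f "- g"] by (simp add: fn_uminus)

lemma fn_numeral: "fn (numeral k) = numeral k"
  by (induction k) (simp_all only: numeral.simps fn_hom)

lemma dd_one: "dd 1 = 0" and ginv_one: "ginv 1 = 1"
  using dd_scal[of 1] ginv_hom(4)[of 1] by (simp_all add: scal_one fn_hom)

lemma ginv_uminus: "ginv (- u) = - ginv u"
  using ginv_hom(2)[of 0 u] by (simp add: ginv_zero)

lemma fn_central: "fn f * \<omega> = \<omega> * fn f"
proof (induction \<omega> rule: forms_induct)
  case (fn g \<omega>)
  have "fn f * fn g = fn g * fn f" by (simp add: mult.commute flip: fn_hom)
  with fn show ?case by (metis mult.assoc)
next
  case (dd g \<omega>)
  with forms_graded_commutative(1)[of f g] show ?case by (metis mult.assoc)
qed (simp_all add: distrib_left distrib_right)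

lemma dd_dd: "dd (dd \<omega>) = 0"
  by (induction \<omega> rule: forms_induct)
    (simp_all add: dd_one dd_zero dd_simps dd_uminus ginv_hom dd_dd_fn)

lemma ginv_ginv: "ginv (ginv \<omega>) = \<omega>"
  by (induction \<omega> rule: forms_induct) (simp_all add: ginv_one ginv_hom ginv_uminus)

lemma ginv_dd: "ginv (dd \<omega>) = - dd (ginv \<omega>)"
  by (induction \<omega> rule: forms_induct)
    (simp_all add: dd_one ginv_one ginv_zero dd_simps dd_uminus ginv_hom ginv_uminus dd_dd_fn)

text \<open>Anticommutation yields only that twice the square is 0; multiplication by the scalar 1/2
  removes the factor.\<close>

lemma dd_fn_square: "dd (fn f) * dd (fn f) = 0"
proof -
  have "dd (fn f) * dd (fn f) + dd (fn f) * dd (fn f) = 0"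
    using forms_graded_commutative(2)[of f f] by (simp add: eq_neg_iff_add_eq_0)
  moreover have "fn (scal (1/2)) * (u + u) = u" for u :: "'a forms"
  proof -
    have "fn (scal (1/2)) + fn (scal (1/2)) = (1 :: 'a forms)"
      by (simp add: scal_one fn_hom(3) flip: fn_hom(1) scal_add)
    then show ?thesis by (metis distrib_left distrib_right mult_1_left)
  qed
  ultimately show ?thesis by (metis mult_zero_right)
qed

text \<open>The signed differential \<open>D\<close> satisfies D(u E) = (D u) E + u dE, D(u dE) =
  -(D u) dE and D D = 0 in every degree. The two terms containing D w then cancel after
  multiplication by E, as E^2 = E. Rows of arbitrary forms are allowed in order that F can be
  applied twice.\<close>

lemma curvature_grassmann_forms:
  fixes e :: "'a::complex_algebra^'n^'n"
  assumes e: "e ** e = e"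
  shows "curvature (grassmann_conn e) (row_mult w (map_matrix fn e))
    = row_mult (row_mult w (d_matrix e ** d_matrix e)) (map_matrix fn e)"
proof -
  define E where "E = map_matrix fn e"
  define D :: "'a forms^'n \<Rightarrow> 'a forms^'n" where "D w = (\<chi> i. dd (ginv (w $ i)))" for w
  let ?dE = "d_matrix e"
  have EE: "E ** E = E"
    by (simp add: E_def e flip: map_matrix_fn_mult)
  have conn: "grassmann_conn e w = row_mult (D w) E" for w
    by (simp add: grassmann_conn_def D_def E_def)
  have D_add: "D (w + w') = D w + D w'" for w w'
    by (simp add: D_def vec_eq_iff ginv_hom dd_simps)
  have D_E: "D (row_mult u E) = row_mult (D u) E + row_mult u ?dE" for u
    by (simp add: D_def row_mult_def vec_eq_iff E_def map_matrix_def d_matrix_def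
        ginv_sum dd_sum ginv_hom dd_simps sum.distrib ginv_ginv)
  have DD: "D (D u) = 0" for u
    by (simp add: D_def vec_eq_iff ginv_dd dd_uminus dd_dd dd_zero ginv_ginv)
  have D_dE: "D (row_mult u ?dE) = - row_mult (D u) ?dE" for u
    by (simp add: D_def row_mult_def vec_eq_iff d_matrix_def ginv_sum dd_sum ginv_hom dd_simps
        dd_uminus dd_dd_fn sum_negf)
  have "curvature (grassmann_conn e) (row_mult w E)
      = row_mult (D (row_mult (row_mult (D w) E) E + row_mult (row_mult w ?dE) E)) E"
    by (simp only: curvature_def conn D_E row_mult_linear)
  also have "row_mult (row_mult (D w) E) E = row_mult (D w) E"
    by (simp only: row_mult_assoc EE)
  also have "D (row_mult (D w) E + row_mult (row_mult w ?dE) E)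
      = row_mult (D w) ?dE - row_mult (row_mult (D w) ?dE) E + row_mult (row_mult w ?dE) ?dE"
    by (simp add: D_add D_E DD D_dE) (simp add: row_mult_def vec_eq_iff sum_negf)
  finally show ?thesis
    by (simp add: row_mult_linear row_mult_assoc[where M = E and N = E] EE
        row_mult_assoc[of w ?dE ?dE, symmetric] flip: E_def)
qed

text \<open>Differentiating e^2 = e gives dE = dE E + E dE. Multiplying by dE on the right and on
  the left gives two expressions for dE dE sharing the term dE E dE; comparing them shows that E
  commutes with dE dE. All forms of the curvature matrix follow from this and E^2 = E.\<close>

lemma curv_matrix_grassmann:
  fixes e :: "'a::complex_algebra^'n^'n"
  assumes e: "e ** e = e"
  defines "E \<equiv> map_matrix fn e" and "\<Omega> \<equiv> d_matrix e ** d_matrix e"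
  shows "E ** \<Omega> = \<Omega> ** E" "curv_matrix (grassmann_conn e) e = E ** \<Omega> ** E"
    "curv_matrix (grassmann_conn e) e = E ** \<Omega>"
    "curv_matrix (grassmann_conn e) e ** curv_matrix (grassmann_conn e) e = E ** (\<Omega> ** \<Omega>)"
proof -
  let ?dE = "d_matrix e"
  have EE: "E ** E = E"
    by (simp add: E_def e flip: map_matrix_fn_mult)
  have "?dE = d_matrix (e ** e)" by (simp add: e)
  also have "\<dots> = ?dE ** E + E ** ?dE"
    by (simp add: d_matrix_def E_def map_matrix_def matrix_matrix_mult_def vec_eq_iff fn_sum fn_hom
        dd_sum dd_simps ginv_hom sum.distrib)
  finally have dE: "?dE = ?dE ** E + E ** ?dE" .
  have "?dE ** ?dE = ?dE ** E ** ?dE + E ** \<Omega>"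
    by (subst dE) (simp add: matrix_add_rdistrib \<Omega>_def matrix_mul_assoc)
  moreover have "?dE ** ?dE = \<Omega> ** E + ?dE ** E ** ?dE"
    by (subst (2) dE) (simp add: matrix_add_ldistrib \<Omega>_def matrix_mul_assoc)
  ultimately have "?dE ** E ** ?dE + E ** \<Omega> = ?dE ** E ** ?dE + \<Omega> ** E"
    by (simp only: add.commute)
  then show comm: "E ** \<Omega> = \<Omega> ** E" by (rule add_left_imp_eq)
  have "row_mult (fn_row (e $ j)) E = fn_row (e $ j)" for j
  proof -
    have "row_mult (fn_row (e $ j)) E = (E ** E) $ j"
      by (simp add: row_mult_def fn_row_def E_def map_matrix_def matrix_matrix_mult_def)
    then show ?thesis by (simp add: EE) (simp add: E_def map_matrix_def fn_row_def)
  qed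
  then have "curv_matrix (grassmann_conn e) e $ j = row_mult (row_mult (fn_row (e $ j)) \<Omega>) E" for j
    using curvature_grassmann_forms[OF e, of "fn_row (e $ j)"]
    by (simp add: curv_matrix_def E_def \<Omega>_def)
  then show \<Phi>: "curv_matrix (grassmann_conn e) e = E ** \<Omega> ** E"
    unfolding vec_eq_iff
    by (simp add: row_mult_def fn_row_def E_def map_matrix_def matrix_matrix_mult_def)
  then show \<Phi>': "curv_matrix (grassmann_conn e) e = E ** \<Omega>"
    using comm EE by (metis matrix_mul_assoc)
  show "curv_matrix (grassmann_conn e) e ** curv_matrix (grassmann_conn e) e = E ** (\<Omega> ** \<Omega>)"
    unfolding \<Phi>' using comm EE by (metis matrix_mul_assoc)
qed

section \<open>The instanton projector: powers of de and the local form\<close>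

lemma map_matrix_cliff:
  assumes "alg_hom \<phi>"
  shows "map_matrix \<phi> (cliff (scal \<i>) a d t x y z)
    = cliff (scal \<i>) (\<phi> a) (\<phi> d) (\<phi> t) (\<phi> x) (\<phi> y) (\<phi> z)"
  by (simp add: vec_eq_iff forall_4 map_matrix_def cliff_def vec4_simps alg_homD[OF assms])

lemma fn_matrix_cliff:
  "map_matrix fn (cliff (scal \<i>) a d t x y z)
    = cliff (fn (scal \<i>)) (fn a) (fn d) (fn t) (fn x) (fn y) (fn z)"
  by (simp add: vec_eq_iff forall_4 map_matrix_def cliff_def vec4_simps fn_0 fn_hom fn_diff fn_uminus)

lemma d_matrix_cliff:
  "d_matrix (cliff (scal \<i>) a d t x y z) = cliff (fn (scal \<i>)) (dd (fn a)) (dd (fn d)) (dd (fn t))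
     (dd (fn x)) (dd (fn y)) (dd (fn z))"
  by (simp add: vec_eq_iff forall_4 d_matrix_def cliff_def vec4_simps fn_0 fn_hom fn_diff fn_uminus
      dd_simps dd_zero dd_scal ginv_hom dd_uminus)

text \<open>The coefficients are 24 times traces: the diagonal gives 2a - 2(1 - a) = 2(2a - 1), and
  each of the other four Clifford matrices paired with itself gives 4.\<close>

lemma cliff_d_matrix:
  fixes a t x y z :: "'a::complex_algebra"
  defines "e \<equiv> cliff (scal \<i>) a (1 - a) t x y z"
    and "\<Omega> \<equiv> d_matrix (cliff (scal \<i>) a (1 - a) t x y z) ** d_matrix (cliff (scal \<i>) a (1 - a) t x y z)"
    and "p \<equiv> dd (fn a)" and "q \<equiv> dd (fn t)" and "r \<equiv> dd (fn x)" and "s \<equiv> dd (fn y)" and "w \<equiv> dd (fn z)"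
  shows "\<Omega> ** \<Omega> = (\<chi> j k. 24 * cliff (fn (scal \<i>)) (q * r * s * w) (- (q * r * s * w))
      (- (p * r * s * w)) (p * q * s * w) (- (p * q * r * w)) (p * q * r * s) $ j $ k)"
    "trace (map_matrix fn e ** \<Omega>) = 0"
    "trace (map_matrix fn e ** (\<Omega> ** \<Omega>)) = fn (48 * (2 * a - 1)) * (q * r * s * w)
       + fn (- 96 * t) * (p * r * s * w) + fn (96 * x) * (p * q * s * w)
       + fn (- 96 * y) * (p * q * r * w) + fn (96 * z) * (p * q * r * s)"
proof -
  let ?i = "fn (scal \<i>) :: 'a forms"
  have d: "d_matrix e = cliff ?i p (- p) q r s w"
    unfolding e_def d_matrix_cliff by (simp add: fn_diff dd_simps fn_hom dd_one p_def q_def r_def s_def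
      w_def)
  have ii: "?i * ?i = - 1" by (simp add: scal_ii fn_uminus fn_hom(3) flip: fn_hom(2))
  note ac = forms_graded_commutative(2)
  have c4: "(d_matrix e ** d_matrix e) ** (d_matrix e ** d_matrix e) = (\<chi> j k. 24 * cliff ?i (q * r * s *
    w) (- (q * r * s * w))
      (- (p * r * s * w)) (p * q * s * w) (- (p * q * r * w)) (p * q * r * s) $ j $ k)"
    "trace (cliff ?i a' d' t' x' y' z' ** (d_matrix e ** d_matrix e)) = 0" for a' d' t' x' y' z'
    unfolding d
    by (rule cliff_power4; (unfold p_def q_def r_def s_def w_def)?;
        (rule dd_fn_square ii fn_central[symmetric] ac))+
  show \<Omega>2: "\<Omega> ** \<Omega> = (\<chi> j k. 24 * cliff (fn (scal \<i>)) (q * r * s * w) (- (q * r * s * w))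
      (- (p * r * s * w)) (p * q * s * w) (- (p * q * r * w)) (p * q * r * s) $ j $ k)"
    using c4(1) by (simp add: \<Omega>_def e_def)
  have E: "map_matrix fn e = cliff ?i (fn a) (fn (1 - a)) (fn t) (fn x) (fn y) (fn z)"
    by (simp add: e_def fn_matrix_cliff)
  show "trace (map_matrix fn e ** \<Omega>) = 0"
    unfolding E using c4(2) by (simp add: \<Omega>_def e_def)
  show "trace (map_matrix fn e ** (\<Omega> ** \<Omega>)) = fn (48 * (2 * a - 1)) * (q * r * s * w)
       + fn (- 96 * t) * (p * r * s * w) + fn (96 * x) * (p * q * s * w)
       + fn (- 96 * y) * (p * q * r * w) + fn (96 * z) * (p * q * r * s)"
  proof -
    have num: "fn f * (numeral k * u) = numeral k * (fn f * u)" for f :: 'a and k u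
      using fn_central[of "numeral k" "fn f"] by (simp add: fn_numeral flip: mult.assoc)
    have mv: "fn f * (?i * u) = ?i * (fn f * u)" for f :: 'a and u
      using fn_central[of "scal \<i>" "fn f"] by (simp flip: mult.assoc)
    have ii': "?i * (?i * u) = - u" for u using ii by (simp flip: mult.assoc)
    have n48: "48 * u = 24 * u + 24 * u" and n96: "96 * u = 24 * u + 24 * u + 24 * u + 24 * u"
      for u :: "'a forms"
      by (simp_all flip: distrib_right)
    note r = num mv[of a] mv[of t] mv[of x] mv[of y] mv[of z] ii' ii
    show ?thesis
      unfolding \<Omega>2 E trace_def
      by (simp add: matrix_matrix_mult_def sum_4 cliff_def vec4_simps fn_hom fn_diff fn_uminus
        fn_numeral)
         (simp add: algebra_simps r, simp only: n48 n96 ac_simps)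
  qed
qed

text \<open>Once da is eliminated, all five products of four differentials are multiples of V = dt
  d^3x, and (de)^4 becomes -24 u (2e - 1) V. The matrix then disappears because (2e - 1) e =
  e.\<close>

lemma cliff_local_form:
  fixes a t x y z u :: "'a::complex_algebra"
  assumes sphere: "t * t + x * x + y * y + z * z = a * (1 - a)" and u: "(1 - 2 * a) * u = 1"
    and e: "e ** e = e" "e = cliff (scal \<i>) a (1 - a) t x y z"
  defines "F \<equiv> curvature (grassmann_conn e)"
  shows "F (F (row_mult (fn_row v) (map_matrix fn e))) =
    (\<chi> i. - 24 * fn u * (dd (fn t) * (dd (fn x) * dd (fn y) * dd (fn z)))
      * row_mult (fn_row v) (map_matrix fn e) $ i)"
proof -
  define p q r s w where "p = dd (fn a)" and "q = dd (fn t)" and "r = dd (fn x)" and "s = dd (fn y)"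
    and "w = dd (fn z)"
  note pq = p_def q_def r_def s_def w_def
  let ?i = "fn (scal \<i>) :: 'a forms" and ?E = "map_matrix fn e" and ?\<Omega> = "d_matrix e ** d_matrix e"
  define V where "V = q * r * s * w"
  define Q where "Q = (\<chi> j k. 24 * cliff ?i V (- V) (- (p * r * s * w)) (p * q * s * w)
      (- (p * q * r * w)) (p * q * r * s) $ j $ k)"
  have "?\<Omega> ** ?\<Omega> = Q"
    unfolding e(2) Q_def V_def pq by (rule cliff_d_matrix(1))
  have num: "fn f * (numeral n * b) = numeral n * (fn f * b)" for f :: 'a and n b
    using fn_central[of "numeral n" "fn f"] by (simp add: fn_numeral flip: mult.assoc)
  have sq: "dd (fn (f * f)) = 2 * (fn f * dd (fn f))" for f :: 'a
    by (simp add: fn_hom dd_simps ginv_hom mult_2) (simp add: fn_central)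
  have k: "fn u * fn (1 - 2 * a) = 1"
    using u by (simp add: mult.commute flip: fn_hom)
  \<comment> \<open>The differential of the sphere equation, to be solved for da with the help of
    \<open>u\<close> = 1/(1 - 2a).\<close>
  have "dd (fn (t * t + x * x + y * y + z * z)) = dd (fn (a - a * a))"
    by (simp only: sphere right_diff_distrib mult_1_right)
  then have "fn (1 - 2 * a) * p = 2 * (fn t * q) + 2 * (fn x * r) + 2 * (fn y * s) + 2 * (fn z * w)"
    by (simp add: fn_hom(1) fn_diff dd_simps sq pq) (simp add: fn_hom fn_numeral algebra_simps num)
  then have "fn u * (fn (1 - 2 * a) * p) = fn u * (2 * (fn t * q) + 2 * (fn x * r) + 2 * (fn y * s) + 2 *
    (fn z * w))"
    by simp
  then have p: "p = fn u * (2 * (fn t * q + fn x * r + fn y * s + fn z * w))"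
    by (simp add: k distrib_left flip: mult.assoc)
  \<comment> \<open>V = u (1 - 2a) V, so that the diagonal entries acquire the factor
    \<open>u\<close> which the other entries already have.\<close>
  have V: "V = fn u * (V - 2 * (fn a * V))"
  proof -
    have "fn u * fn (1 - 2 * a) * V = V" by (simp add: k)
    then show ?thesis by (simp add: fn_hom fn_diff fn_numeral left_diff_distrib mult.assoc)
  qed
  have ac: "r * q = - (q * r)" "s * q = - (q * s)" "w * q = - (q * w)"
      "s * r = - (r * s)" "w * r = - (r * w)" "w * s = - (s * w)"
    unfolding pq by (rule forms_graded_commutative(2))+
  have dd0: "q * q = 0" "r * r = 0" "s * s = 0" "w * w = 0"
    unfolding pq by (rule dd_fn_square)+
  have a3: "g * (h * b) = - (h * (g * b))" if "g * h = - (h * g)" for g h b :: "'a forms"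
    using arg_cong[OF that, of "\<lambda>v. v * b"] by (simp add: mult.assoc)
  have s3: "g * (g * b) = 0" if "g * g = 0" for g b :: "'a forms"
    using arg_cong[OF that, of "\<lambda>v. v * b"] by (simp add: mult.assoc)
  have minors: "p * r * s * w = 2 * (fn u * (fn t * V))" "p * q * s * w = - 2 * (fn u * (fn x * V))"
    "p * q * r * w = 2 * (fn u * (fn y * V))" "p * q * r * s = - 2 * (fn u * (fn z * V))"
    unfolding p V_def
    by (simp_all add: mult.assoc ring_distribs num ac dd0 dd0[THEN s3] ac[THEN a3])
  have mv: "?i * (fn u * b) = fn u * (?i * b)" for b
    using fn_central[of u ?i] by (simp flip: mult.assoc)
  have Q: "Q $ j $ l = - 24 * (fn u * ((2 * ?E $ j $ l - mat 1 $ j $ l) * V))" for j l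
  proof -
    have V24: "24 * V = 24 * (fn u * V) - 48 * (fn u * (fn a * V))"
      using arg_cong[OF V, of "\<lambda>b. 24 * b"] by (simp add: ring_distribs num)
    have n48: "24 * b + 24 * b = 48 * b" for b :: "'a forms" by (simp flip: distrib_right)
    from exhaust_4[of j] exhaust_4[of l] show ?thesis
      by (elim disjE; simp add: Q_def e(2) fn_matrix_cliff cliff_def vec4_simps mat_def minors fn_0
        fn_hom fn_diff fn_uminus;
          simp add: algebra_simps num mv V24 n48)
  qed
  have EE: "?E ** ?E = ?E" by (simp add: e(1) flip: map_matrix_fn_mult)
  have "(Q ** ?E) $ j $ l = - 24 * fn u * V * ?E $ j $ l" for j l
  proof -
    have "(Q ** ?E) $ j $ l = (\<Sum>m\<in>UNIV. - 24 * (fn u * V) * ((2 * ?E $ j $ m - mat 1 $ j $ m) * ?E $ m $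
      l))"
    proof -
      \<comment> \<open>The entries of 2e - 1 are functions, hence central, and can be moved past V
        to meet the second factor.\<close>
      have "2 * ?E $ j $ m - mat 1 $ j $ m = fn (2 * e $ j $ m - mat 1 $ j $ m)" for m
        by (simp add: map_matrix_def fn_diff fn_hom fn_numeral mat_def fn_0)
      then have "(2 * ?E $ j $ m - mat 1 $ j $ m) * V = V * (2 * ?E $ j $ m - mat 1 $ j $ m)" for m
        by (simp only: fn_central)
      then have c: "(2 * ?E $ j $ m - mat 1 $ j $ m) * (V * b) = V * ((2 * ?E $ j $ m - mat 1 $ j $ m) *
        b)" for m b
        by (simp only: mult.assoc[symmetric])
      then show ?thesis
        by (simp only: matrix_matrix_mult_def vec_lambda_beta Q mult.assoc mult_minus_left c)
    qed
    also have "\<dots> = - 24 * (fn u * V) * (2 * (?E ** ?E) $ j $ l - (mat 1 ** ?E) $ j $ l)"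
      by (simp add: matrix_matrix_mult_def sum_distrib_left left_diff_distrib right_diff_distrib
          sum_subtractf mult.assoc sum_negf)
    also have "2 * (?E ** ?E) $ j $ l - (mat 1 ** ?E) $ j $ l = ?E $ j $ l"
      by (simp only: EE matrix_mul_lid mult_2 add_diff_cancel_right')
    finally show ?thesis by (simp only: mult.assoc)
  qed
  then have QE: "Q ** ?E = (\<chi> j l. - 24 * fn u * V * ?E $ j $ l)" by (simp add: vec_eq_iff)
  have "F (F (row_mult (fn_row v) ?E)) = row_mult (fn_row v) (Q ** ?E)"
    unfolding F_def curvature_grassmann_forms[OF e(1)]
    by (simp only: row_mult_assoc \<open>?\<Omega> ** ?\<Omega> = Q\<close>)
  also have "\<dots> = (\<chi> i. - 24 * fn u * V * row_mult (fn_row v) ?E $ i)"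
  proof -
    have "fn (v $ j) * (- 24 * fn u * V * b) = - 24 * fn u * V * (fn (v $ j) * b)" for j b
      using fn_central[of "v $ j" "- 24 * fn u * V"] by (simp only: mult.assoc[symmetric])
    then show ?thesis
      by (simp only: QE row_mult_def vec_eq_iff vec_lambda_beta sum_distrib_left fn_row_def) simp
  qed
  finally show ?thesis by (simp add: V_def pq mult.assoc)
qed

section \<open>Clifford matrices\<close>

definition minor2 :: "'a::comm_ring_1^'n \<Rightarrow> 'a^'n \<Rightarrow> 'n \<Rightarrow> 'n \<Rightarrow> 'a" where
  "minor2 v w i j = v $ i * w $ j - v $ j * w $ i"

text \<open>A component of the wedge product of two 2-forms, given by their components.\<close>

definition wedge4 :: "('n \<Rightarrow> 'n \<Rightarrow> 'a::comm_ring_1) \<Rightarrow> ('n \<Rightarrow> 'n \<Rightarrow> 'a) \<Rightarrow> 'n \<Rightarrow> 'n \<Rightarrow> 'n \<Rightarrow> 'n \<Rightarrow> 'a" where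
  "wedge4 u w i j k l = u i j * w k l - u i k * w j l + u i l * w j k
     + u j k * w i l - u j l * w i k + u k l * w i j"

text \<open>The sum over \<open>A < B\<close> of \<open>u A B\<close> times the product of the \<open>A\<close>-th and the \<open>B\<close>-th Clifford matrix.\<close>

definition bivector_matrix :: "'a::comm_ring_1 \<Rightarrow> (5 \<Rightarrow> 5 \<Rightarrow> 'a) \<Rightarrow> 'a^4^4" where
  "bivector_matrix i u =
    vector [vector [- i * u 2 5 + i * u 3 4, - i * u 2 3 - u 2 4 - u 3 5 + i * u 4 5,
        u 1 2 + i * u 1 5, i * u 1 3 + u 1 4],
     vector [- i * u 2 3 + u 2 4 + u 3 5 + i * u 4 5, i * u 2 5 - i * u 3 4,
        i * u 1 3 - u 1 4, u 1 2 - i * u 1 5],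
     vector [- u 1 2 + i * u 1 5, i * u 1 3 + u 1 4,
        i * u 2 5 + i * u 3 4, i * u 2 3 + u 2 4 - u 3 5 + i * u 4 5],
     vector [i * u 1 3 - u 1 4, - u 1 2 - i * u 1 5,
        i * u 2 3 - u 2 4 + u 3 5 + i * u 4 5, - i * u 2 5 - i * u 3 4]]"

text \<open>Expansion along the first row and then by pairs of rows. Determinants, traces of
  Clifford products and values of 4-forms are all compared in this shape.\<close>

lemma det_5_laplace:
  fixes n a b c d :: "'a::comm_ring_1^5"
  shows "det (vector [n, a, b, c, d] :: 'a^5^5) =
    n$1 * wedge4 (minor2 a b) (minor2 c d) 2 3 4 5 - n$2 * wedge4 (minor2 a b) (minor2 c d) 1 3 4 5
    + n$3 * wedge4 (minor2 a b) (minor2 c d) 1 2 4 5 - n$4 * wedge4 (minor2 a b) (minor2 c d) 1 2 3 5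
    + n$5 * wedge4 (minor2 a b) (minor2 c d) 1 2 3 4"
proof -
  have fin: "finite {2, 3, 4, 5::5}" "1 \<notin> {2, 3, 4, 5::5}" "finite {3, 4, 5::5}" "2 \<notin> {3, 4, 5::5}"
    "finite {4, 5::5}" "3 \<notin> {4, 5::5}" "finite {5::5}" "4 \<notin> {5::5}" by auto
  show ?thesis
    unfolding det_def UNIV_5 sum_over_permutations_insert[OF fin(1,2)]
      sum_over_permutations_insert[OF fin(3,4)] sum_over_permutations_insert[OF fin(5,6)]
      sum_over_permutations_insert[OF fin(7,8)] permutes_sing
    by (simp add: sign_swap_id permutation_swap_id sign_compose sign_id permutation_compose
        Transposition.transpose_def vec5_simps)
      (simp add: wedge4_def minor2_def algebra_simps)
qed

definition vcliff :: "'a::comm_ring_1 \<Rightarrow> 'a^5 \<Rightarrow> 'a^4^4" where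
  "vcliff i v = cliff i (v$1) (- (v$1)) (v$2) (v$3) (v$4) (v$5)"

lemma vcliff_mult:
  fixes i :: "'a::comm_ring_1"
  assumes i: "i * i = - 1"
  shows "vcliff i a ** vcliff i b = bivector_matrix i (minor2 a b) + mat (\<Sum>k\<in>UNIV. a $ k * b $ k)"
proof -
  have i2: "i * (i * u) = - u" for u using i by (simp flip: mult.assoc)
  show ?thesis
    by (simp add: vec_eq_iff forall_4 vcliff_def cliff_def bivector_matrix_def minor2_def
        matrix_matrix_mult_def sum_4 sum_5 vec4_simps mat_def)
       (simp add: algebra_simps i i2)
qed

text \<open>A product of one vector and two bivectors has parts of degree 1, 3 and 5. Only the
  product of all five Clifford matrices, which is 1, has nonzero trace, namely 4; so the trace sees
  just the top degree part.\<close>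

lemma trace_vcliff_bivector:
  fixes i :: "'a::comm_ring_1"
  assumes i: "i * i = - 1"
  shows "trace (vcliff i n ** (bivector_matrix i u ** bivector_matrix i w)) = 4 *
    (n$1 * wedge4 u w 2 3 4 5 - n$2 * wedge4 u w 1 3 4 5 + n$3 * wedge4 u w 1 2 4 5
     - n$4 * wedge4 u w 1 2 3 5 + n$5 * wedge4 u w 1 2 3 4)"
proof -
  have i2: "i * (i * u) = - u" for u using i by (simp flip: mult.assoc)
  show ?thesis
    by (simp add: trace_def vcliff_def cliff_def bivector_matrix_def wedge4_def
        matrix_matrix_mult_def sum_4 vec4_simps)
       (simp add: algebra_simps i i2)
qed

section \<open>Clifford matrices of real vectors\<close>

definition cvec :: "real^'n \<Rightarrow> complex^'n" where
  "cvec v = (\<chi> k. complex_of_real (v $ k))"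

definition gam :: "real^5 \<Rightarrow> complex^4^4" where
  "gam v = vcliff \<i> (cvec v)"

lemma matrix_mult_minus:
  fixes A :: "'a::ring_1^'n^'m"
  shows "(- A) ** B = - (A ** B)" "A ** (- B) = - (A ** B)"
  by (simp_all add: vec_eq_iff matrix_matrix_mult_def sum_negf)

lemma matrix_mult_diff:
  fixes A :: "'a::ring_1^'n^'m"
  shows "(A - C) ** B = A ** B - C ** B" "A ** (B - D) = A ** B - A ** D"
  by (simp_all add: vec_eq_iff matrix_matrix_mult_def left_diff_distrib right_diff_distrib sum_subtractf)

lemma cvec_inner: "(\<Sum>k\<in>UNIV. cvec v $ k * cvec w $ k) = of_real (v \<bullet> w)"
  by (simp add: cvec_def inner_vec_def)

lemma gam_anticommute:
  assumes "v \<bullet> w = 0"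
  shows "gam w ** gam v = - (gam v ** gam w)"
proof -
  have "bivector_matrix \<i> (minor2 (cvec w) (cvec v)) = - bivector_matrix \<i> (minor2 (cvec v) (cvec w))"
    by (simp add: vec_eq_iff forall_4 bivector_matrix_def minor2_def vec4_simps algebra_simps)
  then show ?thesis
    using assms by (simp add: gam_def vcliff_mult cvec_inner inner_commute)
qed

lemma gam_square:
  assumes "v \<bullet> v = 1"
  shows "gam v ** gam v = mat 1"
proof -
  have "bivector_matrix \<i> (minor2 (cvec v) (cvec v)) = 0"
    by (simp add: vec_eq_iff forall_4 bivector_matrix_def minor2_def vec4_simps)
  then show ?thesis using assms by (simp add: gam_def vcliff_mult cvec_inner)
qed

lemma trace_gam_product:
  assumes "a \<bullet> b = 0" "c \<bullet> d = 0"
  shows "trace (gam n ** ((gam a ** gam b) ** (gam c ** gam d)))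
    = 4 * of_real (det (vector [n, a, b, c, d] :: real^5^5))"
proof -
  have m: "bivector_matrix \<i> (minor2 (cvec a) (cvec b)) = gam a ** gam b" if "a \<bullet> b = 0" for a b
    using that by (simp add: gam_def vcliff_mult cvec_inner)
  have "trace (gam n ** ((gam a ** gam b) ** (gam c ** gam d)))
      = 4 * det (vector [cvec n, cvec a, cvec b, cvec c, cvec d] :: complex^5^5)"
    unfolding m[OF assms(1), symmetric] m[OF assms(2), symmetric] det_5_laplace
    unfolding gam_def by (simp add: trace_vcliff_bivector)
  also have "det (vector [cvec n, cvec a, cvec b, cvec c, cvec d] :: complex^5^5)
      = of_real (det (vector [n, a, b, c, d] :: real^5^5))"
    by (simp add: det_5_laplace wedge4_def minor2_def cvec_def)
  finally show ?thesis .
qed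

definition conj_transpose :: "complex^'n^'m \<Rightarrow> complex^'m^'n" where
  "conj_transpose A = (\<chi> i j. cnj (A $ j $ i))"

lemma conj_transpose_mult: "conj_transpose (A ** B) = conj_transpose B ** conj_transpose A"
  by (simp add: conj_transpose_def matrix_matrix_mult_def vec_eq_iff mult.commute)

lemma conj_transpose_gam: "conj_transpose (gam v) = gam v"
  by (simp add: conj_transpose_def gam_def vcliff_def cliff_def cvec_def vec_eq_iff forall_4 vec4_simps)

text \<open>For hermitian A the trace of A^2 is the sum of the squared moduli of all
  entries.\<close>

lemma hermitian_trace_square_zero:
  fixes A :: "complex^'n^'n"
  assumes "conj_transpose A = A" "trace (A ** A) = 0"
  shows "A = 0"
proof -
  have "A $ j $ i = cnj (A $ i $ j)" for i j
    using arg_cong[OF assms(1), of "\<lambda>B. B $ j $ i"] by (simp add: conj_transpose_def)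
  from arg_cong[OF this] have "A $ i $ j * A $ j $ i = A $ i $ j * cnj (A $ i $ j)" for i j .
  then have "trace (A ** A) = (\<Sum>i\<in>UNIV. \<Sum>j\<in>UNIV. A $ i $ j * cnj (A $ i $ j))"
    by (simp only: trace_def matrix_matrix_mult_def vec_lambda_beta)
  also have "\<dots> = of_real (\<Sum>i\<in>UNIV. \<Sum>j\<in>UNIV. (cmod (A $ i $ j))\<^sup>2)"
    by (simp add: complex_norm_square del: of_real_power)
  finally have "(\<Sum>i\<in>UNIV. \<Sum>j\<in>UNIV. (cmod (A $ i $ j))\<^sup>2) = 0"
    using assms(2) by (metis of_real_eq_0_iff)
  then show ?thesis
    by (simp add: sum_nonneg_eq_0_iff sum_nonneg vec_eq_iff)
qed

text \<open>Orthonormality makes the square of the determinant 1, and positivity selects 1; this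
  fixes the trace of the product as 4. The trace argument avoids rotating the frame to the standard
  basis.\<close>

lemma gam_volume:
  assumes on: "n \<bullet> n = 1" "a \<bullet> a = 1" "b \<bullet> b = 1" "c \<bullet> c = 1" "d \<bullet> d = 1"
    "n \<bullet> a = 0" "n \<bullet> b = 0" "n \<bullet> c = 0" "n \<bullet> d = 0" "a \<bullet> b = 0" "a \<bullet> c = 0" "a \<bullet> d = 0"
    "b \<bullet> c = 0" "b \<bullet> d = 0" "c \<bullet> d = 0"
    and pos: "det (vector [n, a, b, c, d] :: real^5^5) > 0"
  shows "gam n ** ((gam a ** gam b) ** (gam c ** gam d)) = mat 1"
proof -
  let ?O = "vector [n, a, b, c, d] :: real^5^5"
  have "(?O ** Finite_Cartesian_Product.transpose ?O) $ i $ j = ?O $ i \<bullet> ?O $ j" for i j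
    by (simp add: matrix_matrix_mult_def Finite_Cartesian_Product.transpose_def inner_vec_def)
  then have "?O ** Finite_Cartesian_Product.transpose ?O = mat 1"
    using on by (simp add: vec_eq_iff forall_5 mat_def vec5_simps inner_commute)
  from arg_cong[OF this, of det] have "det ?O * det ?O = 1"
    by (simp add: det_mul)
  then have "det ?O = 1"
    using pos by (simp add: square_eq_1_iff)
  have ac: "gam w ** gam v = - (gam v ** gam w)" "gam w ** (gam v ** X) = - (gam v ** (gam w ** X))"
    if "v \<bullet> w = 0" for v w X
    using gam_anticommute[OF that] by (simp_all add: matrix_mul_assoc matrix_mult_minus)
  have sq: "gam v ** gam v = mat 1" "gam v ** (gam v ** X) = X" if "v \<bullet> v = 1" for v X
    using gam_square[OF that] by (simp_all add: matrix_mul_assoc)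
  note rules = on(6-)[THEN ac(1)] on(6-)[THEN ac(2)] on(1-5)[THEN sq(1)] on(1-5)[THEN sq(2)]
    matrix_mult_minus matrix_mul_assoc[symmetric]
  \<comment> \<open>\<open>Z\<close> is a hermitian involution of trace 4, hence the identity.\<close>
  define Z where "Z = gam n ** ((gam a ** gam b) ** (gam c ** gam d))"
  have tr: "trace Z = 4"
    unfolding Z_def by (simp add: trace_gam_product on \<open>det ?O = 1\<close>)
  have ZZ: "Z ** Z = mat 1"
    unfolding Z_def by (simp add: rules)
  have "conj_transpose Z = Z"
    unfolding Z_def by (simp add: conj_transpose_mult conj_transpose_gam rules)
  then have H: "conj_transpose (Z - mat 1) = Z - mat 1"
    by (simp add: conj_transpose_def vec_eq_iff mat_def)
  \<comment> \<open>The value is 4 - 4 - 4 + 4, because Z^2 = 1 and both Z and 1 have trace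
    4.\<close>
  have "trace ((Z - mat 1) ** (Z - mat 1)) = 0"
    by (simp only: matrix_mult_diff ZZ matrix_mul_lid matrix_mul_rid trace_sub tr trace_I) simp
  from hermitian_trace_square_zero[OF H this] show ?thesis by (simp add: Z_def)
qed

section \<open>Anti-self-duality\<close>

text \<open>\<open>N\<close> is 2E - 1, the Clifford matrix of the unit normal: the radius is 1/2,
  whence the factor 2. So E absorbs the normal on either side.\<close>

lemma s4_eval_e:
  assumes p: "p \<in> s4_points"
  defines "E \<equiv> map_matrix (s4_eval p) s4_e" and "N \<equiv> gam (2 *\<^sub>R (p - s4_centre))"
  shows "E = cliff \<i> (of_real (p$1)) (of_real (1 - p$1)) (of_real (p$2)) (of_real (p$3)) (of_real (p$4))
      (of_real (p$5))"
    "E ** E = E" "E ** N = E" "N ** E = E"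
proof -
  note ev = s4_eval[OF p] and h = alg_homD[OF s4_eval(1)[OF p]]
  show E: "E = cliff \<i> (of_real (p$1)) (of_real (1 - p$1)) (of_real (p$2)) (of_real (p$3)) (of_real
    (p$4))
      (of_real (p$5))"
    unfolding E_def s4_e_cliff
    using map_matrix_cliff[OF ev(1)] by (simp add: h ev scal_complex_def)
  show EE: "E ** E = E"
    by (simp add: E_def s4_e_projection flip: map_matrix_alg_hom_mult[OF ev(1)])
  have N: "N = E + E - mat 1"
    by (simp add: N_def E gam_def vcliff_def cliff_def cvec_def s4_centre_def vec5_simps vec4_simps
        vec_eq_iff forall_4 mat_def algebra_simps)
  show "E ** N = E" "N ** E = E"
    by (simp_all only: N matrix_mult_diff matrix_add_ldistrib matrix_add_rdistrib EE matrix_mul_lid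
        matrix_mul_rid add_diff_cancel_right')
qed

text \<open>The entries of e are affine in the coordinates. The diagonal entries a and 1 - a
  differentiate to opposite values, which is exactly the pattern of a Clifford matrix.\<close>

lemma tangent_deriv_e:
  assumes p: "p \<in> s4_points" and v: "v \<bullet> (p - s4_centre) = 0"
  shows "map_matrix (tangent_deriv p v) s4_e = gam v"
proof -
  let ?X = "tangent_deriv p v"
  note X = tangent_deriv[OF p v] and h = alg_homD[OF s4_eval(1)[OF p]]
  have d: "?X (f + g) = ?X f + ?X g" "?X (scal c * g) = c * ?X g" "?X (scal c) = 0" for f g c
    using X(1) by (simp_all add: point_deriv_def h scal_complex_def)
  have d0: "?X 0 = 0" "?X 1 = 0" using d(3)[of 0] d(3)[of 1] by (simp_all add: scal_zero scal_one)
  have m: "?X (- f) = - ?X f" for f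
    using d(1)[of f "- f"] by (simp add: d0 eq_neg_iff_add_eq_0 add.commute)
  have m2: "?X (f - g) = ?X f - ?X g" for f g using d(1)[of f "- g"] by (simp add: m)
  show ?thesis
    by (simp add: s4_e_cliff map_matrix_def cliff_def vec_eq_iff forall_4 vec4_simps d d0 m m2 X
        gam_def vcliff_def cvec_def)
qed

lemma s4_form_curvature:
  assumes p: "p \<in> s4_points" and v: "v \<bullet> (p - s4_centre) = 0" "w \<bullet> (p - s4_centre) = 0"
  defines "E \<equiv> map_matrix (s4_eval p) s4_e"
  shows "s4_form p [v, w] (curv_matrix (grassmann_conn s4_e) s4_e $ i $ j)
    = (E ** (gam v ** gam w - gam w ** gam v) ** E) $ i $ j"
proof -
  let ?X = "tangent_deriv p v" and ?Y = "tangent_deriv p w" and ?ch = "s4_eval p"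
  note ch = s4_eval(1)[OF p] and X = tangent_deriv(1)[OF p v(1)] and Y = tangent_deriv(1)[OF p v(2)]
  have sum: "form_at ?ch [?X, ?Y] (sum f A) = (\<Sum>i\<in>A. form_at ?ch [?X, ?Y] (f i))"
    if "finite A" for f and A :: "4 set"
    by (rule form_at_sum[OF ch _ that]) (use X Y in auto)
  have "curv_matrix (grassmann_conn s4_e) s4_e $ i $ j
    = (\<Sum>k\<in>UNIV. \<Sum>l\<in>UNIV. \<Sum>m\<in>UNIV. fn (s4_e $ i $ l) *
       (dd (fn (s4_e $ l $ m)) * dd (fn (s4_e $ m $ k)) * fn (s4_e $ k $ j)))"
    by (simp add: curv_matrix_grassmann(2)[OF s4_e_projection(1)] matrix_matrix_mult_def
        map_matrix_def d_matrix_def sum_distrib_left sum_distrib_right mult.assoc)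
  then have "s4_form p [v, w] (curv_matrix (grassmann_conn s4_e) s4_e $ i $ j)
     = (\<Sum>k\<in>UNIV. \<Sum>l\<in>UNIV. \<Sum>m\<in>UNIV. ?ch (s4_e $ i $ l) * ?ch (s4_e $ k $ j) *
       (?X (s4_e $ l $ m) * ?Y (s4_e $ m $ k) - ?Y (s4_e $ l $ m) * ?X (s4_e $ m $ k)))"
    by (simp add: s4_form_def sum form_at_2[OF ch X Y])
  also have "\<dots> = (E ** (map_matrix ?X s4_e ** map_matrix ?Y s4_e - map_matrix ?Y s4_e ** map_matrix ?X
    s4_e) ** E) $ i $ j"
    by (simp add: matrix_matrix_mult_def E_def map_matrix_def sum_distrib_left sum_distrib_right
        sum_subtractf right_diff_distrib left_diff_distrib mult_ac)
  finally show ?thesis by (simp add: tangent_deriv_e[OF p] v)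
qed

lemma anti_self_dual_curvature:
  "anti_self_dual 1 (curv_matrix (grassmann_conn s4_e) s4_e $ i $ j)"
  unfolding anti_self_dual_def hodge_dual_def
proof (intro ballI allI impI)
  fix p v1 v2 v3 v4 :: "real^5"
  assume p: "p \<in> s4_points" and frame: "oriented_frame 1 p v1 v2 v3 v4"
  let ?c = "p - s4_centre"
  define n where "n = 2 *\<^sub>R ?c"
  define E where "E = map_matrix (s4_eval p) s4_e"
  have t: "v1 \<bullet> ?c = 0" "v2 \<bullet> ?c = 0" "v3 \<bullet> ?c = 0" "v4 \<bullet> ?c = 0"
    and o: "v1 \<bullet> v2 = 0" "v1 \<bullet> v3 = 0" "v1 \<bullet> v4 = 0" "v2 \<bullet> v3 = 0" "v2 \<bullet> v4 = 0" "v3 \<bullet> v4 = 0"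
    and u: "v1 \<bullet> v1 = 1" "v2 \<bullet> v2 = 1" "v3 \<bullet> v3 = 1" "v4 \<bullet> v4 = 1"
    and det: "det (vector [?c, v1, v2, v3, v4] :: real^5^5) > 0"
    using frame by (auto simp: oriented_frame_def norm_eq_1)
  have nc: "norm ?c = 1/2"
    using p by (simp add: s4_points_def dist_norm norm_minus_commute)
  have n: "n \<bullet> n = 1" "n \<bullet> v1 = 0" "n \<bullet> v2 = 0" "n \<bullet> v3 = 0" "n \<bullet> v4 = 0"
    using t by (simp_all add: n_def inner_commute power2_norm_eq_inner[symmetric] nc power2_eq_square)
  have "det (vector [n, v1, v2, v3, v4] :: real^5^5) = 2 * det (vector [?c, v1, v2, v3, v4] :: real^5^5)"
    by (simp add: det_5_laplace n_def algebra_simps)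
  then have vol: "gam n ** ((gam v1 ** gam v2) ** (gam v3 ** gam v4)) = mat 1"
    using det by (intro gam_volume n o u) simp
  note EN = s4_eval_e(3,4)[OF p, folded E_def n_def]
  have ac: "gam w ** gam v = - (gam v ** gam w)" "gam w ** (gam v ** X) = - (gam v ** (gam w ** X))"
    if "v \<bullet> w = 0" for v w X
    using gam_anticommute[OF that] by (simp_all add: matrix_mul_assoc matrix_mult_minus)
  have sq: "gam v ** gam v = mat 1" "gam v ** (gam v ** X) = X" if "v \<bullet> v = 1" for v X
    using gam_square[OF that] by (simp_all add: matrix_mul_assoc)
  note rules = o[THEN ac(1)] o[THEN ac(2)] n(2-)[THEN ac(1)] n(2-)[THEN ac(2)] u[THEN sq(1)] u[THEN
    sq(2)]
    n(1)[THEN sq(1)] n(1)[THEN sq(2)] matrix_mult_minus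
  \<comment> \<open>Inserts n n = 1 in front and v3 v4 v4 v3 = 1 behind, so that the full Clifford
    product appears and can be replaced by 1.\<close>
  have "gam v1 ** gam v2 = gam n ** (gam n ** ((gam v1 ** gam v2) ** (gam v3 ** gam v4))) ** (gam v4 **
    gam v3)"
    by (simp add: rules matrix_mul_assoc[symmetric])
  also have "\<dots> = - (gam n ** (gam v3 ** gam v4))"
    unfolding vol by (simp add: rules)
  finally have half: "E ** (gam v1 ** gam v2) = - (E ** (gam v3 ** gam v4))"
    by (simp add: matrix_mult_minus matrix_mul_assoc EN)
  \<comment> \<open>By orthogonality each commutator is twice the product, and E has already
    absorbed the normal.\<close>
  have "- (E ** (gam v1 ** gam v2 - gam v2 ** gam v1) ** E) = E ** (gam v3 ** gam v4 - gam v4 ** gam v3)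
    ** E"
    by (simp only: ac(1)[OF o(1)] ac(1)[OF o(6)] diff_minus_eq_add matrix_add_ldistrib
        matrix_add_rdistrib half matrix_mult_minus minus_add_distrib minus_minus)
  then show "- s4_form p [v1, v2] (curv_matrix (grassmann_conn s4_e) s4_e $ i $ j) =
     s4_form p [v3, v4] (curv_matrix (grassmann_conn s4_e) s4_e $ i $ j)"
    using t by (simp add: s4_form_curvature[OF p, folded E_def] vec_eq_iff)
qed

text \<open>The coefficients 48(2a - 1) and 96 t, 96 x_k are, up to sign, 96 times the coordinates
  of p - c. With the alternating signs the sum is the Laplace expansion of the determinant whose
  first row is p - c. The term with Tr F drops out.\<close>

lemma s4_form_chern:
  assumes p: "p \<in> s4_points" and t: "v1 \<bullet> (p - s4_centre) = 0" "v2 \<bullet> (p - s4_centre) = 0"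
    "v3 \<bullet> (p - s4_centre) = 0" "v4 \<bullet> (p - s4_centre) = 0"
  defines "\<Phi> \<equiv> curv_matrix (grassmann_conn s4_e) s4_e"
  shows "s4_form p [v1, v2, v3, v4] (trace (\<Phi> ** \<Phi>) - trace \<Phi> * trace \<Phi>)
    = 96 * of_real (det (vector [p - s4_centre, v1, v2, v3, v4] :: real^5^5))"
proof -
  note ch = s4_eval(1)[OF p]
  note X = tangent_deriv(1)[OF p t(1)] tangent_deriv(1)[OF p t(2)] tangent_deriv(1)[OF p t(3)]
    tangent_deriv(1)[OF p t(4)]
  let ?Xs = "map (tangent_deriv p) [v1, v2, v3, v4]"
  have add: "form_at (s4_eval p) ?Xs (\<omega> + \<eta>) = form_at (s4_eval p) ?Xs \<omega> + form_at (s4_eval p) ?Xs \<eta>"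
    for \<omega> \<eta>
    by (rule form_at_add(1)[OF ch]) (use X in auto)
  note co = tangent_deriv(2-)[OF p t(1)] tangent_deriv(2-)[OF p t(2)] tangent_deriv(2-)[OF p t(3)]
    tangent_deriv(2-)[OF p t(4)]
  let ?w = "wedge4 (minor2 (cvec v1) (cvec v2)) (minor2 (cvec v3) (cvec v4))"
  have W: "form_at (s4_eval p) ?Xs (fn f * (dd (fn s4_t) * dd (fn (s4_x $ 1)) * dd (fn (s4_x $ 2)) * dd
    (fn (s4_x $ 3))))
      = s4_eval p f * ?w 2 3 4 5"
    "form_at (s4_eval p) ?Xs (fn f * (dd (fn s4_a) * dd (fn (s4_x $ 1)) * dd (fn (s4_x $ 2)) * dd (fn
      (s4_x $ 3))))
      = s4_eval p f * ?w 1 3 4 5"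
    "form_at (s4_eval p) ?Xs (fn f * (dd (fn s4_a) * dd (fn s4_t) * dd (fn (s4_x $ 2)) * dd (fn (s4_x $
      3))))
      = s4_eval p f * ?w 1 2 4 5"
    "form_at (s4_eval p) ?Xs (fn f * (dd (fn s4_a) * dd (fn s4_t) * dd (fn (s4_x $ 1)) * dd (fn (s4_x $
      3))))
      = s4_eval p f * ?w 1 2 3 5"
    "form_at (s4_eval p) ?Xs (fn f * (dd (fn s4_a) * dd (fn s4_t) * dd (fn (s4_x $ 1)) * dd (fn (s4_x $
      2))))
      = s4_eval p f * ?w 1 2 3 4" for f
    by (simp_all only: list.map form_at_4[OF ch X] co wedge4_def minor2_def cvec_def vec_lambda_beta)
  have "trace \<Phi> = 0"
    unfolding \<Phi>_def curv_matrix_grassmann(3)[OF s4_e_projection(1)] unfolding s4_e_cliff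
    by (rule cliff_d_matrix(2))
  moreover have "trace (\<Phi> ** \<Phi>) = fn (48 * (2 * s4_a - 1)) * (dd (fn s4_t) * dd (fn (s4_x $ 1)) * dd (fn
    (s4_x $ 2)) * dd (fn (s4_x $ 3)))
       + fn (- 96 * s4_t) * (dd (fn s4_a) * dd (fn (s4_x $ 1)) * dd (fn (s4_x $ 2)) * dd (fn (s4_x $ 3)))
       + fn (96 * s4_x $ 1) * (dd (fn s4_a) * dd (fn s4_t) * dd (fn (s4_x $ 2)) * dd (fn (s4_x $ 3)))
       + fn (- 96 * s4_x $ 2) * (dd (fn s4_a) * dd (fn s4_t) * dd (fn (s4_x $ 1)) * dd (fn (s4_x $ 3)))
       + fn (96 * s4_x $ 3) * (dd (fn s4_a) * dd (fn s4_t) * dd (fn (s4_x $ 1)) * dd (fn (s4_x $ 2)))"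
    unfolding \<Phi>_def curv_matrix_grassmann(4)[OF s4_e_projection(1)] unfolding s4_e_cliff
    by (rule cliff_d_matrix(3))
  ultimately have "s4_form p [v1, v2, v3, v4] (trace (\<Phi> ** \<Phi>) - trace \<Phi> * trace \<Phi>)
    = 96 * det (vector [cvec (p - s4_centre), cvec v1, cvec v2, cvec v3, cvec v4] :: complex^5^5)"
    unfolding det_5_laplace
    by (simp only: s4_form_def add W mult_zero_left diff_zero alg_homD[OF ch] alg_hom_numeral[OF ch]
      s4_eval[OF p])
       (simp add: cvec_def s4_centre_def vec5_simps algebra_simps)
  also have "det (vector [cvec (p - s4_centre), cvec v1, cvec v2, cvec v3, cvec v4] :: complex^5^5)
      = of_real (det (vector [p - s4_centre, v1, v2, v3, v4] :: real^5^5))"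
    by (simp add: det_5_laplace wedge4_def minor2_def cvec_def)
  finally show ?thesis .
qed

section \<open>Rank of the bundle\<close>

lemma vec_independent_pair:
  fixes v w :: "'a::field^'n"
  assumes "v $ i \<noteq> 0" "w $ i = 0" "w $ j \<noteq> 0"
  shows "vec.independent {v, w}" "card {v, w} = 2"
proof -
  have "v \<noteq> w" using assms by auto
  then show "card {v, w} = 2" by simp
  have "w \<noteq> 0" using assms by auto
  moreover have "v \<notin> vec.span {w}"
    using assms by (auto simp: vec.span_singleton)
  ultimately show "vec.independent {v, w}"
    by (simp add: vec.independent_insert)
qed

lemma rank_eq_2I:
  fixes A :: "'a::field^'n^'m"
  assumes ind: "A $ r $ i \<noteq> 0" "A $ s $ i = 0" "A $ s $ j \<noteq> 0"
    and span: "\<And>k. \<exists>c d. A $ k = c *s A $ r + d *s A $ s"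
  shows "rank A = 2"
  unfolding row_rank_def_gen
proof (rule vec.dim_unique)
  show "{A $ r, A $ s} \<subseteq> rows A" by (auto simp: rows_def row_def vec_eq_iff)
  show "rows A \<subseteq> vec.span {A $ r, A $ s}"
  proof
    fix v assume "v \<in> rows A"
    then obtain k where "v = A $ k" by (auto simp: rows_def row_def vec_eq_iff)
    then obtain c d where "v = c *s A $ r + d *s A $ s" using span by blast
    then show "v \<in> vec.span {A $ r, A $ s}"
      by (simp add: vec.span_add vec.span_scale vec.span_base)
  qed
qed (use vec_independent_pair[OF ind] in auto)

text \<open>Where a is nonzero the upper two rows begin with a times the unit matrix and the lower
  two are combinations of them, by the sphere equation. At a = 0 that equation forces t = x = 0 and
  e = diag(0, 0, 1, 1), so the lower two rows have to be used instead.\<close>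

lemma rank_s4_e:
  assumes p: "p \<in> s4_points"
  shows "rank (map_matrix (s4_eval p) s4_e) = 2"
proof -
  define a t x y z where "a = complex_of_real (p$1)" and "t = complex_of_real (p$2)"
    and "x = complex_of_real (p$3)" and "y = complex_of_real (p$4)" and "z = complex_of_real (p$5)"
  define E where "E = map_matrix (s4_eval p) s4_e"
  have E: "E = cliff \<i> a (1 - a) t x y z"
    by (simp add: E_def s4_eval_e[OF p] a_def t_def x_def y_def z_def)
  show ?thesis unfolding E_def[symmetric]
  proof (cases "p $ 1 = 0")
    case True
    then have "(p$2)\<^sup>2 + (p$3)\<^sup>2 + (p$4)\<^sup>2 + (p$5)\<^sup>2 = 0" using p by (simp add: s4_points_iff)
    then have "p$2 = 0 \<and> p$3 = 0 \<and> p$4 = 0 \<and> p$5 = 0"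
      by (simp add: add_nonneg_eq_0_iff)
    with True have z: "a = 0" "t = 0" "x = 0" "y = 0" "z = 0"
      by (simp_all add: a_def t_def x_def y_def z_def)
    show "rank E = 2"
    proof (rule rank_eq_2I[of E 3 3 4 4])
      show "\<exists>c d. E $ k = c *s E $ 3 + d *s E $ 4" for k
        using exhaust_4[of k]
        by (elim disjE)
          (rule exI[of _ "if k = 3 then 1 else 0"], rule exI[of _ "if k = 4 then 1 else 0"],
            simp add: E z cliff_def vec_eq_iff forall_4 vec4_simps)+
    qed (simp_all add: E z cliff_def vec4_simps)
  next
    case False
    then have a: "a \<noteq> 0" by (simp add: a_def)
    have "of_real ((p$2)\<^sup>2 + (p$3)\<^sup>2 + (p$4)\<^sup>2 + (p$5)\<^sup>2) = complex_of_real (p$1 * (1 - p$1))"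
      using p by (simp only: s4_points_iff)
    then have sph: "z * z = a - a * a - t * t - x * x - y * y"
      by (simp add: a_def t_def x_def y_def z_def power2_eq_square algebra_simps)
    show "rank E = 2"
    proof (rule rank_eq_2I[of E 1 1 2 2])
      fix k
      show "\<exists>c d. E $ k = c *s E $ 1 + d *s E $ 2"
        using exhaust_4[of k]
      proof (elim disjE)
        assume k: "k = 3"
        \<comment> \<open>The coefficients are the first row of (t - i x.sigma)/a; for the fourth
          row of e they are the second row.\<close>
        show ?thesis
          by (rule exI[of _ "(t - \<i> * z) / a"], rule exI[of _ "(- \<i> * x - y) / a"])
            (simp add: k E cliff_def vec_eq_iff forall_4 vec4_simps a,
             simp add: field_simps a sph)
      next
        assume k: "k = 4"
        show ?thesis
          by (rule exI[of _ "(- \<i> * x + y) / a"], rule exI[of _ "(t + \<i> * z) / a"])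
            (simp add: k E cliff_def vec_eq_iff forall_4 vec4_simps a,
             simp add: field_simps a sph)
      qed (rule exI[of _ "if k = 1 then 1 else 0"], rule exI[of _ "if k = 2 then 1 else 0"], simp)+
    qed (simp_all add: E a cliff_def vec4_simps)
  qed
qed

section \<open>The topological charge\<close>

definition embed4 :: "real^4 \<Rightarrow> real^5" where
  "embed4 y = vector [0, y$1, y$2, y$3, y$4]"

lemma bounded_linear_embed4: "bounded_linear embed4"
  by (rule linear_conv_bounded_linear[THEN iffD1], rule linearI)
    (simp_all add: embed4_def vec_eq_iff forall_5 vec5_simps)

lemma stereo_eq: "stereo y = (1 / (1 + y \<bullet> y)) *\<^sub>R (axis 1 1 + embed4 y)"
  by (simp add: stereo_def embed4_def vec_eq_iff forall_5 vec5_simps axis_def)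

lemma one_plus_inner_pos: "1 + y \<bullet> y > 0" for y :: "'a::real_inner"
  by (simp add: add_pos_nonneg)

lemma frechet_derivative_stereo:
  "frechet_derivative stereo (at y) h =
    (1 / (1 + y \<bullet> y)) *\<^sub>R embed4 h - (2 * (y \<bullet> h) / (1 + y \<bullet> y)\<^sup>2) *\<^sub>R (axis 1 1 + embed4 y)"
proof -
  have *: "1 + y \<bullet> y \<noteq> 0" using one_plus_inner_pos[of y] by simp
  have gen: "1 / c * q * (1 / c) = q / c\<^sup>2" for c q :: real
    by (simp add: divide_inverse power2_eq_square)
  have sq: "((\<lambda>y. 1 + y \<bullet> y) has_derivative (\<lambda>h. 2 * (y \<bullet> h))) (at y)"
    using has_derivative_add[OF has_derivative_const[of 1]
        has_derivative_inner[OF has_derivative_ident[of "at y"] has_derivative_ident[of "at y"]]]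
    by (simp add: inner_commute)
  note f = Deriv.has_derivative_inverse[where f = "\<lambda>y. 1 + y \<bullet> y" and x = y, OF * sq]
  have g: "((\<lambda>y. axis 1 1 + embed4 y) has_derivative embed4) (at y)"
    using has_derivative_add[OF has_derivative_const[of "axis 1 1"]
        bounded_linear.has_derivative[OF bounded_linear_embed4 has_derivative_ident]] by simp
  have "(stereo has_derivative (\<lambda>h. (1 / (1 + y \<bullet> y)) *\<^sub>R embed4 h
      - (2 * (y \<bullet> h) / (1 + y \<bullet> y)\<^sup>2) *\<^sub>R (axis 1 1 + embed4 y))) (at y)"
    using has_derivative_scaleR[OF f g]
    by (simp only: gen stereo_eq[abs_def] inverse_eq_divide scaleR_minus_left add_uminus_conv_diff)
  from fun_cong[OF frechet_derivative_at[OF this], of h] show ?thesis by (rule sym)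
qed

lemma inner_real4: "(y :: real^4) \<bullet> y = (y$1)\<^sup>2 + (y$2)\<^sup>2 + (y$3)\<^sup>2 + (y$4)\<^sup>2"
  by (simp add: inner_vec_def sum_4 power2_eq_square)

lemma stereo_in_s4: "stereo y \<in> s4_points"
proof -
  define s where "s = 1 / (1 + y \<bullet> y)"
  have s: "s * (y \<bullet> y) = 1 - s"
    using one_plus_inner_pos[of y] by (simp add: s_def field_simps)
  have st: "stereo y $ 1 = s" "stereo y $ 2 = s * y$1" "stereo y $ 3 = s * y$2" "stereo y $ 4 = s * y$3"
    "stereo y $ 5 = s * y$4"
    by (simp_all add: stereo_def vec5_simps s_def)
  have "(s * y$1)\<^sup>2 + (s * y$2)\<^sup>2 + (s * y$3)\<^sup>2 + (s * y$4)\<^sup>2 = s * (s * (y \<bullet> y))"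
    by (simp add: inner_real4 power2_eq_square algebra_simps)
  then show ?thesis by (simp add: s4_points_iff s st)
qed

lemma det_5_row_add:
  fixes n :: "real^5"
  shows "det (vector [n, a + j *s n, b + k *s n, c + l *s n, d + m *s n] :: real^5^5) = det (vector [n,
    a, b, c, d] :: real^5^5)"
proof -
  have op: "det (\<chi> k. if k = i then A $ i + c *s A $ 1 else A $ k) = det A" if "i \<noteq> 1" for i c and A ::
    "real^5^5"
  proof -
    have "row k A = A $ k" for k by (simp add: row_def vec_eq_iff)
    with det_row_operation[OF that, of A c] show ?thesis by (simp only:)
  qed
   have "det (vector [n, a + j *s n, b + k *s n, c + l *s n, d + m *s n] :: real^5^5) = det (vector [n,
     a, b + k *s n, c + l *s n, d + m *s n] :: real^5^5)" (is "_ = det ?A")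
  proof -
    have "(vector [n, a + j *s n, b + k *s n, c + l *s n, d + m *s n] :: real^5^5) = (\<chi> q. if q = 2 then
      ?A $ 2 + j *s ?A $ 1 else ?A $ q)"
      by (rule vec_eq_iff[THEN iffD2]) (simp add: forall_5 vec5_simps)
    then show ?thesis by (simp only:) (rule op, simp)
  qed
  also have "\<dots> = det (vector [n, a, b, c + l *s n, d + m *s n] :: real^5^5)" (is "_ = det ?A")
  proof -
    have "(vector [n, a, b + k *s n, c + l *s n, d + m *s n] :: real^5^5) = (\<chi> q. if q = 3 then ?A $ 3 +
      k *s ?A $ 1 else ?A $ q)"
      by (rule vec_eq_iff[THEN iffD2]) (simp add: forall_5 vec5_simps)
    then show ?thesis by (simp only:) (rule op, simp)
  qed
  also have "\<dots> = det (vector [n, a, b, c, d + m *s n] :: real^5^5)" (is "_ = det ?A")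
  proof -
    have "(vector [n, a, b, c + l *s n, d + m *s n] :: real^5^5) = (\<chi> q. if q = 4 then ?A $ 4 + l *s ?A $
      1 else ?A $ q)"
      by (rule vec_eq_iff[THEN iffD2]) (simp add: forall_5 vec5_simps)
    then show ?thesis by (simp only:) (rule op, simp)
  qed
  also have "\<dots> = det (vector [n, a, b, c, d] :: real^5^5)" (is "_ = det ?A")
  proof -
    have "(vector [n, a, b, c, d + m *s n] :: real^5^5) = (\<chi> q. if q = 5 then ?A $ 5 + m *s ?A $ 1 else
      ?A $ q)"
      by (rule vec_eq_iff[THEN iffD2]) (simp add: forall_5 vec5_simps)
    then show ?thesis by (simp only:) (rule op, simp)
  qed
  finally show ?thesis .
qed

text \<open>The parametrisation is conformal with factor s = 1/(1 + |y|^2), and the radius vector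
  has length 1/2; hence the value s^4/2.\<close>

lemma det_stereo_frame:
  defines "w \<equiv> \<lambda>y k. frechet_derivative stereo (at y) (axis k 1)"
  shows "w y k \<bullet> (stereo y - s4_centre) = 0"
    "det (vector [stereo y - s4_centre, w y 1, w y 2, w y 3, w y 4] :: real^5^5) = (1 / (1 + y \<bullet> y)) ^ 4
      / 2"
proof -
  define s where "s = 1 / (1 + y \<bullet> y)"
  define c where "c = stereo y - s4_centre"
  have s: "s * (y \<bullet> y) = 1 - s"
    using one_plus_inner_pos[of y] by (simp add: s_def field_simps)
  have c: "c = vector [s - 1/2, s * y$1, s * y$2, s * y$3, s * y$4]"
    by (simp add: c_def stereo_eq s_def s4_centre_def embed4_def vec_eq_iff forall_5 vec5_simps axis_def)
  have c': "c = s *\<^sub>R (axis 1 1 + embed4 y) - (1/2) *\<^sub>R axis 1 1"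
    by (simp add: c embed4_def vec_eq_iff forall_5 vec5_simps axis_def)
  have "w y k = s *\<^sub>R embed4 (axis k 1) - (2 * y $ k * s\<^sup>2) *\<^sub>R (axis 1 1 + embed4 y)" for k
    unfolding w_def frechet_derivative_stereo by (simp add: inner_axis s_def power_divide)
  \<comment> \<open>Modulo \<open>c\<close>, which does not affect the determinant, the frame is nearly diagonal.\<close>
  then have w: "w y k = s *\<^sub>R (embed4 (axis k 1) - (y $ k) *\<^sub>R axis 1 1) + (- 2 * y $ k * s) *s c" for k
    by (simp add: c' scalar_mult_eq_scaleR algebra_simps power2_eq_square)
  have y: "y $ 1 * y $ 1 + y $ 2 * y $ 2 + y $ 3 * y $ 3 + y $ 4 * y $ 4 = y \<bullet> y"
    by (simp add: inner_real4 power2_eq_square)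
  have cc: "c \<bullet> c = 1/4"
  proof -
    have "c \<bullet> c = (s - 1/2) * (s - 1/2) + s * (s * (y \<bullet> y))"
      by (simp add: inner_vec_def sum_5 sum_4 c vec5_simps algebra_simps)
    then show ?thesis by (simp add: s algebra_simps)
  qed
  \<comment> \<open>s y_k from the embedded axis minus (s - 1/2) y_k from the polar axis.\<close>
  have "(embed4 (axis k 1) - (y $ k) *\<^sub>R axis 1 1) \<bullet> c = y $ k / 2"
    using exhaust_4[of k]
    by (auto simp: inner_vec_def sum_5 c embed4_def vec5_simps axis_def algebra_simps)
  then have "w y k \<bullet> c = s * (y $ k / 2) - 2 * y $ k * s * (c \<bullet> c)"
    by (simp only: w scalar_mult_eq_scaleR inner_add_left inner_scaleR_left)
  then show "w y k \<bullet> (stereo y - s4_centre) = 0"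
    by (simp add: cc flip: c_def)
  have "det (vector [c, w y 1, w y 2, w y 3, w y 4] :: real^5^5)
    = det (vector [c, s *\<^sub>R (embed4 (axis 1 1) - (y $ 1) *\<^sub>R axis 1 1), s *\<^sub>R (embed4 (axis 2 1) - (y $
      2) *\<^sub>R axis 1 1),
       s *\<^sub>R (embed4 (axis 3 1) - (y $ 3) *\<^sub>R axis 1 1), s *\<^sub>R (embed4 (axis 4 1) - (y $ 4) *\<^sub>R axis 1
         1)] :: real^5^5)"
    unfolding w by (rule det_5_row_add)
  also have "\<dots> = s ^ 4 * ((s - 1/2) + s * (y $ 1 * y $ 1 + y $ 2 * y $ 2 + y $ 3 * y $ 3 + y $ 4 * y $
    4))"
    by (simp add: det_5_laplace wedge4_def minor2_def c embed4_def vec5_simps axis_def power4_eq_xxxx)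
       (simp add: algebra_simps)
  also have "\<dots> = s ^ 4 / 2"
    unfolding y s by simp
  finally show "det (vector [stereo y - s4_centre, w y 1, w y 2, w y 3, w y 4] :: real^5^5) = (1 / (1 + y
    \<bullet> y)) ^ 4 / 2"
    by (simp add: s_def c_def)
qed

text \<open>The value is the area 8 pi^2/3 of the unit 4-sphere times (1/2)^4. Slicing by the height
  of the density needs only the volume pi^2/2 r^4 of a ball in dimension 4, and no polar
  coordinates.\<close>

lemma nn_integral_sphere_density:
  "(\<integral>\<^sup>+ y. ennreal ((1 / (1 + y \<bullet> y)) ^ 4) \<partial>(lborel :: (real^4) measure)) = ennreal (pi\<^sup>2 / 6)"
proof -
  \<comment> \<open>Minus the derivative of (1 + r^2)^(-4); integrated from |y| to infinity it
    returns the density at y.\<close>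
  define f :: "real \<Rightarrow> real" where "f r = 8 * r * inverse (1 + r\<^sup>2) ^ 5" for r
  have pos: "1 + r\<^sup>2 > 0" for r :: real by (simp add: add_pos_nonneg)
  have inv: "((\<lambda>r. inverse (1 + r\<^sup>2)) has_real_derivative - (2 * r) * (inverse (1 + r\<^sup>2))\<^sup>2) (at r)"
    for r :: real
    using pos[of r] by (auto intro!: derivative_eq_intros simp: power2_eq_square)
  have [measurable]: "f \<in> borel_measurable borel" unfolding f_def by measurable
  \<comment> \<open>Layer-cake decomposition, reducing the integral to the volume of balls.\<close>
  have shell: "ennreal ((1 / (1 + y \<bullet> y)) ^ 4) = (\<integral>\<^sup>+ r. ennreal (f r) * indicator {norm y ..} r
    \<partial>lborel)"
    for y :: "real^4"
  proof -
    let ?F = "\<lambda>r::real. - (inverse (1 + r\<^sup>2) ^ 4)"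
    have "(\<integral>\<^sup>+ r. ennreal (f r) * indicator {norm y ..} r \<partial>lborel) = ennreal (0 - ?F (norm y))"
    proof (rule nn_integral_FTC_atLeast)
      fix r :: real assume "norm y \<le> r"
      then have "r \<ge> 0" using norm_ge_zero[of y] by linarith
      then show "f r \<ge> 0" using pos[of r] by (simp add: f_def)
      show "(?F has_real_derivative f r) (at r)"
        by (rule derivative_eq_intros inv refl)+ (simp add: f_def eval_nat_numeral)
    next
      show "(?F \<longlongrightarrow> 0) at_top" by real_asymp
    qed measurable
    then show ?thesis by (simp add: inverse_eq_divide power2_norm_eq_inner)
  qed
  have "pair_sigma_finite (lborel :: (real^4) measure) (lborel :: real measure)"
    by (simp add: pair_sigma_finite_def lborel.sigma_finite_measure_axioms)
  note fubini = pair_sigma_finite.Fubini'[OF this]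
  have "(\<integral>\<^sup>+ y. ennreal ((1 / (1 + y \<bullet> y)) ^ 4) \<partial>(lborel :: (real^4) measure))
    = (\<integral>\<^sup>+ y. \<integral>\<^sup>+ r. ennreal (f r) * indicator {z. norm (fst z) \<le> snd z} (y, r) \<partial>lborel \<partial>(lborel ::
      (real^4) measure))"
    unfolding shell by (intro nn_integral_cong) (auto split: split_indicator)
  also have "\<dots> = (\<integral>\<^sup>+ r. \<integral>\<^sup>+ y. ennreal (f r) * indicator {z. norm (fst z) \<le> snd z} (y, r) \<partial>(lborel ::
    (real^4) measure) \<partial>lborel)"
    by (rule fubini[symmetric]) measurable
  also have "\<dots> = (\<integral>\<^sup>+ r. ennreal (4 * pi\<^sup>2 * r ^ 5 / (1 + r\<^sup>2) ^ 5) * indicator {0..} r \<partial>lborel)"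
  proof (intro nn_integral_cong)
    fix r :: real
    have "(\<integral>\<^sup>+ y. ennreal (f r) * indicator {z. norm (fst z) \<le> snd z} (y, r) \<partial>(lborel :: (real^4)
      measure))
      = ennreal (f r) * (\<integral>\<^sup>+ y. indicator (cball 0 r) y \<partial>(lborel :: (real^4) measure))"
      by (subst nn_integral_cmult[symmetric]) (auto intro!: nn_integral_cong borel_measurable_indicator
        split: split_indicator)
    also have "\<dots> = ennreal (f r) * emeasure lborel (cball (0 :: real^4) r)"
      by simp
    also have "\<dots> = ennreal (4 * pi\<^sup>2 * r ^ 5 / (1 + r\<^sup>2) ^ 5) * indicator {0..} r"
    proof (cases "r \<ge> 0")
      case True
      then have vol: "emeasure lborel (cball (0 :: real^4) r) = ennreal (pi\<^sup>2 / 2 * r ^ 4)"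
        by (simp add: emeasure_cball unit_ball_vol_numeral fact_numeral)
      have "8 * r * inverse c ^ 5 * (pi\<^sup>2 / 2 * r ^ 4) = 4 * pi\<^sup>2 * r ^ 5 / c ^ 5" for c :: real
        unfolding power_inverse divide_inverse by (simp add: eval_nat_numeral)
      then have prod: "f r * (pi\<^sup>2 / 2 * r ^ 4) = 4 * pi\<^sup>2 * r ^ 5 / (1 + r\<^sup>2) ^ 5" by (simp only: f_def)
      have "0 \<le> f r" using True pos[of r] by (simp add: f_def)
      then have "ennreal (f r) * ennreal (pi\<^sup>2 / 2 * r ^ 4) = ennreal (f r * (pi\<^sup>2 / 2 * r ^ 4))"
        by (intro ennreal_mult[symmetric]) simp_all
      then show ?thesis
        unfolding vol prod using True by simp
    next
      case False
      then show ?thesis by simp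
    qed
    finally show "(\<integral>\<^sup>+ y. ennreal (f r) * indicator {z. norm (fst z) \<le> snd z} (y, r) \<partial>(lborel :: (real^4)
      measure))
      = ennreal (4 * pi\<^sup>2 * r ^ 5 / (1 + r\<^sup>2) ^ 5) * indicator {0..} r" .
  qed
  also have "\<dots> = ennreal (pi\<^sup>2 / 6 - 0)"
  proof -
    \<comment> \<open>Substitution u = r^2/(1 + r^2) with du = 2 r/(1 + r^2)^2 dr turns the
      integrand into 2 pi^2 u^2 (1 - u) du on [0, 1], and 1/3 - 1/4 = 1/12.\<close>
    let ?u = "\<lambda>r::real. 1 - inverse (1 + r\<^sup>2)"
    let ?G = "\<lambda>r. 2 * pi\<^sup>2 * ((?u r) ^ 3 / 3 - (?u r) ^ 4 / 4)"
    have G: "((\<lambda>r. 2 * pi\<^sup>2 * (g r ^ 3 / 3 - g r ^ 4 / 4)) has_real_derivative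
        2 * pi\<^sup>2 * ((g r)\<^sup>2 * (1 - g r)) * D) (at r)"
      if "(g has_real_derivative D) (at r)" for g :: "real \<Rightarrow> real" and D r
      using that by (auto intro!: derivative_eq_intros simp: algebra_simps eval_nat_numeral)
    have "(\<integral>\<^sup>+ r. ennreal (4 * pi\<^sup>2 * r ^ 5 / (1 + r\<^sup>2) ^ 5) * indicator {0..} r \<partial>lborel) = ennreal (pi\<^sup>2
      / 6 - ?G 0)"
    proof (rule nn_integral_FTC_atLeast)
      fix r :: real assume "0 \<le> r"
      then show "0 \<le> 4 * pi\<^sup>2 * r ^ 5 / (1 + r\<^sup>2) ^ 5" using pos[of r] by simp
      have u: "(?u has_real_derivative 2 * r * (inverse (1 + r\<^sup>2))\<^sup>2) (at r)"
        by (rule derivative_eq_intros inv refl)+ simp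
      have "(?G has_real_derivative 2 * pi\<^sup>2 * ((?u r)\<^sup>2 * (1 - ?u r)) * (2 * r * (inverse (1 + r\<^sup>2))\<^sup>2))
        (at r)"
        by (rule G[OF u])
      moreover have "1 - ?u r = inverse (1 + r\<^sup>2)" by simp
      moreover have "?u r = r\<^sup>2 / (1 + r\<^sup>2)" using pos[of r] by (simp add: field_simps)
      moreover have "2 * pi\<^sup>2 * ((r\<^sup>2 / c)\<^sup>2 * inverse c) * (2 * r * (inverse c)\<^sup>2) = 4 * pi\<^sup>2 * r ^ 5 /
        c ^ 5" for c :: real
        by (simp add: divide_inverse eval_nat_numeral)
      ultimately show "(?G has_real_derivative 4 * pi\<^sup>2 * r ^ 5 / (1 + r\<^sup>2) ^ 5) (at r)" by (simp only:)
    next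
      have "(?u \<longlongrightarrow> 1) at_top" by real_asymp
      then have "(?G \<longlongrightarrow> 2 * pi\<^sup>2 * (1 ^ 3 / 3 - 1 ^ 4 / 4)) at_top"
        by (intro tendsto_intros) auto
      then show "(?G \<longlongrightarrow> pi\<^sup>2 / 6) at_top" by simp
    qed measurable
    then show ?thesis by simp
  qed
  finally show ?thesis by simp
qed

lemma integral_sphere_density:
  "(LINT y|lborel. complex_of_real (48 * (1 / (1 + y \<bullet> (y :: real^4))) ^ 4)) = of_real (8 * pi\<^sup>2)"
proof -
  have "has_bochner_integral lborel (\<lambda>y :: real^4. (1 / (1 + y \<bullet> y)) ^ 4) (pi\<^sup>2 / 6)"
    by (rule has_bochner_integral_nn_integral)
      (simp_all add: nn_integral_sphere_density one_plus_inner_pos less_imp_le)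
  then have "has_bochner_integral lborel (\<lambda>y :: real^4. complex_of_real (48 * (1 / (1 + y \<bullet> y)) ^ 4))
    (of_real (48 * (pi\<^sup>2 / 6)))"
    by (intro has_bochner_integral_of_real has_bochner_integral_mult_right)
  moreover have "48 * (pi\<^sup>2 / 6) = 8 * pi\<^sup>2" by simp
  ultimately show ?thesis by (simp only: has_bochner_integral_integral_eq)
qed

lemma second_chern_number_s4_e:
  "second_chern_number (curv_matrix (grassmann_conn s4_e) s4_e) = 1"
proof -
  \<comment> \<open>The 48 is the 96 of \<open>s4_form_chern\<close> times the 1/2 of
    \<open>det_stereo_frame\<close>.\<close>
  have "s4_integral (trace (curv_matrix (grassmann_conn s4_e) s4_e ** curv_matrix (grassmann_conn s4_e)
    s4_e)
      - trace (curv_matrix (grassmann_conn s4_e) s4_e) * trace (curv_matrix (grassmann_conn s4_e) s4_e))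
    = (LINT y|lborel. complex_of_real (48 * (1 / (1 + y \<bullet> (y :: real^4))) ^ 4))"
    unfolding s4_integral_def
    by (rule Bochner_Integration.integral_cong) (simp_all add: s4_form_chern stereo_in_s4
      det_stereo_frame)
  then show ?thesis
    by (simp only: second_chern_number_def integral_sphere_density of_real_mult[symmetric]) simp
qed

theorem proposition3p2:
  shows
    "star_alg_hom s4_proj \<and> surj s4_proj
        \<and> (\<forall>f. s4_proj f = 0 \<longleftrightarrow> f \<in> ideal_gen s4_rels)
     \<and> bij_betw char_coords {ch. star_alg_hom ch} s4_points
     \<and> map_matrix s4_proj cm_P =
         block (mat s4_a) (pauli_comb s4_t \<i> s4_x)
               (pauli_comb s4_t (- \<i>) s4_x) (mat (1 - s4_a))
     \<and> s4_e ** s4_e = s4_e \<and> dagger s4_e = s4_e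
     \<and> is_one_instanton s4_e (grassmann_conn s4_e)
     \<and> (\<forall>(\<phi> :: s4 \<Rightarrow> 'b::complex_algebra) u. alg_hom \<phi> \<longrightarrow> \<phi> (1 - 2 * s4_a) * u = 1 \<longrightarrow>
          (let e = map_matrix \<phi> s4_e; F = curvature (grassmann_conn e); d = (\<lambda>f. dd (fn (\<phi> f)))
           in \<forall>v :: 'b^4.
                F (F (row_mult (fn_row v) (map_matrix fn e))) =
                (\<chi> i. - of_nat (fact 4) * fn u * (d s4_t * (d (s4_x $ 1) * d (s4_x $ 2) * d (s4_x $ 3)))
                       * row_mult (fn_row v) (map_matrix fn e) $ i)))"
proof (intro conjI allI impI)
  show "is_one_instanton s4_e (grassmann_conn s4_e)"
    unfolding is_one_instanton_def
    using rank_s4_e anti_self_dual_curvature second_chern_number_s4_e by auto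
next
  \<comment> \<open>The homomorphism transports the projector, its idempotency and the sphere
    equation, so the local form over the target algebra is an instance of
    \<open>cliff_local_form\<close>.\<close>
  fix \<phi> :: "s4 \<Rightarrow> 'b" and u
  assume \<phi>: "alg_hom \<phi>" and u: "\<phi> (1 - 2 * s4_a) * u = 1"
  note h = alg_homD[OF \<phi>] alg_hom_numeral[OF \<phi>]
  have e: "map_matrix \<phi> s4_e ** map_matrix \<phi> s4_e = map_matrix \<phi> s4_e"
    by (simp add: s4_e_projection flip: map_matrix_alg_hom_mult[OF \<phi>])
  have c: "map_matrix \<phi> s4_e = cliff (scal \<i>) (\<phi> s4_a) (1 - \<phi> s4_a) (\<phi> s4_t) (\<phi> (s4_x $ 1))
      (\<phi> (s4_x $ 2)) (\<phi> (s4_x $ 3))"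
    by (simp add: s4_e_cliff map_matrix_cliff[OF \<phi>] h)
  have "(1 - 2 * \<phi> s4_a) * u = 1" using u by (simp add: h)
  moreover have "\<phi> s4_t * \<phi> s4_t + \<phi> (s4_x $ 1) * \<phi> (s4_x $ 1) + \<phi> (s4_x $ 2) * \<phi> (s4_x $ 2)
      + \<phi> (s4_x $ 3) * \<phi> (s4_x $ 3) = \<phi> s4_a * (1 - \<phi> s4_a)"
    using arg_cong[OF s4_relation, of \<phi>] by (simp add: h)
  ultimately show "let e = map_matrix \<phi> s4_e; F = curvature (grassmann_conn e); d = (\<lambda>f. dd (fn (\<phi> f)))
     in \<forall>v :: 'b^4. F (F (row_mult (fn_row v) (map_matrix fn e))) =
          (\<chi> i. - of_nat (fact 4) * fn u * (d s4_t * (d (s4_x $ 1) * d (s4_x $ 2) * d (s4_x $ 3)))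
             * row_mult (fn_row v) (map_matrix fn e) $ i)"
    using cliff_local_form[OF _ _ e c] by (simp add: Let_def fact_numeral)
qed (use star_alg_hom_s4_proj surj_s4_proj s4_proj_eq_0_iff bij_betw_char_coords map_matrix_s4_proj_cm_P
    s4_e_projection in auto)

end
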